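(* Let $(H,S,\alpha)$ be a finite-dimensional Hom-Hopf algebra with $\alpha$ bijective, let $\{e_i\}$ be a basis of $H$ and $\{e^i\}$ its dual basis in $H^*$. Then the Drinfel'd double $(H^{op}\bowtie H^*,\alpha\otimes(\alpha^{-1})^* )$ is a quasitriangular Hom-bialgebra with quasitriangular structure $$R=\sum_i\big(1\bowtie(\alpha^{-1})^*(e^i)\big)\otimes\big(S^{-1}(e_i)\bowtie\varepsilon\big).$$
   Context: Everything is over a fixed field $k$. Sweedler notation $\Delta(c)=c_1\otimes c_2$, $\Delta(c_2)=c_{21}\otimes c_{22}$ etc. (summation omitted). A (unital) Hom-associative algebra is $(A,\mu,\alpha)$ with $\mu(a\otimes b)=ab$, $1_A\in A$, such that $\alpha(ab)=\alpha(a)\alpha(b)$, $\alpha(1_A)=1_A$, $1_Aa=\alpha(a)=a1_A$, $\alpha(a)(bc)=(ab)\alpha(c)$. A (counital) Hom-coassociative coalgebra is $(C,\Delta,\varepsilon,\alpha)$ with $\varepsilon\circ\alpha=\varepsilon$, $(\alpha\otimes\alpha)\Delta=\Delta\alpha$, $(\varepsilon\otimes id)\Delta=\alpha=(id\otimes\varepsilon)\Delta$, $(\Delta\otimes\alpha)\Delta=(\alpha\otimes\Delta)\Delta$. A Hom-bialgebra is both, with the same $\alpha$, such that $\Delta$ and $\varepsilon$ are unital and multiplicative. A Hom-Hopf algebra is a Hom-bialgebra with a linear map $S$ such that $S\alpha=\alpha S$ and $S(h_1)h_2=h_1S(h_2)=\varepsilon(h)1$. (For $H$ finite-dimensional with $\alpha$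 bijective, $S$ is bijective.) A Hom-bialgebra $(D,\alpha_D)$ is quasitriangular with structure $R\in D\otimes D$ if $\Delta^{op}(x)R=R\Delta(x)$ for all $x\in D$, $(\Delta\otimes\alpha_D)R=R^{13}R^{23}$ and $(\alpha_D\otimes\Delta)R=R^{13}R^{12}$, where products in $D\otimes D$ and $D^{\otimes3}$ are componentwise, and for $R=\sum r\otimes r'$, $R^{12}=\sum r\otimes r'\otimes1$, $R^{13}=\sum r\otimes1\otimes r'$, $R^{23}=\sum1\otimes r\otimes r'$. The dual $H^*$ has structure map $(\alpha^{-1})^*$ ($f\mapsto f\circ\alpha^{-1}$), product $(f\bullet g)(h)=f(\alpha^{-2}(h_1))g(\alpha^{-2}(h_2))$ (written $fg$), unit $\varepsilon$, coproduct determined by $f_1(h)f_2(k)=f(\alpha^{-2}(hk))$, counit $f\mapsto f(1)$. Write $\alpha^*(f)=f\circ\alpha$, $\langle f\leftharpoonup h,k\rangle=\langle f,h\alpha^{-2}(k)\rangle$, $\langle h\rightharpoonup f,k\rangle=\langle f,\alpha^{-2}(k)h\rangle$. The Drinfel'd double $H^{op}\bowtie H^*$ is the space $H\otimes H^*$ (elements $h\bowtie f=h\otimes f$) with structure map $\alpha\otimes(\alpha^{-1})^*$, unit $1\bowtie\varepsilon$, counit $\varepsilon(h)f(1)$, comultiplication $\Delta(h\otimes f)=h_1\otimes f_1\otimes h_2\otimes f_2$ and multiplication $$(h\otimes f)(k\otimes g)=\alpha^{-2}(k_{21})h\otimes\big[\alpha^{-3}(k_{22})\rightharpoonup\big((\alpha^*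 )^2(f)\leftharpoonup S\alpha^{-3}(k_1)\big)\big]g,$$ where $\alpha^{-2}(k_{21})h$ is the product of $H$. *)

theory Defs
  imports Complex_Main "HOL-Library.Function_Algebras"
begin

section \<open>Vector spaces and linear maps\<close>

text \<open>
  A vector space is a linear subspace \<open>carr V\<close> of an ambient vector space that fills a
  whole type.
\<close>

record ('k, 'a) vsp =
  carr :: "'a set"
  smul :: "'k \<Rightarrow> 'a \<Rightarrow> 'a"

definition is_vsp :: "('k::field, 'a::ab_group_add, 'm) vsp_scheme \<Rightarrow> bool" where
  "is_vsp V \<longleftrightarrow> vector_space (smul V) \<and> module.subspace (smul V) (carr V)"

definition base_field :: "('k::field, 'k) vsp" where
  "base_field = \<lparr>carr = UNIV, smul = (*)\<rparr>"

definition linear_on ::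
  "('k::field, 'a::ab_group_add, 'm) vsp_scheme \<Rightarrow> ('k, 'b::ab_group_add, 'n) vsp_scheme
    \<Rightarrow> ('a \<Rightarrow> 'b) \<Rightarrow> bool" where
  "linear_on V W f \<longleftrightarrow>
     (\<forall>x\<in>carr V. f x \<in> carr W) \<and>
     (\<forall>x\<in>carr V. \<forall>y\<in>carr V. f (x + y) = f x + f y) \<and>
     (\<forall>c. \<forall>x\<in>carr V. f (smul V c x) = smul W c (f x))"

definition bilinear_on ::
  "('k::field, 'a::ab_group_add, 'm) vsp_scheme \<Rightarrow> ('k, 'b::ab_group_add, 'n) vsp_scheme
    \<Rightarrow> ('k, 'c::ab_group_add, 'l) vsp_scheme \<Rightarrow> ('a \<Rightarrow> 'b \<Rightarrow> 'c) \<Rightarrow> bool" where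
  "bilinear_on V W X f \<longleftrightarrow>
     (\<forall>v\<in>carr V. linear_on W X (f v)) \<and> (\<forall>w\<in>carr W. linear_on V X (\<lambda>v. f v w))"


section \<open>The tensor product of two vector spaces\<close>

text \<open>
  The pure tensor of \<open>v\<close> and \<open>w\<close> is realised as evaluation of bilinear forms at
  \<open>(v, w)\<close>, and the tensor product as the span of the pure tensors. It has the universal
  property for bilinear maps into arbitrary vector spaces (theorem \<open>tensor_universal\<close>).
  The forms used as arguments are only required to be bilinear on \<open>carr V \<times> carr W\<close>.
\<close>

definition tens ::
  "('k::field, 'a::ab_group_add, 'm) vsp_scheme \<Rightarrow> ('k, 'b::ab_group_add, 'n) vsp_scheme
    \<Rightarrow> 'a \<Rightarrow> 'b \<Rightarrow> ('a \<Rightarrow> 'b \<Rightarrow> 'k) \<Rightarrow> 'k" where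
  "tens V W v w = (\<lambda>b. if bilinear_on V W base_field b then b v w else 0)"

definition fun_smul :: "'k::times \<Rightarrow> ('x \<Rightarrow> 'k) \<Rightarrow> 'x \<Rightarrow> 'k" where
  "fun_smul c t = (\<lambda>b. c * t b)"

definition tensor ::
  "('k::field, 'a::ab_group_add, 'm) vsp_scheme \<Rightarrow> ('k, 'b::ab_group_add, 'n) vsp_scheme
    \<Rightarrow> ('k, ('a \<Rightarrow> 'b \<Rightarrow> 'k) \<Rightarrow> 'k) vsp" where
  "tensor V W =
     \<lparr>carr = module.span fun_smul {tens V W v w | v w. v \<in> carr V \<and> w \<in> carr W},
      smul = fun_smul\<rparr>"

text \<open>
  \<open>tlift V W f\<close> is the linear map on the tensor product induced by a map \<open>f\<close> that is
  bilinear on \<open>V \<times> W\<close>: it sends a finite sum of pure tensors \<open>v \<otimes> w\<close> to the sum of the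
  \<open>f v w\<close>. Theorem \<open>tensor_universal\<close> shows that the result does not depend on the
  chosen representation.
\<close>

definition tlift ::
  "('k::field, 'a::ab_group_add, 'm) vsp_scheme \<Rightarrow> ('k, 'b::ab_group_add, 'n) vsp_scheme
    \<Rightarrow> ('a \<Rightarrow> 'b \<Rightarrow> 'c::ab_group_add) \<Rightarrow> (('a \<Rightarrow> 'b \<Rightarrow> 'k) \<Rightarrow> 'k) \<Rightarrow> 'c" where
  "tlift V W f t =
     (SOME x. \<exists>ps. set ps \<subseteq> carr V \<times> carr W \<and>
        t = (\<Sum>(v, w)\<leftarrow>ps. tens V W v w) \<and> x = (\<Sum>(v, w)\<leftarrow>ps. f v w))"

definition tmap ::
  "('k::field, 'a::ab_group_add, 'm) vsp_scheme \<Rightarrow> ('k, 'b::ab_group_add, 'n) vsp_scheme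
    \<Rightarrow> ('k, 'c::ab_group_add, 'p) vsp_scheme \<Rightarrow> ('k, 'd::ab_group_add, 'q) vsp_scheme
    \<Rightarrow> ('a \<Rightarrow> 'c) \<Rightarrow> ('b \<Rightarrow> 'd)
    \<Rightarrow> (('a \<Rightarrow> 'b \<Rightarrow> 'k) \<Rightarrow> 'k) \<Rightarrow> (('c \<Rightarrow> 'd \<Rightarrow> 'k) \<Rightarrow> 'k)" where
  "tmap V W V' W' f g = tlift V W (\<lambda>v w. tens V' W' (f v) (g w))"

definition tflip ::
  "('k::field, 'a::ab_group_add, 'm) vsp_scheme \<Rightarrow> ('k, 'b::ab_group_add, 'n) vsp_scheme
    \<Rightarrow> (('a \<Rightarrow> 'b \<Rightarrow> 'k) \<Rightarrow> 'k) \<Rightarrow> (('b \<Rightarrow> 'a \<Rightarrow> 'k) \<Rightarrow> 'k)" where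
  "tflip V W = tlift V W (\<lambda>v w. tens W V w v)"

text \<open>The canonical isomorphism from \<open>(U \<otimes> V) \<otimes> W\<close> to \<open>U \<otimes> (V \<otimes> W)\<close>.\<close>

definition tassoc where
  "tassoc U V W =
     tlift (tensor U V) W
       (\<lambda>t w. tlift U V (\<lambda>u v. tens U (tensor V W) u (tens V W v w)) t)"

text \<open>Componentwise product, for products \<open>m\<close> on \<open>V\<close> and \<open>n\<close> on \<open>W\<close>.\<close>

definition tmul where
  "tmul V W m n s t =
     tlift V W (\<lambda>v w. tlift V W (\<lambda>v' w'. tens V W (m v v') (n w w')) t) s"


subsection \<open>Universal property\<close>

lemma linear_onD:
  assumes "linear_on V W f"
  shows "x \<in> carr V \<Longrightarrow> f x \<in> carr W"
    and "x \<in> carr V \<Longrightarrow> y \<in> carr V \<Longrightarrow> f (x + y) = f x + f y"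
    and "x \<in> carr V \<Longrightarrow> f (smul V c x) = smul W c (f x)"
  using assms by (auto simp: linear_on_def)

lemma vector_space_fun_smul: "vector_space (fun_smul :: 'k::field \<Rightarrow> ('x \<Rightarrow> 'k) \<Rightarrow> _)"
  by unfold_locales (auto simp: fun_smul_def fun_eq_iff algebra_simps)

lemma is_vsp_base_field: "is_vsp (base_field :: ('k::field, 'k) vsp)"
proof -
  interpret vector_space "(*) :: 'k \<Rightarrow> 'k \<Rightarrow> 'k"
    by unfold_locales (auto simp: algebra_simps)
  show ?thesis
    by (auto simp: is_vsp_def base_field_def subspace_def intro: vector_space_axioms)
qed

lemma module_fun_smul: "module (fun_smul :: 'k::field \<Rightarrow> ('x \<Rightarrow> 'k) \<Rightarrow> _)"
  by unfold_locales (auto simp: fun_smul_def fun_eq_iff algebra_simps)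

lemma is_vsp_tensor: "is_vsp (tensor V W)"
  by (simp add: is_vsp_def tensor_def vector_space_fun_smul module.subspace_span[OF module_fun_smul])

lemma is_vspD:
  assumes "is_vsp V"
  shows "0 \<in> carr V" "x \<in> carr V \<Longrightarrow> y \<in> carr V \<Longrightarrow> x + y \<in> carr V"
    "x \<in> carr V \<Longrightarrow> smul V c x \<in> carr V" "vector_space (smul V)" "module (smul V)"
proof -
  from assms have vs: "vector_space (smul V)" and sub: "module.subspace (smul V) (carr V)"
    by (auto simp: is_vsp_def)
  interpret vector_space "smul V" by (rule vs)
  show "0 \<in> carr V" "x \<in> carr V \<Longrightarrow> y \<in> carr V \<Longrightarrow> x + y \<in> carr V"
    "x \<in> carr V \<Longrightarrow> smul V c x \<in> carr V" "vector_space (smul V)" "module (smul V)"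
    using sub vs module_axioms by (auto simp: subspace_def)
qed

lemma linear_functional_separates:
  fixes V :: "('k::field, 'a::ab_group_add, 'm) vsp_scheme"
  assumes "is_vsp V" "\<And>\<phi>. linear_on V base_field \<phi> \<Longrightarrow> \<phi> x = \<phi> y"
  shows "x = y"
proof (rule ccontr)
  assume ne: "x \<noteq> y"
  interpret vector_space "smul V" using is_vspD(4)[OF assms(1)] .
  interpret K: vector_space "(*) :: 'k \<Rightarrow> 'k \<Rightarrow> 'k"
    by unfold_locales (auto simp: algebra_simps)
  interpret VK: vector_space_pair "smul V" "(*) :: 'k \<Rightarrow> 'k \<Rightarrow> 'k" ..
  have "independent {x - y}" using ne by (simp add: dependent_single)
  from VK.linear_independent_extend[OF this, of "\<lambda>_. 1"]
  obtain g where g: "Vector_Spaces.linear (smul V) (*) g" "g (x - y) = 1" by auto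
  interpret g: Vector_Spaces.linear "smul V" "(*)" g by (rule g(1))
  have "linear_on V base_field g"
    by (auto simp: linear_on_def base_field_def g.add g.scale)
  from assms(2)[OF this] have "g (x - y) = 0" by (simp add: g.diff)
  with g(2) show False by simp
qed

lemma bilinear_on_compose:
  assumes "bilinear_on V W X f" "linear_on X Y \<phi>"
  shows "bilinear_on V W Y (\<lambda>v w. \<phi> (f v w))"
  using assms unfolding bilinear_on_def linear_on_def by simp

lemma sum_list_fun_apply:
  "(\<Sum>p\<leftarrow>ps. (F p :: 'x \<Rightarrow> 'b::comm_monoid_add)) b = (\<Sum>p\<leftarrow>ps. F p b)"
  by (induction ps) (auto)

lemma linear_on_sum_list:
  assumes "is_vsp V" "is_vsp W" "linear_on V W f" "\<And>p. p \<in> set ps \<Longrightarrow> g p \<in> carr V"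
  shows "f (\<Sum>p\<leftarrow>ps. g p) = (\<Sum>p\<leftarrow>ps. f (g p))" "(\<Sum>p\<leftarrow>ps. g p) \<in> carr V"
proof -
  have f0: "f 0 = 0"
    using linear_onD(2)[OF assms(3), of 0 0] is_vspD(1)[OF assms(1)] by simp
  have "f (\<Sum>p\<leftarrow>ps. g p) = (\<Sum>p\<leftarrow>ps. f (g p)) \<and> (\<Sum>p\<leftarrow>ps. g p) \<in> carr V"
    using assms(4)
    by (induction ps) (auto simp: f0 is_vspD[OF assms(1)] linear_onD[OF assms(3)])
  then show "f (\<Sum>p\<leftarrow>ps. g p) = (\<Sum>p\<leftarrow>ps. f (g p))" "(\<Sum>p\<leftarrow>ps. g p) \<in> carr V" by auto
qed

lemma tens_in: "v \<in> carr V \<Longrightarrow> w \<in> carr W \<Longrightarrow> tens V W v w \<in> carr (tensor V W)"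
  unfolding tensor_def
  by (auto intro!: module.span_base[OF module_fun_smul])

lemma bilinear_on_tens:
  assumes "is_vsp V" "is_vsp W"
  shows "bilinear_on V W (tensor V W) (tens V W)"
proof -
  have "tens V W v (x + y) = tens V W v x + tens V W v y"
    if "v \<in> carr V" "x \<in> carr W" "y \<in> carr W" for v x y
    using that by (auto simp: fun_eq_iff tens_def bilinear_on_def linear_on_def)
  moreover have "tens V W (x + y) w = tens V W x w + tens V W y w"
    if "x \<in> carr V" "y \<in> carr V" "w \<in> carr W" for x y w
    using that by (auto simp: fun_eq_iff tens_def bilinear_on_def linear_on_def)
  moreover have "tens V W v (smul W c x) = fun_smul c (tens V W v x)"
    if "v \<in> carr V" "x \<in> carr W" for v x c
    using that
    by (auto simp: fun_eq_iff tens_def bilinear_on_def linear_on_def fun_smul_def base_field_def)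
  moreover have "tens V W (smul V c x) w = fun_smul c (tens V W x w)"
    if "x \<in> carr V" "w \<in> carr W" for w x c
    using that
    by (auto simp: fun_eq_iff tens_def bilinear_on_def linear_on_def fun_smul_def base_field_def)
  moreover have "smul (tensor V W) = fun_smul" by (simp add: tensor_def)
  ultimately show ?thesis
    by (auto simp: bilinear_on_def linear_on_def tens_in)
qed

lemma tensor_cases:
  fixes V :: "('k::field, 'a::ab_group_add, 'm) vsp_scheme"
    and W :: "('k, 'b::ab_group_add, 'n) vsp_scheme"
  assumes "is_vsp V" "t \<in> carr (tensor V W)"
  obtains ps where "set ps \<subseteq> carr V \<times> carr W" "t = (\<Sum>(v, w)\<leftarrow>ps. tens V W v w)"
proof -
  interpret T: module "fun_smul :: 'k \<Rightarrow> _ \<Rightarrow> ('a \<Rightarrow> 'b \<Rightarrow> 'k) \<Rightarrow> 'k"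
    by (rule module_fun_smul)
  from assms(2) have
    "t \<in> T.span {tens V W v w | v w. v \<in> carr V \<and> w \<in> carr W}"
    by (simp add: tensor_def)
  then have "\<exists>ps. set ps \<subseteq> carr V \<times> carr W \<and> t = (\<Sum>(v, w)\<leftarrow>ps. tens V W v w)"
  proof (induction rule: T.span_induct_alt)
    case base
    show ?case by (rule exI[of _ "[]"]) simp
  next
    case (step c x y)
    then obtain v w ps where *: "x = tens V W v w" "v \<in> carr V" "w \<in> carr W"
      "set ps \<subseteq> carr V \<times> carr W" "y = (\<Sum>(v, w)\<leftarrow>ps. tens V W v w)" by auto
    have "fun_smul c x = tens V W (smul V c v) w"
      using *(2,3) unfolding *(1)
      by (auto simp: fun_eq_iff tens_def bilinear_on_def linear_on_def fun_smul_def base_field_def)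
    then show ?case
      using * is_vspD(3)[OF assms(1) *(2), of c]
      by (intro exI[of _ "(smul V c v, w) # ps"]) auto
  qed
  with that show ?thesis by blast
qed

lemma tens_sum_list_eq:
  assumes X: "is_vsp X" and f: "bilinear_on V W X f"
    and ps: "set ps \<subseteq> carr V \<times> carr W" and qs: "set qs \<subseteq> carr V \<times> carr W"
    and eq: "(\<Sum>(v, w)\<leftarrow>ps. tens V W v w) = (\<Sum>(v, w)\<leftarrow>qs. tens V W v w)"
  shows "(\<Sum>(v, w)\<leftarrow>ps. f v w) = (\<Sum>(v, w)\<leftarrow>qs. f v w)"
proof (rule linear_functional_separates[OF X])
  fix \<phi> assume phi: "linear_on X base_field \<phi>"
  have bil: "bilinear_on V W base_field (\<lambda>v w. \<phi> (f v w))"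
    by (rule bilinear_on_compose[OF f phi])
  have fin: "f v w \<in> carr X" if "v \<in> carr V" "w \<in> carr W" for v w
    using f that by (auto simp: bilinear_on_def linear_on_def)
  have *: "\<phi> (\<Sum>(v, w)\<leftarrow>rs. f v w) = (\<Sum>(v, w)\<leftarrow>rs. tens V W v w) (\<lambda>v w. \<phi> (f v w))"
    if "set rs \<subseteq> carr V \<times> carr W" for rs
  proof -
    have "\<phi> (\<Sum>(v, w)\<leftarrow>rs. f v w) = (\<Sum>p\<leftarrow>rs. \<phi> (case p of (v, w) \<Rightarrow> f v w))"
      using that fin by (intro linear_on_sum_list(1)[OF X is_vsp_base_field phi]) auto
    also have "\<dots> = (\<Sum>p\<leftarrow>rs. (case p of (v, w) \<Rightarrow> tens V W v w) (\<lambda>v w. \<phi> (f v w)))"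
      using bil by (intro arg_cong[where f = sum_list] map_cong) (auto simp: tens_def)
    finally show ?thesis by (simp add: sum_list_fun_apply)
  qed
  show "\<phi> (\<Sum>(v, w)\<leftarrow>ps. f v w) = \<phi> (\<Sum>(v, w)\<leftarrow>qs. f v w)"
    by (simp add: *[OF ps] *[OF qs] eq)
qed

lemma tlift_sum_list:
  assumes "is_vsp X" "bilinear_on V W X f" "set ps \<subseteq> carr V \<times> carr W"
  shows "tlift V W f (\<Sum>(v, w)\<leftarrow>ps. tens V W v w) = (\<Sum>(v, w)\<leftarrow>ps. f v w)"
  unfolding tlift_def
proof (rule someI2)
  show "\<exists>qs. set qs \<subseteq> carr V \<times> carr W \<and>
      (\<Sum>(v, w)\<leftarrow>ps. tens V W v w) = (\<Sum>(v, w)\<leftarrow>qs. tens V W v w) \<and>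
      (\<Sum>(v, w)\<leftarrow>ps. f v w) = (\<Sum>(v, w)\<leftarrow>qs. f v w)"
    using assms(3) by blast
qed (use tens_sum_list_eq[OF assms(1,2)] assms(3) in metis)

theorem tensor_universal:
  assumes V: "is_vsp V" and W: "is_vsp W" and X: "is_vsp X" and f: "bilinear_on V W X f"
  shows "linear_on (tensor V W) X (tlift V W f)"
    and "v \<in> carr V \<Longrightarrow> w \<in> carr W \<Longrightarrow> tlift V W f (tens V W v w) = f v w"
    and "linear_on (tensor V W) X F \<Longrightarrow>
         (\<And>v w. v \<in> carr V \<Longrightarrow> w \<in> carr W \<Longrightarrow> F (tens V W v w) = f v w) \<Longrightarrow>
         t \<in> carr (tensor V W) \<Longrightarrow> F t = tlift V W f t"
proof -
  note L = tlift_sum_list[OF X f]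
  have fin: "f v w \<in> carr X" if "v \<in> carr V" "w \<in> carr W" for v w
    using f that by (auto simp: bilinear_on_def linear_on_def)
  show tens: "tlift V W f (tens V W v w) = f v w" if "v \<in> carr V" "w \<in> carr W" for v w
    using L[of "[(v, w)]"] that by simp
  have Xid: "linear_on X X (\<lambda>x. x)" by (simp add: linear_on_def)
  have cl: "tlift V W f t \<in> carr X" if t: "t \<in> carr (tensor V W)" for t
  proof -
    obtain ps where ps: "set ps \<subseteq> carr V \<times> carr W" "t = (\<Sum>(v, w)\<leftarrow>ps. tens V W v w)"
      using tensor_cases[OF V t] by blast
    have "(\<Sum>p\<leftarrow>ps. (case p of (v, w) \<Rightarrow> f v w)) \<in> carr X"
      using ps(1) fin by (intro linear_on_sum_list(2)[OF X X Xid]) auto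
    with L[OF ps(1)] ps(2) show ?thesis by simp
  qed
  have add: "tlift V W f (s + t) = tlift V W f s + tlift V W f t"
    if st: "s \<in> carr (tensor V W)" "t \<in> carr (tensor V W)" for s t
  proof -
    obtain ps where ps: "set ps \<subseteq> carr V \<times> carr W" "s = (\<Sum>(v, w)\<leftarrow>ps. tens V W v w)"
      using tensor_cases[OF V st(1)] by blast
    obtain qs where qs: "set qs \<subseteq> carr V \<times> carr W" "t = (\<Sum>(v, w)\<leftarrow>qs. tens V W v w)"
      using tensor_cases[OF V st(2)] by blast
    show ?thesis using L[of "ps @ qs"] L[of ps] L[of qs] ps qs by simp
  qed
  have scale: "tlift V W f (smul (tensor V W) c t) = smul X c (tlift V W f t)"
    if t: "t \<in> carr (tensor V W)" for c t
  proof -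
    obtain ps where ps: "set ps \<subseteq> carr V \<times> carr W" "t = (\<Sum>(v, w)\<leftarrow>ps. tens V W v w)"
      using tensor_cases[OF V t] by blast
    define qs where "qs = map (\<lambda>(v, w). (smul V c v, w)) ps"
    have qs: "set qs \<subseteq> carr V \<times> carr W"
      using ps(1) is_vspD(3)[OF V] by (auto simp: qs_def)
    have 1: "linear_on (tensor V W) (tensor V W) (smul (tensor V W) c)"
      "linear_on X X (smul X c)"
      using is_vspD[OF is_vsp_tensor[of V W]] is_vspD[OF X]
      by (auto simp: linear_on_def vector_space.vector_space_assms mult.commute)
    have "smul (tensor V W) c t = (\<Sum>p\<leftarrow>ps. smul (tensor V W) c (case p of (v, w) \<Rightarrow> tens V W v w))"
      unfolding ps(2) using ps(1) tens_in
      by (intro linear_on_sum_list(1)[OF is_vsp_tensor is_vsp_tensor 1(1)]) fastforce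
    also have "\<dots> = (\<Sum>p\<leftarrow>ps. (case p of (v, w) \<Rightarrow> tens V W (smul V c v) w))"
      using ps(1) bilinear_on_tens[OF V W]
      by (intro arg_cong[where f = sum_list] map_cong refl)
        (auto simp: bilinear_on_def linear_on_def)
    also have "\<dots> = (\<Sum>(v, w)\<leftarrow>qs. tens V W v w)"
      by (simp add: qs_def o_def case_prod_unfold)
    finally have "tlift V W f (smul (tensor V W) c t) = (\<Sum>(v, w)\<leftarrow>qs. f v w)"
      using L[OF qs] by simp
    also have "\<dots> = (\<Sum>p\<leftarrow>ps. (case p of (v, w) \<Rightarrow> f (smul V c v) w))"
      by (simp add: qs_def o_def case_prod_unfold)
    also have "\<dots> = (\<Sum>p\<leftarrow>ps. smul X c (case p of (v, w) \<Rightarrow> f v w))"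
      using ps(1) f
      by (intro arg_cong[where f = sum_list] map_cong refl)
        (auto simp: bilinear_on_def linear_on_def)
    also have "\<dots> = smul X c (\<Sum>(v, w)\<leftarrow>ps. f v w)"
      using ps(1) fin by (intro linear_on_sum_list(1)[OF X X 1(2), symmetric]) auto
    finally show ?thesis using L[OF ps(1)] ps(2) by simp
  qed
  show "linear_on (tensor V W) X (tlift V W f)"
    using cl add scale by (auto simp: linear_on_def)
  show "F t = tlift V W f t"
    if F: "linear_on (tensor V W) X F" "\<And>v w. v \<in> carr V \<Longrightarrow> w \<in> carr W \<Longrightarrow> F (tens V W v w) = f v w"
      and t: "t \<in> carr (tensor V W)"
  proof -
    obtain ps where ps: "set ps \<subseteq> carr V \<times> carr W" "t = (\<Sum>(v, w)\<leftarrow>ps. tens V W v w)"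
      using tensor_cases[OF V t] by blast
    have "F t = (\<Sum>p\<leftarrow>ps. F (case p of (v, w) \<Rightarrow> tens V W v w))"
      unfolding ps(2) using ps(1) tens_in
      by (intro linear_on_sum_list(1)[OF is_vsp_tensor X F(1)]) fastforce
    also have "\<dots> = (\<Sum>p\<leftarrow>ps. (case p of (v, w) \<Rightarrow> f v w))"
      using ps(1) F(2) by (intro arg_cong[where f = sum_list] map_cong refl) auto
    finally show ?thesis using L[OF ps(1)] ps(2) by simp
  qed
qed


section \<open>Hom-bialgebras and Hom-Hopf algebras\<close>

record ('k, 'a) hom_data = "('k, 'a) vsp" +
  mul :: "'a \<Rightarrow> 'a \<Rightarrow> 'a"
  one :: 'a
  comul :: "'a \<Rightarrow> ('a \<Rightarrow> 'a \<Rightarrow> 'k) \<Rightarrow> 'k"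
  counit :: "'a \<Rightarrow> 'k"
  twist :: "'a \<Rightarrow> 'a"

text \<open>
  \<open>sweedler C f c\<close> is the sum that is usually written \<open>f c\<^sub>1 c\<^sub>2\<close>.
\<close>

definition sweedler ::
  "('k::field, 'a::ab_group_add) hom_data \<Rightarrow> ('a \<Rightarrow> 'a \<Rightarrow> 'b::ab_group_add) \<Rightarrow> 'a \<Rightarrow> 'b" where
  "sweedler C f c = tlift C C f (comul C c)"

locale hom_algebra =
  fixes A :: "('k::field, 'a::ab_group_add) hom_data"
  assumes vsp: "is_vsp A"
    and mul_bilinear: "bilinear_on A A A (mul A)"
    and one_in: "one A \<in> carr A"
    and twist_linear: "linear_on A A (twist A)"
    and twist_mul: "a \<in> carr A \<Longrightarrow> b \<in> carr A \<Longrightarrow>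
          twist A (mul A a b) = mul A (twist A a) (twist A b)"
    and twist_one: "twist A (one A) = one A"
    and one_mul: "a \<in> carr A \<Longrightarrow> mul A (one A) a = twist A a"
    and mul_one: "a \<in> carr A \<Longrightarrow> mul A a (one A) = twist A a"
    and hom_assoc: "a \<in> carr A \<Longrightarrow> b \<in> carr A \<Longrightarrow> c \<in> carr A \<Longrightarrow>
          mul A (twist A a) (mul A b c) = mul A (mul A a b) (twist A c)"

locale hom_coalgebra =
  fixes C :: "('k::field, 'a::ab_group_add) hom_data"
  assumes vsp: "is_vsp C"
    and comul_linear: "linear_on C (tensor C C) (comul C)"
    and counit_linear: "linear_on C base_field (counit C)"
    and twist_linear: "linear_on C C (twist C)"
    and counit_twist: "c \<in> carr C \<Longrightarrow> counit C (twist C c) = counit C c"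
    and twist_comul: "c \<in> carr C \<Longrightarrow>
          tmap C C C C (twist C) (twist C) (comul C c) = comul C (twist C c)"
    and counit_left: "c \<in> carr C \<Longrightarrow>
          sweedler C (\<lambda>c1 c2. smul C (counit C c1) c2) c = twist C c"
    and counit_right: "c \<in> carr C \<Longrightarrow>
          sweedler C (\<lambda>c1 c2. smul C (counit C c2) c1) c = twist C c"
    and hom_coassoc: "c \<in> carr C \<Longrightarrow>
          tassoc C C C (tmap C C (tensor C C) C (comul C) (twist C) (comul C c)) =
          tmap C C C (tensor C C) (twist C) (comul C) (comul C c)"

locale hom_bialgebra = hom_algebra B + hom_coalgebra B
  for B :: "('k::field, 'a::ab_group_add) hom_data" +
  assumes comul_one: "comul B (one B) = tens B B (one B) (one B)"
    and comul_mul: "a \<in> carr B \<Longrightarrow> b \<in> carr B \<Longrightarrow>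
          comul B (mul B a b) = tmul B B (mul B) (mul B) (comul B a) (comul B b)"
    and counit_one: "counit B (one B) = 1"
    and counit_mul: "a \<in> carr B \<Longrightarrow> b \<in> carr B \<Longrightarrow>
          counit B (mul B a b) = counit B a * counit B b"

locale hom_hopf_algebra = hom_bialgebra H
  for H :: "('k::field, 'a::ab_group_add) hom_data" and S :: "'a \<Rightarrow> 'a" +
  assumes antipode_linear: "linear_on H H S"
    and antipode_twist: "h \<in> carr H \<Longrightarrow> S (twist H h) = twist H (S h)"
    and antipode_left: "h \<in> carr H \<Longrightarrow>
          sweedler H (\<lambda>h1 h2. mul H (S h1) h2) h = smul H (counit H h) (one H)"
    and antipode_right: "h \<in> carr H \<Longrightarrow>
          sweedler H (\<lambda>h1 h2. mul H h1 (S h2)) h = smul H (counit H h) (one H)"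


section \<open>Quasitriangular structures\<close>

text \<open>
  The triple tensor product of \<open>D\<close> is taken to be \<open>D \<otimes> (D \<otimes> D)\<close>.
\<close>

definition R12 where
  "R12 D R = tlift D D (\<lambda>r r'. tens D (tensor D D) r (tens D D r' (one D))) R"

definition R13 where
  "R13 D R = tlift D D (\<lambda>r r'. tens D (tensor D D) r (tens D D (one D) r')) R"

definition R23 where
  "R23 D R = tlift D D (\<lambda>r r'. tens D (tensor D D) (one D) (tens D D r r')) R"

definition mul3 where
  "mul3 D = tmul D (tensor D D) (mul D) (tmul D D (mul D) (mul D))"

locale quasitriangular_hom_bialgebra = hom_bialgebra D
  for D :: "('k::field, 'a::ab_group_add) hom_data"
    and R :: "('a \<Rightarrow> 'a \<Rightarrow> 'k) \<Rightarrow> 'k" +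
  assumes R_in: "R \<in> carr (tensor D D)"
    and R_comul: "x \<in> carr D \<Longrightarrow>
          tmul D D (mul D) (mul D) (tflip D D (comul D x)) R =
          tmul D D (mul D) (mul D) R (comul D x)"
    and comul_twist_R:
          "tassoc D D D (tmap D D (tensor D D) D (comul D) (twist D) R) =
           mul3 D (R13 D R) (R23 D R)"
    and twist_comul_R:
          "tmap D D D (tensor D D) (twist D) (comul D) R =
           mul3 D (R13 D R) (R12 D R)"


section \<open>The dual and the Drinfel'd double\<close>

text \<open>
  In this section \<open>carr H\<close> is the whole type (so \<open>H\<close> is an arbitrary vector space whose
  underlying type is \<open>'a\<close>); then the linear functionals on \<open>H\<close> are exactly the
  functions \<open>f\<close> with \<open>linear_on H base_field f\<close>, and \<open>\<alpha>\<inverse>\<close> is \<open>inv (twist H)\<close>.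
\<close>

definition twist_neg :: "('k, 'a) hom_data \<Rightarrow> nat \<Rightarrow> 'a \<Rightarrow> 'a" where
  "twist_neg H n = inv (twist H) ^^ n"

definition dual_vsp :: "('k::field, 'a::ab_group_add, 'm) vsp_scheme \<Rightarrow> ('k, 'a \<Rightarrow> 'k) vsp" where
  "dual_vsp H = \<lparr>carr = {f. linear_on H base_field f}, smul = fun_smul\<rparr>"

definition dual_mul ::
  "('k::field, 'a::ab_group_add) hom_data \<Rightarrow> ('a \<Rightarrow> 'k) \<Rightarrow> ('a \<Rightarrow> 'k) \<Rightarrow> 'a \<Rightarrow> 'k" where
  "dual_mul H f g = sweedler H (\<lambda>h1 h2. f (twist_neg H 2 h1) * g (twist_neg H 2 h2))"

text \<open>
  Since \<open>H\<close> is finite-dimensional, a tensor in \<open>H\<^sup>* \<otimes> H\<^sup>*\<close> is determined by its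
  pairings with all \<open>h \<otimes> k\<close>.
\<close>

definition dual_comul ::
  "('k::field, 'a::ab_group_add) hom_data
    \<Rightarrow> ('a \<Rightarrow> 'k) \<Rightarrow> (('a \<Rightarrow> 'k) \<Rightarrow> ('a \<Rightarrow> 'k) \<Rightarrow> 'k) \<Rightarrow> 'k" where
  "dual_comul H f =
     (THE t. t \<in> carr (tensor (dual_vsp H) (dual_vsp H)) \<and>
        (\<forall>h\<in>carr H. \<forall>k\<in>carr H.
           tlift (dual_vsp H) (dual_vsp H) (\<lambda>f1 f2. f1 h * f2 k) t =
           f (twist_neg H 2 (mul H h k))))"

definition dual_hom ::
  "('k::field, 'a::ab_group_add) hom_data \<Rightarrow> ('k, 'a \<Rightarrow> 'k) hom_data" where
  "dual_hom H =
     \<lparr>carr = carr (dual_vsp H), smul = smul (dual_vsp H),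
      mul = dual_mul H, one = counit H, comul = dual_comul H, counit = (\<lambda>f. f (one H)),
      twist = (\<lambda>f. f \<circ> inv (twist H))\<rparr>"

definition harpoon_left ::
  "('k, 'a) hom_data \<Rightarrow> ('a \<Rightarrow> 'k) \<Rightarrow> 'a \<Rightarrow> 'a \<Rightarrow> 'k" where
  "harpoon_left H f h = (\<lambda>k. f (mul H h (twist_neg H 2 k)))"

definition harpoon_right ::
  "('k, 'a) hom_data \<Rightarrow> 'a \<Rightarrow> ('a \<Rightarrow> 'k) \<Rightarrow> 'a \<Rightarrow> 'k" where
  "harpoon_right H h f = (\<lambda>k. f (mul H (twist_neg H 2 k) h))"

definition double_mul where
  "double_mul H S x y =
     tlift H (dual_hom H) (\<lambda>h f. tlift H (dual_hom H) (\<lambda>k g.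
       sweedler H (\<lambda>k1 k2. sweedler H (\<lambda>k21 k22.
         tens H (dual_hom H)
           (mul H (twist_neg H 2 k21) h)
           (mul (dual_hom H)
              (harpoon_right H (twist_neg H 3 k22)
                 (harpoon_left H (f \<circ> twist H \<circ> twist H) (S (twist_neg H 3 k1))))
              g))
       k2) k) y) x"

definition double_comul where
  "double_comul H =
     (let D = tensor H (dual_hom H) in
      tlift H (dual_hom H) (\<lambda>h f.
        sweedler H (\<lambda>h1 h2. sweedler (dual_hom H) (\<lambda>f1 f2.
          tens D D (tens H (dual_hom H) h1 f1) (tens H (dual_hom H) h2 f2)) f) h))"

definition drinfeld_double ::
  "('k::field, 'a::ab_group_add) hom_data \<Rightarrow> ('a \<Rightarrow> 'a)
    \<Rightarrow> ('k, ('a \<Rightarrow> ('a \<Rightarrow> 'k) \<Rightarrow> 'k) \<Rightarrow> 'k) hom_data" where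
  "drinfeld_double H S =
     \<lparr>carr = carr (tensor H (dual_hom H)), smul = smul (tensor H (dual_hom H)),
      mul = double_mul H S,
      one = tens H (dual_hom H) (one H) (counit H),
      comul = double_comul H,
      counit = tlift H (dual_hom H) (\<lambda>h f. counit H h * f (one H)),
      twist = tmap H (dual_hom H) H (dual_hom H) (twist H) (twist (dual_hom H))\<rparr>"

end

theory Submission
  imports Defs
begin

text \<open>
  The maps \<open>m = \<alpha>\<inverse> \<circ> \<mu>\<close> and \<open>\<Delta> \<circ> \<alpha>\<inverse>\<close> turn \<open>H\<close> into an ordinary Hopf algebra with automorphism
  \<open>\<alpha>\<close>. Under \<open>h \<otimes> f \<mapsto> h \<otimes> \<alpha>\<^sup>*(f)\<close> the double of the statement becomes the twist of the ordinary
  Drinfel'd double of that Hopf algebra, and \<open>R\<close> becomes its canonical element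
  \<open>\<Sum>\<^sub>i (1 \<otimes> e\<^sup>i) \<otimes> (S\<inverse>(e\<^sub>i) \<otimes> \<epsilon>)\<close>, which is invariant under the twist. Every axiom is then an equation
  in a tensor power of \<open>H \<otimes> H\<^sup>*\<close>; pairing each factor with some \<open>\<phi> \<in> H\<^sup>*\<close> and \<open>x \<in> H\<close> reduces it to a scalar
  identity that follows from coassociativity and the antipode laws.

  The antipode is bijective because \<open>H\<^sup>*\<close> contains a nonzero integral \<open>\<lambda>\<close> (Larson and Sweedler):
  if \<open>S h = 0\<close>, then \<open>\<lambda>(x S(h\<^sub>1)) h\<^sub>2 = 0\<close> for all \<open>x\<close>, and hence \<open>\<lambda>(x) h = 0\<close>.
\<close>

section \<open>Finite-dimensional Hopf algebras in coordinates\<close>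

text \<open>Checking the axioms directly would mean carrying different powers of \<alpha> on
  Sweedler legs of different depth; untwisting removes them all at once. The shift by
  \<open>\<alpha>\<^sup>*\<close> comes from the mixed term of the product: product and coproduct of
  \<open>H\<^sup>*\<close> untwist as they stand, but unshifted, the outer legs \<open>k1\<close>,
  \<open>k3\<close> would act on \<open>f\<close> through \<open>\<alpha> k1\<close>,
  \<open>\<alpha> k3\<close>, while \<open>k2\<close> multiplies \<open>h\<close> without this
  \<alpha>. Passing to \<open>\<lambda>z. f (\<beta> z)\<close> removes the discrepancy.
  \<open>inv S\<close> is a total function in HOL, so the formula for \<open>R\<close> means what it
  should only once \<open>S\<close> is known to be bijective. Likewise \<open>tlift\<close> and
  \<open>dual_comul\<close> are a choice and a description: they compute only after bilinearity, or
  existence and uniqueness, has been shown, and this is where most linearity lemmas are used. The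
  coproduct laws quantify over scalar-valued forms because a locale assumption cannot quantify over
  value types; coordinate functionals separate points, so vector-valued identities follow.\<close>

text \<open>
  The coproduct is given in coordinates, as \<open>\<Delta> h = (\<Sum>i\<in>I. e i \<otimes> \<delta> i h)\<close>; equations between tensors are
  stated by applying arbitrary multilinear forms.
\<close>

locale fd_hopf =
  fixes sc :: "'k::field \<Rightarrow> 'h::ab_group_add \<Rightarrow> 'h"
    and I :: "'i set" and e :: "'i \<Rightarrow> 'h" and e' :: "'i \<Rightarrow> 'h \<Rightarrow> 'k"
    and m :: "'h \<Rightarrow> 'h \<Rightarrow> 'h" (infixl "\<odot>" 70) and u :: 'h
    and \<delta> :: "'i \<Rightarrow> 'h \<Rightarrow> 'h" and \<epsilon> :: "'h \<Rightarrow> 'k" and S :: "'h \<Rightarrow> 'h"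
  assumes vector_space_sc: "vector_space sc"
    and finite_I: "finite I"
    and linear_e': "Vector_Spaces.linear sc (*) (e' i)"
    and expand: "(\<Sum>i\<in>I. sc (e' i x) (e i)) = x"
    and linear_m_left: "Vector_Spaces.linear sc sc (\<lambda>x. x \<odot> y)"
    and linear_m_right: "Vector_Spaces.linear sc sc ((\<odot>) x)"
    and m_assoc: "(x \<odot> y) \<odot> z = x \<odot> (y \<odot> z)"
    and u_m: "u \<odot> x = x" and m_u: "x \<odot> u = x"
    and linear_\<delta>: "Vector_Spaces.linear sc sc (\<delta> i)"
    and linear_\<epsilon>: "Vector_Spaces.linear sc (*) \<epsilon>"
    and linear_S: "Vector_Spaces.linear sc sc S"
    and coassoc_\<delta>: "(\<And>b c. Vector_Spaces.linear sc (*) (\<lambda>a. F a b c)) \<Longrightarrow>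
      (\<And>a c. Vector_Spaces.linear sc (*) (\<lambda>b. F a b c)) \<Longrightarrow>
      (\<And>a b. Vector_Spaces.linear sc (*) (F a b)) \<Longrightarrow>
      (\<Sum>i\<in>I. \<Sum>j\<in>I. F (e j) (\<delta> j (e i)) (\<delta> i h)) = (\<Sum>i\<in>I. \<Sum>j\<in>I. F (e i) (e j) (\<delta> j (\<delta> i h)))"
    and counit_left_\<delta>: "(\<Sum>i\<in>I. sc (\<epsilon> (e i)) (\<delta> i h)) = h"
    and counit_right_\<delta>: "(\<Sum>i\<in>I. sc (\<epsilon> (\<delta> i h)) (e i)) = h"
    and comul_m_\<delta>: "(\<And>b. Vector_Spaces.linear sc (*) (\<lambda>a. G a b)) \<Longrightarrow>
      (\<And>a. Vector_Spaces.linear sc (*) (G a)) \<Longrightarrow>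
      (\<Sum>i\<in>I. G (e i) (\<delta> i (x \<odot> y))) = (\<Sum>i\<in>I. \<Sum>j\<in>I. G (e i \<odot> e j) (\<delta> i x \<odot> \<delta> j y))"
    and comul_u_\<delta>: "(\<And>b. Vector_Spaces.linear sc (*) (\<lambda>a. G a b)) \<Longrightarrow>
      (\<And>a. Vector_Spaces.linear sc (*) (G a)) \<Longrightarrow> (\<Sum>i\<in>I. G (e i) (\<delta> i u)) = G u u"
    and \<epsilon>_m: "\<epsilon> (x \<odot> y) = \<epsilon> x * \<epsilon> y" and \<epsilon>_u: "\<epsilon> u = 1"
    and antipode_left_\<delta>: "(\<Sum>i\<in>I. S (e i) \<odot> \<delta> i h) = sc (\<epsilon> h) u"
    and antipode_right_\<delta>: "(\<Sum>i\<in>I. e i \<odot> S (\<delta> i h)) = sc (\<epsilon> h) u"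
begin

section \<open>Linear forms and Sweedler sums\<close>

sublocale vector_space sc by (rule vector_space_sc)
abbreviation lf :: "('h \<Rightarrow> 'k) \<Rightarrow> bool" where "lf \<equiv> Vector_Spaces.linear sc (*)"
abbreviation lv :: "('h \<Rightarrow> 'h) \<Rightarrow> bool" where "lv \<equiv> Vector_Spaces.linear sc sc"

lemma lf_iff: "lf f \<longleftrightarrow> (\<forall>x y. f (x + y) = f x + f y) \<and> (\<forall>c x. f (sc c x) = c * f x)"
proof -
  have "vector_space ((*) :: 'k \<Rightarrow> 'k \<Rightarrow> 'k)"
    by unfold_locales (auto simp: algebra_simps)
  then show ?thesis using vector_space_axioms by (auto simp: Vector_Spaces.linear_iff)
qed

lemma lv_iff: "lv f \<longleftrightarrow> (\<forall>x y. f (x + y) = f x + f y) \<and> (\<forall>c x. f (sc c x) = sc c (f x))"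
  using vector_space_axioms by (auto simp: Vector_Spaces.linear_iff)

lemma lf_o: "lf f \<Longrightarrow> lv g \<Longrightarrow> lf (\<lambda>x. f (g x))"
  by (simp add: lf_iff lv_iff)

lemma lv_o: "lv f \<Longrightarrow> lv g \<Longrightarrow> lv (\<lambda>x. f (g x))"
  by (simp add: lv_iff)

lemma lf_add: "lf f \<Longrightarrow> f (x + y) = f x + f y"
  and lf_scale: "lf f \<Longrightarrow> f (sc c x) = c * f x"
  by (simp_all add: lf_iff)

lemma lf_sum: "lf f \<Longrightarrow> f (\<Sum>i\<in>J. g i) = (\<Sum>i\<in>J. f (g i))"
  by (induction J rule: infinite_finite_induct)
    (auto simp: lf_add, metis lf_scale mult_zero_left scale_zero_left, metis lf_scale mult_zero_left scale_zero_left)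

text \<open>Syntax-directed linearity rules. Each use of coassociativity or of an antipode law
  leaves multilinearity goals about nested Sweedler sums, which \<open>simp\<close> closes with this
  set; proofs add the functionals at hand to it locally.\<close>

named_theorems lin

lemma lin_mult [lin]:
  "lf f \<Longrightarrow> lf (\<lambda>x. f x * c)" "lf f \<Longrightarrow> lf (\<lambda>x. c * f x)"
  by (simp_all add: lf_iff algebra_simps)

lemma lin_sum [lin]: "(\<And>j. lf (f j)) \<Longrightarrow> lf (\<lambda>x. \<Sum>j\<in>J. f j x)"
  by (simp add: lf_iff sum.distrib sum_distrib_left)

lemma lv_id [lin]: "lv (\<lambda>x. x)"
  by (simp add: lv_iff)

lemma lin_m [lin]: "lv g \<Longrightarrow> lv (\<lambda>x. g x \<odot> y)" "lv g \<Longrightarrow> lv (\<lambda>x. y \<odot> g x)"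
  using lv_o[OF linear_m_left] lv_o[OF linear_m_right] by auto

lemmas lin_basic [lin] = lf_o[OF linear_e'] lf_o[OF linear_\<epsilon>] lv_o[OF linear_S] lv_o[OF linear_\<delta>]
  linear_m_right linear_e' linear_\<epsilon> linear_S linear_\<delta>

text \<open>\<open>sw F h\<close> is the Sweedler sum of \<open>F h\<^sub>1 h\<^sub>2\<close> for the ordinary coproduct.\<close>

definition sw :: "('h \<Rightarrow> 'h \<Rightarrow> 'b::comm_monoid_add) \<Rightarrow> 'h \<Rightarrow> 'b" where
  "sw F h = (\<Sum>i\<in>I. F (e i) (\<delta> i h))"

lemma lin_sw [lin]:
  "(\<And>a b. lf (\<lambda>x. F x a b)) \<Longrightarrow> lf (\<lambda>x. sw (\<lambda>a b. F x a b) h)"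
  "lv g \<Longrightarrow> (\<And>a. lf (G a)) \<Longrightarrow> lf (\<lambda>x. sw (\<lambda>a b. G a b) (g x))"
  "(\<And>a. lf (G a)) \<Longrightarrow> lf (sw G)"
  using lf_o[of "G _" "\<lambda>x. \<delta> _ (g x)"]
  unfolding sw_def by (auto intro!: lin intro: lf_o)

lemma sw_mult_left: "c * sw F h = sw (\<lambda>a b. c * F a b) h"
  and sw_mult_right: "sw F h * c = sw (\<lambda>a b. F a b * (c::'k)) h"
  by (simp_all add: sw_def sum_distrib_left sum_distrib_right)

lemma sw_sum: "sw (\<lambda>a b. \<Sum>j\<in>J. F j a b) h = (\<Sum>j\<in>J. sw (F j) h)"
  unfolding sw_def by (rule sum.swap)

lemma sw_swap: "sw (\<lambda>a b. sw (\<lambda>c d. F a b c d) y) x = sw (\<lambda>c d. sw (\<lambda>a b. F a b c d) x) y"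
  unfolding sw_def by (rule sum.swap)

lemma sw_swap3: "sw (\<lambda>a b. sw (\<lambda>c d. sw (\<lambda>p q. F a b c d p q) (K c d)) y) x =
    sw (\<lambda>c d. sw (\<lambda>p q. sw (\<lambda>a b. F a b c d p q) x) (K c d)) y"
  unfolding sw_def by (subst sum.swap, rule sum.cong[OF refl], rule sum.swap)

lemma sw_cong: "(\<And>a b. F a b = G a b) \<Longrightarrow> sw F h = sw G h"
  by (simp add: sw_def)

lemma expand_lf:
  assumes "lf f"
  shows "(\<Sum>i\<in>I. e' i x * f (e i)) = f x" "(\<Sum>i\<in>I. f (e i) * e' i x) = f x"
proof -
  have "f (\<Sum>i\<in>I. sc (e' i x) (e i)) = (\<Sum>i\<in>I. e' i x * f (e i))"
    using assms by (simp add: lf_sum lf_scale)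
  then show "(\<Sum>i\<in>I. e' i x * f (e i)) = f x" by (simp add: expand)
  then show "(\<Sum>i\<in>I. f (e i) * e' i x) = f x" by (simp add: mult.commute)
qed

lemma eq_by_lf:
  assumes "\<And>f. lf f \<Longrightarrow> f x = f y"
  shows "x = y"
proof -
  have "(\<Sum>i\<in>I. sc (e' i x) (e i)) = (\<Sum>i\<in>I. sc (e' i y) (e i))"
    using assms[OF linear_e'] by simp
  then show ?thesis by (simp only: expand)
qed

section \<open>The Hopf algebra laws as rules for Sweedler sums\<close>

lemma coassoc:
  assumes "\<And>b c. lf (\<lambda>a. F a b c)" "\<And>a c. lf (\<lambda>b. F a b c)" "\<And>a b. lf (F a b)"
  shows "sw (\<lambda>a b. sw (\<lambda>c d. F c d b) a) h = sw (\<lambda>a b. sw (\<lambda>c d. F a c d) b) h"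
  unfolding sw_def by (rule coassoc_\<delta>) (use assms in auto)

text \<open>Coassociativity across an intervening sum: the sum over \<open>K b\<close>, either a
  further coproduct of the last leg or one of an unrelated element, stands outside the coproduct of
  \<open>a\<close>. Swapping it inwards restores the shape of \<open>coassoc\<close>.\<close>

lemma coassoc':
  assumes "\<And>b c p q. lf (\<lambda>a. F a b c p q)" "\<And>a c p q. lf (\<lambda>b. F a b c p q)"
    "\<And>a b. lf (\<lambda>c. sw (\<lambda>p q. F a b c p q) (K c))"
  shows "sw (\<lambda>a b. sw (\<lambda>p q. sw (\<lambda>c d. F c d b p q) a) (K b)) h =
    sw (\<lambda>a b. sw (\<lambda>c d. sw (\<lambda>p q. F a c d p q) (K d)) b) h"
proof -
  have "sw (\<lambda>a b. sw (\<lambda>p q. sw (\<lambda>c d. F c d b p q) a) (K b)) h =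
     sw (\<lambda>a b. sw (\<lambda>c d. sw (\<lambda>p q. F c d b p q) (K b)) a) h"
    by (intro sw_cong sw_swap)
  also have "\<dots> = sw (\<lambda>a b. sw (\<lambda>c d. sw (\<lambda>p q. F a c d p q) (K d)) b) h"
    by (rule coassoc) (use assms in \<open>auto intro!: lin\<close>)
  finally show ?thesis .
qed

lemma counit_left: assumes "lf f" shows "sw (\<lambda>a b. \<epsilon> a * f b) h = f h" "sw (\<lambda>a b. f b * \<epsilon> a) h = f h"
proof -
  have "f (\<Sum>i\<in>I. sc (\<epsilon> (e i)) (\<delta> i h)) = sw (\<lambda>a b. \<epsilon> a * f b) h"
    using assms by (simp add: lf_sum lf_scale sw_def)
  then show "sw (\<lambda>a b. \<epsilon> a * f b) h = f h" "sw (\<lambda>a b. f b * \<epsilon> a) h = f h"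
    by (simp_all add: counit_left_\<delta> mult.commute)
qed

lemma counit_right: assumes "lf f" shows "sw (\<lambda>a b. \<epsilon> b * f a) h = f h" "sw (\<lambda>a b. f a * \<epsilon> b) h = f h"
proof -
  have "f (\<Sum>i\<in>I. sc (\<epsilon> (\<delta> i h)) (e i)) = sw (\<lambda>a b. \<epsilon> b * f a) h"
    using assms by (simp add: lf_sum lf_scale sw_def)
  then show "sw (\<lambda>a b. \<epsilon> b * f a) h = f h" "sw (\<lambda>a b. f a * \<epsilon> b) h = f h"
    by (simp_all add: counit_right_\<delta> mult.commute)
qed

lemma sw_m:
  assumes "\<And>b. lf (\<lambda>a. G a b)" "\<And>a. lf (G a)"
  shows "sw G (x \<odot> y) = sw (\<lambda>a b. sw (\<lambda>c d. G (a \<odot> c) (b \<odot> d)) y) x"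
  unfolding sw_def by (rule comul_m_\<delta>) (use assms in auto)

lemma sw_u:
  assumes "\<And>b. lf (\<lambda>a. G a b)" "\<And>a. lf (G a)"
  shows "sw G u = G u u"
  unfolding sw_def by (rule comul_u_\<delta>) (use assms in auto)

lemma antipode_left: assumes "lf f" shows "sw (\<lambda>a b. f (S a \<odot> b)) h = \<epsilon> h * f u"
  by (simp add: sw_def antipode_left_\<delta> lf_scale[OF assms] flip: lf_sum[OF assms])

lemma antipode_right: assumes "lf f" shows "sw (\<lambda>a b. f (a \<odot> S b)) h = \<epsilon> h * f u"
  by (simp add: sw_def antipode_right_\<delta> lf_scale[OF assms] flip: lf_sum[OF assms])

section \<open>The antipode reverses products and coproducts\<close>

lemma S_u: "S u = u"
proof (rule eq_by_lf)
  fix f assume f: "lf f"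
  note [lin] = f lf_o[OF f]
  show "f (S u) = f u"
    using antipode_left[OF f, of u] by (simp add: sw_u lin \<epsilon>_u m_u)
qed

lemma \<epsilon>_S: "\<epsilon> (S h) = \<epsilon> h"
proof -
  have "\<epsilon> (S h) = sw (\<lambda>a b. \<epsilon> (S a) * \<epsilon> b) h"
    by (rule counit_right(2)[symmetric]) (simp add: lin)
  also have "\<dots> = \<epsilon> h"
    using antipode_left[OF linear_\<epsilon>, of h] by (simp add: \<epsilon>_m \<epsilon>_u)
  finally show ?thesis .
qed

text \<open>In the convolution algebra of maps from \<open>H \<otimes> H\<close> to
  \<open>H\<close>, the left side is a left inverse of the multiplication and the right side a right
  inverse, so they agree. \<open>?T\<close> is the product of all three; it collapses from the right
  by \<open>antipode_right\<close> and from the left by \<open>antipode_left\<close>.\<close>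

lemma S_m: "S (x \<odot> y) = S y \<odot> S x"
proof (rule eq_by_lf)
  fix f assume f: "lf f"
  note [lin] = f lf_o[OF f]
  let ?T = "sw (\<lambda>x1 x'. sw (\<lambda>x2 x3. sw (\<lambda>y1 y'. sw (\<lambda>y2 y3.
    f (S (x1 \<odot> y1) \<odot> (x2 \<odot> (y2 \<odot> (S y3 \<odot> S x3))))) y') y) x') x"
  have "?T = sw (\<lambda>x1 x'. sw (\<lambda>x2 x3. f (S (x1 \<odot> y) \<odot> (x2 \<odot> S x3))) x') x"
  proof (intro sw_cong)
    fix x1 x2 x3
    have "sw (\<lambda>y2 y3. f (S (x1 \<odot> y1) \<odot> (x2 \<odot> (y2 \<odot> (S y3 \<odot> S x3))))) y' =
       \<epsilon> y' * f (S (x1 \<odot> y1) \<odot> (x2 \<odot> S x3))" for y1 y'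
      using antipode_right[of "\<lambda>z. f (S (x1 \<odot> y1) \<odot> (x2 \<odot> (z \<odot> S x3)))" y']
      by (simp add: lin m_assoc u_m)
    then show "sw (\<lambda>y1 y'. sw (\<lambda>y2 y3.
      f (S (x1 \<odot> y1) \<odot> (x2 \<odot> (y2 \<odot> (S y3 \<odot> S x3))))) y') y = f (S (x1 \<odot> y) \<odot> (x2 \<odot> S x3))"
      by (simp add: counit_right lin)
  qed
  also have "\<dots> = sw (\<lambda>x1 x'. \<epsilon> x' * f (S (x1 \<odot> y))) x"
    using antipode_right[of "\<lambda>z. f (S (_ \<odot> y) \<odot> z)"]
    by (intro sw_cong) (simp add: lin m_u)
  also have "\<dots> = f (S (x \<odot> y))" by (simp add: counit_right lin)
  finally have 1: "?T = f (S (x \<odot> y))" .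
  \<comment> \<open>For the other collapse both coproducts are regrouped to the left, so that
    \<open>x1\<close>, \<open>x2\<close> and \<open>y1\<close>, \<open>y2\<close> become the legs of
    one coproduct of a product and \<open>antipode_left\<close> applies to it.\<close>
  have "?T = sw (\<lambda>x1 x3. sw (\<lambda>y1 y3. sw (\<lambda>a b. f (S a \<odot> (b \<odot> (S y3 \<odot> S x3)))) (x1 \<odot> y1)) y) x"
  proof -
    have "?T = sw (\<lambda>x1 x3. sw (\<lambda>x1 x2. sw (\<lambda>y1 y'. sw (\<lambda>y2 y3.
      f (S (x1 \<odot> y1) \<odot> (x2 \<odot> (y2 \<odot> (S y3 \<odot> S x3))))) y') y) x1) x"
      by (rule coassoc[symmetric]) (simp_all add: lin)
    also have "\<dots> = sw (\<lambda>x1 x3. sw (\<lambda>y1 y'. sw (\<lambda>y2 y3. sw (\<lambda>x1 x2. 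
      f (S (x1 \<odot> y1) \<odot> (x2 \<odot> (y2 \<odot> (S y3 \<odot> S x3))))) x1) y') y) x"
      by (intro sw_cong sw_swap3)
    also have "\<dots> = sw (\<lambda>x1 x3. sw (\<lambda>y1 y3. sw (\<lambda>x1 x2. sw (\<lambda>y1 y2.
      f (S (x1 \<odot> y1) \<odot> (x2 \<odot> (y2 \<odot> (S y3 \<odot> S x3))))) y1) x1) y) x"
      by (intro sw_cong coassoc'[symmetric]) (simp_all add: lin)
    finally show ?thesis by (simp add: sw_m lin m_assoc)
  qed
  also have "\<dots> = sw (\<lambda>x1 x3. sw (\<lambda>y1 y3. \<epsilon> x1 * \<epsilon> y1 * f (S y3 \<odot> S x3)) y) x"
    using antipode_left[of "\<lambda>z. f (z \<odot> (S _ \<odot> S _))"]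
    by (intro sw_cong) (simp add: lin m_assoc u_m \<epsilon>_m)
  also have "\<dots> = f (S y \<odot> S x)"
    by (simp add: counit_left lin mult.assoc flip: sw_mult_left)
  finally show "f (S (x \<odot> y)) = f (S y \<odot> S x)" using 1 by simp
qed

text \<open>The same inverse argument with maps from \<open>H\<close> to
  \<open>H \<otimes> H\<close>: \<Delta> after \<open>S\<close>, and \<open>S \<otimes> S\<close>
  after the opposite coproduct, both invert \<Delta> under convolution. \<open>T\<close> pairs
  \<open>G\<close> with \<Delta>(S h1) \<Delta>(h2) (S h4 \<otimes> S h3).\<close>

lemma sw_S:
  assumes G1: "\<And>b. lf (\<lambda>a. G a b)" and G2: "\<And>a. lf (G a)"
  shows "sw G (S h) = sw (\<lambda>a b. G (S b) (S a)) h"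
proof -
  note [lin] = G1 G2 lf_o[OF G1] lf_o[OF G2]
  define T where "T = sw (\<lambda>h1 h'. sw (\<lambda>h2 h''. sw (\<lambda>h3 h4. sw (\<lambda>a b. sw (\<lambda>c d.
    G (a \<odot> (c \<odot> S h4)) (b \<odot> (d \<odot> S h3))) h2) (S h1)) h'') h') h"
  \<comment> \<open>The right inverse property, multiplied on the left by
    \<open>a \<otimes> b\<close>. With four legs of \<open>y\<close> the factors are y1 S(y4) and y2
    S(y3): the inner pair has to cancel before the outer legs become neighbours.\<close>
  have Q: "sw (\<lambda>y1 y'. sw (\<lambda>y2 y3. sw (\<lambda>c d. G (a \<odot> (c \<odot> S y3)) (b \<odot> (d \<odot> S y2))) y1) y') y = \<epsilon> y * G a b"
    (is "?L = _") for a b y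
  proof -
    have "?L = sw (\<lambda>c z. sw (\<lambda>d z'. sw (\<lambda>y2 y3. G (a \<odot> (c \<odot> S y3)) (b \<odot> (d \<odot> S y2))) z') z) y"
      by (rule coassoc') (simp_all add: lin)
    also have "\<dots> = sw (\<lambda>c z. sw (\<lambda>w y3. sw (\<lambda>d y2. G (a \<odot> (c \<odot> S y3)) (b \<odot> (d \<odot> S y2))) w) z) y"
      by (intro sw_cong coassoc[symmetric]) (simp_all add: lin)
    also have "\<dots> = sw (\<lambda>c z. sw (\<lambda>w y3. \<epsilon> w * G (a \<odot> (c \<odot> S y3)) b) z) y"
      using antipode_right[of "\<lambda>z. G (a \<odot> (_ \<odot> S _)) (b \<odot> z)"]
      by (intro sw_cong) (simp add: lin m_u)
    also have "\<dots> = sw (\<lambda>c z. G (a \<odot> (c \<odot> S z)) b) y"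
      by (simp add: lin counit_left)
    also have "\<dots> = \<epsilon> y * G a b"
      using antipode_right[of "\<lambda>z. G (a \<odot> z) b"] by (simp add: lin m_u)
    finally show ?thesis .
  qed
  have "T = sw (\<lambda>h1 h'. sw (\<lambda>a b. sw (\<lambda>h2 h''. sw (\<lambda>h3 h4. sw (\<lambda>c d.
      G (a \<odot> (c \<odot> S h4)) (b \<odot> (d \<odot> S h3))) h2) h'') h') (S h1)) h"
    unfolding T_def by (rule sw_cong, rule sw_swap3[symmetric])
  also have "\<dots> = sw (\<lambda>h1 h'. sw (\<lambda>a b. \<epsilon> h' * G a b) (S h1)) h"
    by (simp add: Q)
  also have "\<dots> = sw G (S h)"
    by (simp add: counit_right lin flip: sw_mult_left)
  finally have 1: "T = sw G (S h)" .
  have "T = sw (\<lambda>h1 h'. sw (\<lambda>h2 h''. sw (\<lambda>h3 h4. sw (\<lambda>p q.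
    G (p \<odot> S h4) (q \<odot> S h3)) (S h1 \<odot> h2)) h'') h') h"
    unfolding T_def by (simp add: sw_m lin m_assoc)
  also have "\<dots> = sw (\<lambda>w h''. sw (\<lambda>h1 h2. sw (\<lambda>h3 h4. sw (\<lambda>p q.
    G (p \<odot> S h4) (q \<odot> S h3)) (S h1 \<odot> h2)) h'') w) h"
    by (intro coassoc[symmetric]) (simp_all add: lin)
  also have "\<dots> = sw (\<lambda>w h''. sw (\<lambda>h3 h4. sw (\<lambda>h1 h2. sw (\<lambda>p q.
    G (p \<odot> S h4) (q \<odot> S h3)) (S h1 \<odot> h2)) w) h'') h"
    by (intro sw_cong sw_swap)
  also have "\<dots> = sw (\<lambda>w h''. sw (\<lambda>h3 h4. \<epsilon> w * G (S h4) (S h3)) h'') h"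
    using antipode_left[of "\<lambda>z. sw (\<lambda>p q. G (p \<odot> S _) (q \<odot> S _)) z"]
    by (intro sw_cong) (simp add: lin sw_u u_m)
  also have "\<dots> = sw (\<lambda>a b. G (S b) (S a)) h"
    by (simp add: counit_left lin flip: sw_mult_left)
  finally show ?thesis using 1 by simp
qed

section \<open>The convolution algebra of the dual and its integrals\<close>

definition conv :: "('h \<Rightarrow> 'k) \<Rightarrow> ('h \<Rightarrow> 'k) \<Rightarrow> 'h \<Rightarrow> 'k" (infixl "\<star>" 70) where
  "(f \<star> g) h = sw (\<lambda>a b. f a * g b) h"

lemma lf_conv [lin]: "lf f \<Longrightarrow> lf g \<Longrightarrow> lf (f \<star> g)"
  unfolding conv_def by (rule lin) (auto intro: lin)

lemma conv_assoc:
  assumes "lf f" "lf g" "lf h"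
  shows "(f \<star> g) \<star> h = f \<star> (g \<star> h)"
  unfolding conv_def
  by (simp add: fun_eq_iff lin sw_mult_left sw_mult_right coassoc mult.assoc assms lf_o[OF assms(1)] lf_o[OF assms(2)])

text \<open>
  The projection of \<open>H\<^sup>*\<close> onto its integrals, from the fundamental theorem of Hopf modules.
\<close>

definition int_proj :: "('h \<Rightarrow> 'k) \<Rightarrow> 'h \<Rightarrow> 'k" where
  "int_proj f x = (\<Sum>i\<in>I. (e' i \<star> f) (x \<odot> S (S (e i))))"

lemma lf_int_proj: "lf f \<Longrightarrow> lf (int_proj f)"
  unfolding int_proj_def by (auto intro!: lin intro: lf_o[OF lf_conv])

text \<open>Associativity, with \<open>e' i \<star> e' j\<close> expanded in the functionals
  \<open>e' k\<close>. The structure constants that appear are then absorbed by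
  \<open>sum_conv\<close>.\<close>

lemma e'_conv_e':
  assumes f: "lf f"
  shows "(e' i \<star> (e' j \<star> f)) y = (\<Sum>k\<in>I. (e' i \<star> e' j) (e k) * (e' k \<star> f) y)"
proof -
  have "(\<Sum>k\<in>I. (e' i \<star> e' j) (e k) * (e' k \<star> f) y) =
      sw (\<lambda>a b. (\<Sum>k\<in>I. (e' i \<star> e' j) (e k) * e' k a) * f b) y"
    by (simp add: conv_def[of "e' _" f] sum_distrib_left sum_distrib_right sw_mult_left sw_sum mult.assoc)
  also have "\<dots> = ((e' i \<star> e' j) \<star> f) y"
    by (simp add: expand_lf lin conv_def[of _ f])
  finally show ?thesis by (simp add: conv_assoc linear_e' f)
qed

text \<open>The structure constants of the dual algebra are those of the coproduct: the sum of (e' i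
  \<star> e' j)(x) e i \<otimes> e j is \<Delta> x. This turns double sums over dual bases into
  Sweedler sums.\<close>

lemma sum_conv:
  assumes "\<And>b. lf (\<lambda>a. G a b)" "\<And>a. lf (G a)"
  shows "(\<Sum>i\<in>I. \<Sum>j\<in>I. (e' i \<star> e' j) x * G (e i) (e j)) = sw G x"
proof -
  have "(\<Sum>i\<in>I. \<Sum>j\<in>I. (e' i \<star> e' j) x * G (e i) (e j)) =
    sw (\<lambda>a b. \<Sum>i\<in>I. \<Sum>j\<in>I. e' i a * e' j b * G (e i) (e j)) x"
    by (simp add: conv_def sw_mult_right sw_sum)
  also have "\<dots> = sw G x"
    using assms expand_lf(1)[of "\<lambda>a. G a _"]
    by (simp add: expand_lf mult.assoc flip: sum_distrib_left)
  finally show ?thesis .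
qed

text \<open>The Hopf module compatibility of the dual, where \<open>z\<close> acts on
  \<open>f\<close> by precomposition with right multiplication by \<open>S z\<close>. On the right,
  \<open>S z1\<close> has the coproduct legs S(z12) and S(z11); the first meets \<open>z2\<close>
  inside \<open>g\<close> and cancels, leaving \<open>S z\<close> in \<open>f\<close>.\<close>

lemma conv_mul_antipode:
  assumes f: "lf f" and g: "lf g"
  shows "sw (\<lambda>a b. g a * f (b \<odot> S z)) x = sw (\<lambda>z1 z2. sw (\<lambda>a b. g (a \<odot> z2) * f b) (x \<odot> S z1)) z"
proof -
  note [lin] = f g lf_o[OF f] lf_o[OF g]
  have "sw (\<lambda>z1 z2. sw (\<lambda>a b. g (a \<odot> z2) * f b) (x \<odot> S z1)) z =
    sw (\<lambda>z1 z2. sw (\<lambda>a b. sw (\<lambda>p q. g (a \<odot> (S q \<odot> z2)) * f (b \<odot> S p)) z1) x) z"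
    by (simp add: sw_m sw_S lin m_assoc)
  also have "\<dots> = sw (\<lambda>a b. sw (\<lambda>z1 z2. sw (\<lambda>p q. g (a \<odot> (S q \<odot> z2)) * f (b \<odot> S p)) z1) z) x"
    by (rule sw_swap)
  also have "\<dots> = sw (\<lambda>a b. sw (\<lambda>p w. sw (\<lambda>q z2. g (a \<odot> (S q \<odot> z2)) * f (b \<odot> S p)) w) z) x"
    by (intro sw_cong coassoc) (simp_all add: lin)
  also have "\<dots> = sw (\<lambda>a b. sw (\<lambda>p w. g a * (f (b \<odot> S p) * \<epsilon> w)) z) x"
    using antipode_left[of "\<lambda>z. g (_ \<odot> z)"]
    by (intro sw_cong) (simp add: lin m_u mult_ac flip: sw_mult_right sw_mult_left)
  also have "\<dots> = sw (\<lambda>a b. g a * f (b \<odot> S z)) x"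
    by (simp add: counit_right lin flip: sw_mult_left)
  finally show ?thesis by simp
qed

lemma sw_conv_e':
  assumes "lf g"
  shows "sw (\<lambda>a b. g a * f b) y = (\<Sum>i\<in>I. g (e i) * (e' i \<star> f) y)"
  by (simp add: conv_def sw_mult_left flip: sw_sum mult.assoc sum_distrib_right)
    (simp add: expand_lf assms)

text \<open>\<open>int_proj f\<close> is a left integral: convolution by \<open>g\<close> multiplies
  it by \<open>g u\<close>. Moving \<open>g\<close> across S(S(e j)) by
  \<open>conv_mul_antipode\<close> leaves a factor \<open>S a\<close> inside \<open>g\<close>;
  rewriting the two dual basis sums as one coproduct makes its left neighbour the preceding leg, so
  \<open>antipode_right\<close> reduces \<open>g\<close> to \<open>g u\<close>.\<close>

lemma int_proj_invariant:
  assumes f: "lf f" and g: "lf g"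
  shows "sw (\<lambda>a b. g a * int_proj f b) x = g u * int_proj f x"
proof -
  note [lin] = f g lf_o[OF f] lf_o[OF g] lf_o[OF lf_conv]
  have "sw (\<lambda>a b. g a * int_proj f b) x =
     (\<Sum>j\<in>I. sw (\<lambda>a b. g a * (e' j \<star> f) (b \<odot> S (S (e j)))) x)"
    by (simp add: int_proj_def sum_distrib_left sw_sum)
  also have "\<dots> = (\<Sum>j\<in>I. sw (\<lambda>b a. sw (\<lambda>c d. g (c \<odot> a) * (e' j \<star> f) d) (x \<odot> S b)) (S (e j)))"
    by (simp add: conv_mul_antipode lin)
  also have "\<dots> = (\<Sum>j\<in>I. \<Sum>i\<in>I. sw (\<lambda>a b. g (e i \<odot> S a) * (e' i \<star> (e' j \<star> f)) (x \<odot> S (S b))) (e j))"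
    by (simp add: sw_S lin) (simp add: lin sw_conv_e'[of "\<lambda>c. g (c \<odot> S _)"] sw_sum)
  also have "\<dots> = (\<Sum>k\<in>I. \<Sum>i\<in>I. \<Sum>j\<in>I. (e' i \<star> e' j) (e k) *
      sw (\<lambda>a b. g (e i \<odot> S a) * (e' k \<star> f) (x \<odot> S (S b))) (e j))"
    by (simp add: e'_conv_e' f sum_distrib_left sw_sum sw_mult_left mult_ac)
      (subst sum.swap, subst (2) sum.swap, subst sum.swap, rule refl)
  also have "\<dots> = (\<Sum>k\<in>I. sw (\<lambda>c d. sw (\<lambda>a b. g (c \<odot> S a) * (e' k \<star> f) (x \<odot> S (S b))) d) (e k))"
    by (intro sum.cong refl sum_conv) (simp_all add: lin)
  also have "\<dots> = (\<Sum>k\<in>I. sw (\<lambda>d b. sw (\<lambda>c a. g (c \<odot> S a) * (e' k \<star> f) (x \<odot> S (S b))) d) (e k))"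
    by (intro sum.cong refl coassoc[symmetric]) (simp_all add: lin)
  also have "\<dots> = (\<Sum>k\<in>I. sw (\<lambda>d b. g u * (\<epsilon> d * (e' k \<star> f) (x \<odot> S (S b)))) (e k))"
    using antipode_right[OF g] by (simp add: mult_ac flip: sw_mult_right)
  also have "\<dots> = g u * int_proj f x"
    by (simp add: lin counit_left int_proj_def flip: sw_mult_left sum_distrib_left)
  finally show ?thesis .
qed

text \<open>The surjectivity half of the fundamental theorem: integrals, moved by the action of
  \<open>H\<close>, generate the whole dual. The two antipode factors combine as S(S a \<odot> b)
  with \<open>a\<close>, \<open>b\<close> neighbouring legs, and this collapses. It supplies a
  nonzero integral.\<close>

lemma int_proj_reconstruct:
  assumes f: "lf f"
  shows "(\<Sum>i\<in>I. int_proj (e' i \<star> f) (x \<odot> S (e i))) = f x"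
proof -
  note [lin] = f lf_o[OF f] lf_o[OF lf_conv]
  have "(\<Sum>i\<in>I. int_proj (e' i \<star> f) (x \<odot> S (e i))) =
      (\<Sum>k\<in>I. \<Sum>j\<in>I. \<Sum>i\<in>I. (e' j \<star> e' i) (e k) * (e' k \<star> f) (x \<odot> (S (e i) \<odot> S (S (e j)))))"
    by (simp add: int_proj_def e'_conv_e' f m_assoc)
      (subst sum.swap, subst (2) sum.swap, subst sum.swap, rule refl)
  also have "\<dots> = (\<Sum>k\<in>I. sw (\<lambda>a b. (e' k \<star> f) (x \<odot> S (S a \<odot> b))) (e k))"
    by (intro sum.cong refl, subst sum_conv) (simp_all add: lin S_m)
  also have "\<dots> = (\<Sum>k\<in>I. \<epsilon> (e k) * (e' k \<star> f) x)"
    using antipode_left[of "\<lambda>z. (e' _ \<star> f) (x \<odot> S z)"] by (simp add: lin S_u m_u)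
  also have "\<dots> = f x"
    by (simp add: lin counit_left flip: sw_conv_e')
  finally show ?thesis .
qed

section \<open>Bijectivity of the antipode\<close>

lemma S_eq_0:
  assumes "S h = 0"
  shows "h = 0"
proof -
  have \<epsilon>: "lf \<epsilon>" by (rule linear_\<epsilon>)
  \<comment> \<open>By reconstruction this sum is \<epsilon> u = 1, so one of the projected
    functionals is a nonzero integral.\<close>
  have "(\<Sum>i\<in>I. int_proj (e' i \<star> \<epsilon>) (u \<odot> S (e i))) \<noteq> 0"
    by (simp add: int_proj_reconstruct \<epsilon> \<epsilon>_u)
  then obtain i x where x: "int_proj (e' i \<star> \<epsilon>) x \<noteq> 0"
    by (meson sum.neutral)
  define l where "l = int_proj (e' i \<star> \<epsilon>)"
  have l: "lf l" unfolding l_def by (intro lf_int_proj lin)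
  have inv: "sw (\<lambda>a b. g a * l b) y = g u * l y" if "lf g" for g y
    unfolding l_def using that by (intro int_proj_invariant lin)
  \<comment> \<open>In \<open>conv_mul_antipode\<close> with \<open>z\<close> taken to be
    \<open>h\<close>, one side vanishes because \<open>S h = 0\<close>; on the other, invariance of
    \<open>l\<close> evaluates the inner sum.\<close>
  have 0: "sw (\<lambda>a b. l (y \<odot> S a) * g b) h = 0" if g: "lf g" for g y
  proof -
    note [lin] = g l lf_o[OF g] lf_o[OF l]
    have "sw (\<lambda>a b. g a * l (b \<odot> S h)) y = sw (\<lambda>a b. g b * l (y \<odot> S a)) h"
      using inv[of "\<lambda>z. g (z \<odot> _)"] by (simp add: conv_mul_antipode lin u_m)
    moreover have "l (b \<odot> S h) = 0" for b
      using lf_scale[OF l, of 0] linear_m_right[of b] assms by (simp add: lv_iff) (metis scale_zero_left)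
    ultimately show ?thesis by (simp add: mult.commute sw_def)
  qed
  have "g h = g 0" if g: "lf g" for g
  proof -
    note [lin] = g l lf_o[OF g] lf_o[OF l]
    \<comment> \<open>The counit of the first leg is inserted in the form a \<odot> S b, under
      \<open>l\<close> and a further antipode.\<close>
    have "l x * g h = sw (\<lambda>w c. sw (\<lambda>a b. l (x \<odot> S (a \<odot> S b)) * g c) w) h"
      using antipode_right[of "\<lambda>z. l (x \<odot> S z)"]
      by (simp add: lin S_u m_u counit_left mult.assoc flip: sw_mult_right)
    also have "\<dots> = sw (\<lambda>a w. sw (\<lambda>b c. l (x \<odot> S (a \<odot> S b)) * g c) w) h"
      by (rule coassoc) (simp_all add: lin)
    \<comment> \<open>S(a \<odot> S b) is S(S b) \<odot> S a, so for each fixed \<open>e i\<close>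
      the sum is an instance of \<open>0\<close> with \<open>y\<close> equal to x \<odot> S(S(e i))
      and \<open>g\<close> composed with \<open>\<delta> i\<close>.\<close>
    also have "\<dots> = (\<Sum>i\<in>I. sw (\<lambda>a w. l (x \<odot> S (S (e i)) \<odot> S a) * g (\<delta> i w)) h)"
      by (simp add: sw_def[of _ "_ :: 'h"] S_m m_assoc) (rule sum.swap)
    also have "\<dots> = 0" using 0 by (simp add: lin)
    finally show ?thesis using x lf_scale[OF g, of 0 0] by (simp add: l_def)
  qed
  then show ?thesis by (rule eq_by_lf)
qed

lemma bij_S: "bij S"
proof -
  have "inj S"
  proof (rule injI)
    fix x y assume "S x = S y"
    moreover have "S (x - y) = S x - S y"
      by (rule module_hom.diff[OF Vector_Spaces.linear.axioms(3)[OF linear_S]])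
    ultimately show "x = y" using S_eq_0[of "x - y"] by simp
  qed
  moreover have "surj S"
  proof -
    have "x \<in> span (e ` I)" for x
    proof -
      have "(\<Sum>i\<in>I. sc (e' i x) (e i)) \<in> span (e ` I)"
        by (intro span_sum span_scale span_base) auto
      then show ?thesis by (simp only: expand)
    qed
    then have UNIV: "span (e ` I) = UNIV" by auto
    \<comment> \<open>\<open>e\<close> is a spanning family here; cutting a basis out of it gives
      finite dimension, where injectivity of a linear endomorphism implies surjectivity.\<close>
    obtain B where B: "B \<subseteq> e ` I" "independent B" "e ` I \<subseteq> span B"
      using maximal_independent_subset[of "e ` I"] by blast
    interpret finite_dimensional_vector_space sc B
    proof
      show "finite B" using B(1) finite_I finite_surj by blast
      show "span B = UNIV" using B(3) UNIV span_mono[of "e ` I" "span B"] by (simp add: span_span top.extremum_unique)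
    qed (rule B(2))
    show ?thesis using linear_inj_imp_surj[OF linear_S \<open>inj S\<close>] .
  qed
  ultimately show ?thesis by (simp add: bij_def)
qed

section \<open>The inverse antipode and its skew antipode laws\<close>

definition T :: "'h \<Rightarrow> 'h" where "T = inv S"

lemma S_T [simp]: "S (T x) = x" and T_S [simp]: "T (S x) = x"
  unfolding T_def using bij_S by (simp_all add: bij_is_surj surj_f_inv_f bij_is_inj)

lemma T_eq_iff: "T x = y \<longleftrightarrow> x = S y"
  using S_T T_S by metis

lemma linear_T: "lv T"
  using linear_S by (simp add: lv_iff T_eq_iff)

lemmas lin_T [lin] = linear_T lv_o[OF linear_T]

lemma T_m: "T (x \<odot> y) = T y \<odot> T x"
  by (simp add: T_eq_iff S_m)

lemma T_u: "T u = u"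
  by (simp add: T_eq_iff S_u)

lemma sw_T:
  assumes G1: "\<And>b. lf (\<lambda>a. G a b)" and G2: "\<And>a. lf (G a)"
  shows "sw G (T h) = sw (\<lambda>a b. G (T b) (T a)) h"
proof -
  note [lin] = lf_o[OF G1] lf_o[OF G2]
  show ?thesis using sw_S[of "\<lambda>a b. G (T b) (T a)" "T h"] by (simp add: lin)
qed

text \<open>Applying the antihomomorphism \<open>T\<close> to S(h1) h2 gives T(h2) h1.\<close>

lemma skew_antipode_left: assumes "lf f" shows "sw (\<lambda>a b. f (T b \<odot> a)) h = \<epsilon> h * f u"
  using antipode_left[of "\<lambda>z. f (T z)" h] by (simp add: lin lf_o assms T_m T_u)

lemma skew_antipode_right: assumes "lf f" shows "sw (\<lambda>a b. f (b \<odot> T a)) h = \<epsilon> h * f u"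
  using antipode_right[of "\<lambda>z. f (T z)" h] by (simp add: lin lf_o assms T_m T_u)

section \<open>The ordinary Drinfel'd double, by pairings\<close>

definition act :: "'h \<Rightarrow> 'h \<Rightarrow> ('h \<Rightarrow> 'k) \<Rightarrow> 'h \<Rightarrow> 'k" where
  "act a c f x = f (S a \<odot> (x \<odot> c))"

lemma lf_act [lin]: "lf f \<Longrightarrow> lf (act a c f)"
  using lf_o[of f "\<lambda>x. S a \<odot> (x \<odot> c)"] unfolding act_def[abs_def] by (simp add: lin)

text \<open>
  \<open>dmul \<Psi> h f k g\<close> applies the bilinear map \<open>\<Psi>\<close> to the product of \<open>h \<otimes> f\<close> and \<open>k \<otimes> g\<close> in the ordinary
  double, and \<open>dm \<phi> x\<close> is the pairing of this product with \<open>\<phi> \<otimes> x\<close>.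
\<close>

definition dmul :: "('h \<Rightarrow> ('h \<Rightarrow> 'k) \<Rightarrow> 'b::comm_monoid_add) \<Rightarrow> 'h \<Rightarrow> ('h \<Rightarrow> 'k) \<Rightarrow> 'h \<Rightarrow> ('h \<Rightarrow> 'k) \<Rightarrow> 'b" where
  "dmul \<Psi> h f k g = sw (\<lambda>k1 k'. sw (\<lambda>k2 k3. \<Psi> (k2 \<odot> h) (act k1 k3 f \<star> g)) k') k"

abbreviation dm :: "('h \<Rightarrow> 'k) \<Rightarrow> 'h \<Rightarrow> 'h \<Rightarrow> ('h \<Rightarrow> 'k) \<Rightarrow> 'h \<Rightarrow> ('h \<Rightarrow> 'k) \<Rightarrow> 'k" where
  "dm \<phi> x \<equiv> dmul (\<lambda>h f. \<phi> h * f x)"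

text \<open>Serves as a congruence rule: the functional fed to \<open>\<Psi>\<close> is always a
  convolution of linear forms, and evaluating \<open>\<Psi>\<close> usually needs that
  linearity.\<close>

lemma dmul_cong:
  "lf f \<Longrightarrow> lf g \<Longrightarrow> (\<And>h f. lf f \<Longrightarrow> \<Psi> h f = \<Phi> h f) \<Longrightarrow> dmul \<Psi> h f k g = dmul \<Phi> h f k g"
  unfolding dmul_def by (simp add: lin)

text \<open>\<open>act a c f\<close> is the untwisted form of
  \<open>c \<rightharpoonup> (f \<leftharpoonup> S a)\<close>. The action respects convolution
  because \<Delta> is multiplicative; \<open>S\<close> reverses the coproduct, so \<open>a2\<close>
  goes to \<open>f\<close> and \<open>a1\<close> to \<open>g\<close>.\<close>

lemma act_conv:
  assumes f: "lf f" and g: "lf g"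
  shows "act a c (f \<star> g) x = sw (\<lambda>a1 a2. sw (\<lambda>c1 c2. (act a2 c1 f \<star> act a1 c2 g) x) c) a"
proof -
  note [lin] = lf_o[OF f] lf_o[OF g]
  have "act a c (f \<star> g) x = sw (\<lambda>a1 a2. sw (\<lambda>x1 x2. sw (\<lambda>c1 c2. act a2 c1 f x1 * act a1 c2 g x2) c) x) a"
    by (simp add: act_def conv_def sw_m sw_S lin)
  also have "\<dots> = sw (\<lambda>a1 a2. sw (\<lambda>c1 c2. (act a2 c1 f \<star> act a1 c2 g) x) c) a"
    unfolding conv_def by (intro sw_cong sw_swap)
  finally show ?thesis .
qed

lemma act_\<epsilon>: "act a c \<epsilon> = (\<lambda>x. \<epsilon> a * \<epsilon> c * \<epsilon> x)"
  by (simp add: act_def fun_eq_iff \<epsilon>_m \<epsilon>_S mult_ac)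

lemma conv_\<epsilon>: "lf f \<Longrightarrow> f \<star> \<epsilon> = f" "lf f \<Longrightarrow> \<epsilon> \<star> f = f"
  by (simp_all add: conv_def fun_eq_iff counit_left counit_right)

text \<open>Two bracketings of the five-fold coproduct of \<open>l\<close>. The left one arises when
  both outer legs are split by \<open>act_conv\<close>, the right one when the coproduct of a
  product splits the middle leg.\<close>

lemma sw_regroup:
  assumes [simp]: "\<And>b c d e. lf (\<lambda>a. M a b c d e)" "\<And>a c d e. lf (\<lambda>b. M a b c d e)"
    "\<And>a b d e. lf (\<lambda>c. M a b c d e)" "\<And>a b c e. lf (\<lambda>d. M a b c d e)" "\<And>a b c d. lf (M a b c d)"
  shows "sw (\<lambda>l1 l'. sw (\<lambda>l2 l3. sw (\<lambda>a1 a2. sw (\<lambda>c1 c2. M a1 a2 l2 c1 c2) l3) l1) l') l =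
    sw (\<lambda>l1 l'. sw (\<lambda>l2 l3. sw (\<lambda>a a'. sw (\<lambda>c c'. M l1 a c c' l3) a') l2) l') l"
proof -
  have "sw (\<lambda>l1 l'. sw (\<lambda>l2 l3. sw (\<lambda>a1 a2. sw (\<lambda>c1 c2. M a1 a2 l2 c1 c2) l3) l1) l') l =
    sw (\<lambda>l1 z. sw (\<lambda>a w. sw (\<lambda>c v. sw (\<lambda>c' l3. M l1 a c c' l3) v) w) z) l"
    by (rule coassoc') (simp_all add: lin)
  also have "\<dots> = sw (\<lambda>l1 z. sw (\<lambda>a w. sw (\<lambda>a' l3. sw (\<lambda>c c'. M l1 a c c' l3) a') w) z) l"
    by (intro sw_cong coassoc[symmetric]) simp_all
  also have "\<dots> = sw (\<lambda>l1 l'. sw (\<lambda>l2 l3. sw (\<lambda>a a'. sw (\<lambda>c c'. M l1 a c c' l3) a') l2) l') l"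
    by (intro sw_cong coassoc[symmetric]) (simp_all add: lin)
  finally show ?thesis .
qed

lemma dm_assoc:
  assumes \<phi>: "lf \<phi>" and f: "lf f" and g: "lf g" and q: "lf q"
  shows "dmul (\<lambda>h' f'. dm \<phi> x h' f' l q) h f k g = dmul (\<lambda>k' g'. dm \<phi> x h f k' g') k g l q"
proof -
  \<comment> \<open>The common summand of both bracketings: five legs of \<open>l\<close>, of which
    1 and 5 act on \<open>g\<close>, 2 and 4 on the already acted-on \<open>f\<close>, and 3
    multiplies \<open>k2 \<odot> h\<close>.\<close>
  define M where "M k1 k2 k3 l1 l2 l3 l4 l5 =
    \<phi> (l3 \<odot> (k2 \<odot> h)) * ((act l2 l4 (act k1 k3 f) \<star> (act l1 l5 g \<star> q)) x)" for k1 k2 k3 l1 l2 l3 l4 l5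
  note [lin] = lf_o[OF \<phi>] lf_o[OF f] lf_o[OF g] lf_o[OF q] f g q
  have M: "lf (\<lambda>a. M k1 k2 k3 a b c d e)" "lf (\<lambda>b. M k1 k2 k3 a b c d e)" "lf (\<lambda>c. M k1 k2 k3 a b c d e)"
    "lf (\<lambda>d. M k1 k2 k3 a b c d e)" "lf (M k1 k2 k3 a b c d)" 
    "lf (\<lambda>k1. M k1 k2 k3 a b c d e)" "lf (\<lambda>k2. M k1 k2 k3 a b c d e)" "lf (\<lambda>k3. M k1 k2 k3 a b c d e)" for k1 k2 k3 a b c d e
    unfolding M_def conv_def act_def by (simp_all add: lin)
  have "dmul (\<lambda>h' f'. dm \<phi> x h' f' l q) h f k g =
    sw (\<lambda>k1 k'. sw (\<lambda>k2 k3. sw (\<lambda>l1 l'. sw (\<lambda>l2 l3. sw (\<lambda>a1 a2. sw (\<lambda>c1 c2.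
      M k1 k2 k3 a1 a2 l2 c1 c2) l3) l1) l') l) k') k"
  proof -
    have "\<phi> (l2 \<odot> (k2 \<odot> h)) * (act l1 l3 (act k1 k3 f \<star> g) \<star> q) x =
      sw (\<lambda>a1 a2. sw (\<lambda>c1 c2. M k1 k2 k3 a1 a2 l2 c1 c2) l3) l1" for k1 k2 k3 l1 l2 l3
    proof -
      have "(act l1 l3 (act k1 k3 f \<star> g) \<star> q) x =
        sw (\<lambda>x1 x2. sw (\<lambda>a1 a2. sw (\<lambda>c1 c2. (act a2 c1 (act k1 k3 f) \<star> act a1 c2 g) x1 * q x2) l3) l1) x"
        by (simp add: conv_def[of _ q] act_conv lin sw_mult_right)
      also have "\<dots> = sw (\<lambda>a1 a2. sw (\<lambda>c1 c2. ((act a2 c1 (act k1 k3 f) \<star> act a1 c2 g) \<star> q) x) l3) l1"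
        unfolding conv_def[of _ q] by (rule sw_swap3)
      finally show ?thesis
        by (simp add: M_def sw_mult_left conv_assoc lin)
    qed
    then show ?thesis by (simp add: dmul_def)
  qed
  also have "\<dots> = sw (\<lambda>k1 k'. sw (\<lambda>k2 k3. sw (\<lambda>l1 l'. sw (\<lambda>l2 l3. sw (\<lambda>a a'. sw (\<lambda>c c'.
      M k1 k2 k3 l1 a c c' l3) a') l2) l') l) k') k"
    by (intro sw_cong sw_regroup M)
  also have "\<dots> = sw (\<lambda>l1 l'. sw (\<lambda>l2 l3. sw (\<lambda>k1 k'. sw (\<lambda>k2 k3. sw (\<lambda>a a'. sw (\<lambda>c c'.
      M k1 k2 k3 l1 a c c' l3) a') l2) k') k) l') l"
    by (subst sw_swap3[symmetric]) (intro sw_cong sw_swap3[symmetric])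
  also have "\<dots> = sw (\<lambda>l1 l'. sw (\<lambda>l2 l3. sw (\<lambda>a a'. sw (\<lambda>k1 k'. sw (\<lambda>c c'. sw (\<lambda>k2 k3.
      M k1 k2 k3 l1 a c c' l3) k') a') k) l2) l') l"
    by (intro sw_cong, subst sw_swap3[symmetric]) (intro sw_cong sw_swap)
  also have "\<dots> = dmul (\<lambda>k' g'. dm \<phi> x h f k' g') k g l q"
    unfolding dmul_def by (simp add: sw_m lin M[unfolded M_def] M_def m_assoc S_m conv_def[of _ "_ \<star> _"] act_def)
  finally show ?thesis .
qed

lemma dm_u:
  assumes "lf \<phi>" "lf f" "lf g"
  shows "dm \<phi> x h f u g = \<phi> h * (f \<star> g) x"
proof -
  note [lin] = assms lf_o[OF assms(1)] lf_o[OF assms(2)]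
  have "dm \<phi> x h f u g = sw (\<lambda>k1 k'. sw (\<lambda>k2 k3. sw (\<lambda>a b. \<phi> (k2 \<odot> h) * (act k1 k3 f a * g b)) x) k') u"
    by (simp add: dmul_def conv_def sw_mult_left)
  also have "\<dots> = \<phi> h * (f \<star> g) x"
    by (simp add: act_def sw_u lin u_m m_u S_u conv_def sw_mult_left)
  finally show ?thesis .
qed

text \<open>The first tensor factor is multiplied in the opposite order. With \<open>dm_u\<close>
  this evaluates all products that the unit laws and the two coproduct axioms of \<open>R\<close>
  require.\<close>

lemma dm_\<epsilon>:
  assumes "lf \<phi>" "lf f"
  shows "dm \<phi> x h \<epsilon> k f = \<phi> (k \<odot> h) * f x"
proof -
  note [lin] = assms lf_o[OF assms(1)]
  have "dm \<phi> x h \<epsilon> k f = sw (\<lambda>k1 k'. \<epsilon> k1 * (sw (\<lambda>k2 k3. \<epsilon> k3 * \<phi> (k2 \<odot> h)) k' * f x)) k"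
    by (simp add: dmul_def act_\<epsilon> conv_def sw_mult_left sw_mult_right mult_ac)
      (simp add: counit_left lin mult.assoc flip: sw_mult_left)
  then show ?thesis by (simp add: lin counit_left counit_right mult.assoc)
qed

text \<open>Six consecutive legs of \<open>k\<close>: the third and the antipode of the fourth
  cancel, and the remaining four are bracketed as in the product of the double when its middle leg
  has been split.\<close>

lemma sw_collapse:
  assumes [simp]: "\<And>b c d e. lf (\<lambda>a. G a b c d e)" "\<And>a c d e. lf (\<lambda>b. G a b c d e)"
    "\<And>a b d e. lf (\<lambda>c. G a b c d e)" "\<And>a b c e. lf (\<lambda>d. G a b c d e)" "\<And>a b c d. lf (G a b c d)"
  shows "sw (\<lambda>k1 k2. sw (\<lambda>a w. sw (\<lambda>b c. sw (\<lambda>p v. sw (\<lambda>q r. G a b (c \<odot> S p) q r) v) k2) w) k1) k =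
    sw (\<lambda>a w. sw (\<lambda>v r. sw (\<lambda>b q. G a b u q r) v) w) k"
proof -
  note [lin] = lf_o[OF assms(1)] lf_o[OF assms(2)] lf_o[OF assms(3)] lf_o[OF assms(4)] lf_o[OF assms(5)]
  have "sw (\<lambda>k1 k2. sw (\<lambda>a w. sw (\<lambda>b c. sw (\<lambda>p v. sw (\<lambda>q r. G a b (c \<odot> S p) q r) v) k2) w) k1) k =
    sw (\<lambda>a z. sw (\<lambda>w k2. sw (\<lambda>b c. sw (\<lambda>p v. sw (\<lambda>q r. G a b (c \<odot> S p) q r) v) k2) w) z) k"
    by (rule coassoc) (simp_all add: lin)
  also have "\<dots> = sw (\<lambda>a z. sw (\<lambda>b z'. sw (\<lambda>c k2. sw (\<lambda>p v. sw (\<lambda>q r. G a b (c \<odot> S p) q r) v) k2) z') z) k"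
    by (intro sw_cong coassoc) (simp_all add: lin)
  also have "\<dots> = sw (\<lambda>a z. sw (\<lambda>b z'. sw (\<lambda>s v. sw (\<lambda>c p. sw (\<lambda>q r. G a b (c \<odot> S p) q r) v) s) z') z) k"
    by (intro sw_cong coassoc[symmetric]) (simp_all add: lin)
  also have "\<dots> = sw (\<lambda>a z. sw (\<lambda>b z'. sw (\<lambda>s v. \<epsilon> s * sw (\<lambda>q r. G a b u q r) v) z') z) k"
    by (intro sw_cong antipode_right) (simp_all add: lin)
  also have "\<dots> = sw (\<lambda>a z. sw (\<lambda>b z'. sw (\<lambda>q r. G a b u q r) z') z) k"
    by (simp add: counit_left lin)
  also have "\<dots> = sw (\<lambda>a w. sw (\<lambda>v r. sw (\<lambda>b q. G a b u q r) v) w) k"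
    by (intro sw_cong coassoc[symmetric]) (simp_all add: lin)
  finally show ?thesis .
qed

text \<open>Pairing the dual leg with \<open>x\<close> and \<open>y\<close> turns the coproduct of a
  functional into its value at \<open>x \<odot> y\<close>. On the right, summing over the dual bases
  leaves f(S k1 x1 k3 S k4 y1 k6) g(x2 y2) with six legs of \<open>k\<close>;
  \<open>sw_collapse\<close> removes k3 S k4.\<close>

lemma dm_comul:
  assumes \<phi>: "lf \<phi>" and \<psi>: "lf \<psi>" and f: "lf f" and g: "lf g"
  shows "dmul (\<lambda>h' f'. sw (\<lambda>a b. \<phi> a * \<psi> b) h' * f' (x \<odot> y)) h f k g =
    sw (\<lambda>h1 h2. \<Sum>i\<in>I. sw (\<lambda>k1 k2. \<Sum>j\<in>I. dm \<phi> x h1 (e' i) k1 (e' j) *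
      dm \<psi> y h2 (\<lambda>z. f (e i \<odot> z)) k2 (\<lambda>z. g (e j \<odot> z))) k) h"
proof -
  note [lin] = lf_o[OF \<phi>] lf_o[OF \<psi>] lf_o[OF f] lf_o[OF g] f g \<phi> \<psi>
  \<comment> \<open>The slot \<open>s\<close> stands between \<open>x1\<close> and
    \<open>y1\<close>: it is \<open>u\<close> on the left side of the claim and
    \<open>c \<odot> S p\<close> on the right.\<close>
  define G where "G k1 k2 s k3 k4 h1 h2 = \<phi> (k2 \<odot> h1) * (\<psi> (k3 \<odot> h2) *
      sw (\<lambda>x1 x2. sw (\<lambda>y1 y2. f (S k1 \<odot> (x1 \<odot> (s \<odot> (y1 \<odot> k4)))) * g (x2 \<odot> y2)) y) x)"
    for k1 k2 s k3 k4 h1 h2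
  have G: "lf (\<lambda>k1. G k1 k2 s k3 k4 h1 h2)" "lf (\<lambda>k2. G k1 k2 s k3 k4 h1 h2)" "lf (\<lambda>s. G k1 k2 s k3 k4 h1 h2)"
    "lf (\<lambda>k3. G k1 k2 s k3 k4 h1 h2)" "lf (\<lambda>k4. G k1 k2 s k3 k4 h1 h2)" for k1 k2 s k3 k4 h1 h2
    unfolding G_def by (simp_all add: lin)
  have "dmul (\<lambda>h' f'. sw (\<lambda>a b. \<phi> a * \<psi> b) h' * f' (x \<odot> y)) h f k g =
    sw (\<lambda>k1 w. sw (\<lambda>v k4. sw (\<lambda>k2 k3. sw (\<lambda>h1 h2. G k1 k2 u k3 k4 h1 h2) h) v) w) k"
    by (simp add: dmul_def sw_m lin sw_mult_right sw_mult_left conv_def act_def m_assoc u_m G_def mult.assoc)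
  also have "\<dots> = sw (\<lambda>k1 k2. sw (\<lambda>a w. sw (\<lambda>b c. sw (\<lambda>p v. sw (\<lambda>q r. sw (\<lambda>h1 h2.
      G a b (c \<odot> S p) q r h1 h2) h) v) k2) w) k1) k"
    by (rule sw_collapse[symmetric]) (simp_all add: lin G)
  also have "\<dots> = sw (\<lambda>h1 h2. sw (\<lambda>k1 k2. sw (\<lambda>a w. sw (\<lambda>b c. sw (\<lambda>p v. sw (\<lambda>q r.
      G a b (c \<odot> S p) q r h1 h2) v) k2) w) k1) k) h"
    by (simp only: sw_swap[where y = h])
  also have "\<dots> = sw (\<lambda>h1 h2. \<Sum>i\<in>I. sw (\<lambda>k1 k2. \<Sum>j\<in>I. dm \<phi> x h1 (e' i) k1 (e' j) *
      dm \<psi> y h2 (\<lambda>z. f (e i \<odot> z)) k2 (\<lambda>z. g (e j \<odot> z))) k) h"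
  proof (rule sw_cong)
    fix h1 h2
    have "(\<Sum>i\<in>I. \<Sum>j\<in>I. (act a c (e' i) \<star> e' j) x * (act p r (\<lambda>z. f (e i \<odot> z)) \<star> (\<lambda>z. g (e j \<odot> z))) y) =
       sw (\<lambda>x1 x2. sw (\<lambda>y1 y2. f (S a \<odot> (x1 \<odot> (c \<odot> (S p \<odot> (y1 \<odot> r))))) * g (x2 \<odot> y2)) y) x" for a c p r
    proof -
      have "(\<Sum>i\<in>I. \<Sum>j\<in>I. (act a c (e' i) \<star> e' j) x * (act p r (\<lambda>z. f (e i \<odot> z)) \<star> (\<lambda>z. g (e j \<odot> z))) y) =
        sw (\<lambda>x1 x2. sw (\<lambda>y1 y2. (\<Sum>i\<in>I. e' i (S a \<odot> (x1 \<odot> c)) * f (e i \<odot> (S p \<odot> (y1 \<odot> r)))) *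
           (\<Sum>j\<in>I. e' j x2 * g (e j \<odot> y2))) y) x"
        by (simp add: conv_def act_def sum_product sw_mult_left sw_mult_right sw_sum mult_ac)
          (subst sum.swap, subst sw_swap, rule refl)
      then show ?thesis
        using expand_lf(1)[of "\<lambda>z. f (z \<odot> _)"] expand_lf(1)[of "\<lambda>z. g (z \<odot> _)"] by (simp add: lin m_assoc)
    qed
    then have "G a b (c \<odot> S p) q r h1 h2 = (\<Sum>i\<in>I. \<Sum>j\<in>I. \<phi> (b \<odot> h1) * (act a c (e' i) \<star> e' j) x *
       (\<psi> (q \<odot> h2) * (act p r (\<lambda>z. f (e i \<odot> z)) \<star> (\<lambda>z. g (e j \<odot> z))) y))" for a b c p q r
      by (simp add: G_def m_assoc mult_ac flip: sum_distrib_left)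
    then show "sw (\<lambda>k1 k2. sw (\<lambda>a w. sw (\<lambda>b c. sw (\<lambda>p v. sw (\<lambda>q r.
      G a b (c \<odot> S p) q r h1 h2) v) k2) w) k1) k = (\<Sum>i\<in>I. sw (\<lambda>k1 k2. \<Sum>j\<in>I. dm \<phi> x h1 (e' i) k1 (e' j) *
      dm \<psi> y h2 (\<lambda>z. f (e i \<odot> z)) k2 (\<lambda>z. g (e j \<odot> z))) k)"
      by (simp add: dmul_def sw_sum sw_mult_right) (simp add: sw_mult_left)
  qed
  finally show ?thesis .
qed

lemma dm_counit:
  assumes "lf f" "lf g"
  shows "dm \<epsilon> u h f k g = \<epsilon> h * f u * (\<epsilon> k * g u)"
proof -
  note [lin] = assms lf_o[OF assms(1)]
  have "dm \<epsilon> u h f k g = sw (\<lambda>k1 k'. sw (\<lambda>k2 k3. \<epsilon> k2 * (\<epsilon> h * f (S k1 \<odot> k3) * g u)) k') k"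
    by (simp add: dmul_def \<epsilon>_m conv_def sw_u act_def lf_o lin u_m mult_ac)
  also have "\<dots> = \<epsilon> h * g u * sw (\<lambda>k1 k'. f (S k1 \<odot> k')) k"
    by (simp add: counit_left lin sw_mult_left mult_ac)
  also have "\<dots> = \<epsilon> h * f u * (\<epsilon> k * g u)"
    by (simp add: antipode_left assms)
  finally show ?thesis .
qed

text \<open>The opposite coproduct times the canonical element, for fixed legs of \<open>h\<close>.
  Summing over \<open>i\<close> substitutes a leg of \<open>x\<close> for \<open>e i\<close>; as
  \<open>T\<close> reverses coproducts, it meets the leg already in \<open>f\<close> as
  \<open>T c \<odot> x1\<close>, which \<open>skew_antipode_left\<close> removes.\<close>

lemma dm_R_left:
  assumes \<phi>: "lf \<phi>" and \<psi>: "lf \<psi>" and f: "lf f"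
  shows "(\<Sum>i\<in>I. \<Sum>j\<in>I. dm \<phi> x h2 (\<lambda>z. f (e j \<odot> z)) u (e' i) * dm \<psi> y h1 (e' j) (T (e i)) \<epsilon>) =
    \<phi> h2 * sw (\<lambda>a b. \<psi> (T a \<odot> h1) * f (b \<odot> y)) x"
proof -
  note [lin] = lf_o[OF \<phi>] lf_o[OF \<psi>] lf_o[OF f] f \<phi> \<psi>
  have "(\<Sum>i\<in>I. \<Sum>j\<in>I. dm \<phi> x h2 (\<lambda>z. f (e j \<odot> z)) u (e' i) * dm \<psi> y h1 (e' j) (T (e i)) \<epsilon>) =
    (\<Sum>i\<in>I. \<Sum>j\<in>I. \<phi> h2 * sw (\<lambda>x1 x2. e' i x2 * f (e j \<odot> x1)) x *
      sw (\<lambda>a b. sw (\<lambda>c d. \<psi> (T d \<odot> h1) * e' j (b \<odot> (y \<odot> T c))) a) (e i))"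
    by (simp add: dm_u lin, simp add: dmul_def sw_T lin conv_\<epsilon>)
      (simp add: conv_def act_def mult.commute sw_T lin)
  also have "\<dots> = \<phi> h2 * sw (\<lambda>x1 x2. \<Sum>i\<in>I. e' i x2 *
      sw (\<lambda>a b. sw (\<lambda>c d. \<psi> (T d \<odot> h1) * (\<Sum>j\<in>I. e' j (b \<odot> (y \<odot> T c)) * f (e j \<odot> x1))) a) (e i)) x"
    by (simp add: sum_distrib_left sw_sum sw_mult_right mult.assoc) (simp add: sw_mult_left mult_ac)
  also have "\<dots> = \<phi> h2 * sw (\<lambda>x1 x2. sw (\<lambda>a b. sw (\<lambda>c d. \<psi> (T d \<odot> h1) * f (b \<odot> (y \<odot> (T c \<odot> x1)))) a) x2) x"
    using expand_lf(1)[of "\<lambda>z. f (z \<odot> _)"] by (simp add: lin m_assoc) (simp add: expand_lf lin)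
  also have "sw (\<lambda>x1 x2. sw (\<lambda>a b. sw (\<lambda>c d. \<psi> (T d \<odot> h1) * f (b \<odot> (y \<odot> (T c \<odot> x1)))) a) x2) x =
     sw (\<lambda>x1 x2. sw (\<lambda>c w. sw (\<lambda>d b. \<psi> (T d \<odot> h1) * f (b \<odot> (y \<odot> (T c \<odot> x1)))) w) x2) x"
    by (intro sw_cong coassoc) (simp_all add: lin)
  also have "\<dots> = sw (\<lambda>v w. sw (\<lambda>x1 c. sw (\<lambda>d b. \<psi> (T d \<odot> h1) * f (b \<odot> (y \<odot> (T c \<odot> x1)))) w) v) x"
    by (rule coassoc[symmetric]) (simp_all add: lin)
  also have "\<dots> = sw (\<lambda>v w. \<epsilon> v * sw (\<lambda>d b. \<psi> (T d \<odot> h1) * f (b \<odot> y)) w) x"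
    using skew_antipode_left[of "\<lambda>z. sw (\<lambda>d b. \<psi> (T d \<odot> h1) * f (b \<odot> (y \<odot> z))) _"]
    by (simp add: lin m_u)
  also have "\<dots> = sw (\<lambda>a b. \<psi> (T a \<odot> h1) * f (b \<odot> y)) x"
    by (simp add: counit_left lin)
  finally show ?thesis .
qed

text \<open>The canonical element times the coproduct. Here \<open>e i\<close> becomes S p1 \<odot>
  x1 \<odot> p3, whose image under \<open>T\<close> is T p3 \<odot> T x1 \<odot> p1; so
  \<open>h2\<close> stands next to \<open>T p3\<close> and \<open>skew_antipode_right\<close>
  applies. The outcome is chosen to match \<open>dm_R_left\<close>.\<close>

lemma dm_R_right:
  assumes \<phi>: "lf \<phi>" and \<psi>: "lf \<psi>" and f: "lf f"
  shows "sw (\<lambda>h1 h2. \<Sum>i\<in>I. \<Sum>j\<in>I. dm \<phi> x u (e' i) h1 (e' j) * dm \<psi> y (T (e i)) \<epsilon> h2 (\<lambda>z. f (e j \<odot> z))) h =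
    sw (\<lambda>h1 h2. \<phi> h2 * sw (\<lambda>a b. \<psi> (T a \<odot> h1) * f (b \<odot> y)) x) h"
proof -
  note [lin] = lf_o[OF \<phi>] lf_o[OF \<psi>] lf_o[OF f] f \<phi> \<psi>
  have "(\<Sum>i\<in>I. \<Sum>j\<in>I. dm \<phi> x u (e' i) h1 (e' j) * dm \<psi> y (T (e i)) \<epsilon> h2 (\<lambda>z. f (e j \<odot> z))) =
     sw (\<lambda>p1 w. sw (\<lambda>p2 p3. sw (\<lambda>x1 x2. \<phi> p2 * (\<psi> ((h2 \<odot> T p3) \<odot> (T x1 \<odot> p1)) * f (x2 \<odot> y))) x) w) h1" for h1 h2
  proof -
    have "(\<Sum>i\<in>I. \<Sum>j\<in>I. dm \<phi> x u (e' i) h1 (e' j) * dm \<psi> y (T (e i)) \<epsilon> h2 (\<lambda>z. f (e j \<odot> z))) =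
      sw (\<lambda>p1 w. sw (\<lambda>p2 p3. sw (\<lambda>x1 x2. \<phi> p2 * ((\<Sum>i\<in>I. e' i (S p1 \<odot> (x1 \<odot> p3)) * \<psi> (h2 \<odot> T (e i))) *
        (\<Sum>j\<in>I. e' j x2 * f (e j \<odot> y)))) x) w) h1"
      by (simp add: dm_\<epsilon> lin, simp add: dmul_def m_u conv_def act_def sum_product sw_mult_left sw_mult_right sw_sum
          sum_distrib_left mult_ac)
    then show ?thesis
      using expand_lf(1)[of "\<lambda>z. f (z \<odot> _)"] expand_lf(1)[of "\<lambda>z. \<psi> (_ \<odot> T z)"]
      by (simp add: lin m_assoc T_m)
  qed
  then have "sw (\<lambda>h1 h2. \<Sum>i\<in>I. \<Sum>j\<in>I. dm \<phi> x u (e' i) h1 (e' j) * dm \<psi> y (T (e i)) \<epsilon> h2 (\<lambda>z. f (e j \<odot> z))) h =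
    sw (\<lambda>h1 h2. sw (\<lambda>p1 w. sw (\<lambda>p2 p3. sw (\<lambda>x1 x2. \<phi> p2 * (\<psi> ((h2 \<odot> T p3) \<odot> (T x1 \<odot> p1)) * f (x2 \<odot> y))) x) w) h1) h"
    by simp
  also have "\<dots> = sw (\<lambda>p1 z. sw (\<lambda>w h2. sw (\<lambda>p2 p3. sw (\<lambda>x1 x2. \<phi> p2 * (\<psi> ((h2 \<odot> T p3) \<odot> (T x1 \<odot> p1)) * f (x2 \<odot> y))) x) w) z) h"
    by (rule coassoc) (simp_all add: lin)
  also have "\<dots> = sw (\<lambda>p1 z. sw (\<lambda>p2 v. sw (\<lambda>p3 h2. sw (\<lambda>x1 x2. \<phi> p2 * (\<psi> ((h2 \<odot> T p3) \<odot> (T x1 \<odot> p1)) * f (x2 \<odot> y))) x) v) z) h"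
    by (intro sw_cong coassoc) (simp_all add: lin)
  also have "\<dots> = sw (\<lambda>p1 z. sw (\<lambda>p2 v. \<epsilon> v * sw (\<lambda>x1 x2. \<phi> p2 * (\<psi> (T x1 \<odot> p1) * f (x2 \<odot> y))) x) z) h"
    using skew_antipode_right[of "\<lambda>z. sw (\<lambda>x1 x2. \<phi> _ * (\<psi> (z \<odot> (T x1 \<odot> _)) * f (x2 \<odot> y))) x"]
    by (simp add: lin u_m)
  also have "\<dots> = sw (\<lambda>h1 h2. \<phi> h2 * sw (\<lambda>a b. \<psi> (T a \<odot> h1) * f (b \<odot> y)) x) h"
    by (simp add: counit_right lin) (simp add: sw_mult_left)
  finally show ?thesis .
qed

end

section \<open>Hopf algebras with an automorphism\<close>

locale fd_hopf_aut = fd_hopf +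
  fixes \<alpha> \<beta> :: "'b \<Rightarrow> 'b"
  assumes linear_\<alpha>: "Vector_Spaces.linear sc sc \<alpha>"
    and \<alpha>_\<beta> [simp]: "\<alpha> (\<beta> x) = x" and \<beta>_\<alpha> [simp]: "\<beta> (\<alpha> x) = x"
    and \<alpha>_m: "\<alpha> (x \<odot> y) = \<alpha> x \<odot> \<alpha> y" and \<alpha>_u: "\<alpha> u = u"
    and \<epsilon>_\<alpha>: "\<epsilon> (\<alpha> x) = \<epsilon> x" and S_\<alpha>: "S (\<alpha> x) = \<alpha> (S x)"
    and \<alpha>_\<delta>: "(\<And>b. Vector_Spaces.linear sc (*) (\<lambda>a. G a b)) \<Longrightarrow>
      (\<And>a. Vector_Spaces.linear sc (*) (G a)) \<Longrightarrow>
      (\<Sum>i\<in>I. G (e i) (\<delta> i (\<alpha> h))) = (\<Sum>i\<in>I. G (\<alpha> (e i)) (\<alpha> (\<delta> i h)))"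
begin

lemma \<beta>_eq_iff: "\<beta> x = y \<longleftrightarrow> x = \<alpha> y"
  by auto

lemma linear_\<beta>: "lv \<beta>"
  using linear_\<alpha> by (simp add: lv_iff \<beta>_eq_iff)

lemmas lin_\<alpha> [lin] = linear_\<alpha> linear_\<beta> lv_o[OF linear_\<alpha>] lv_o[OF linear_\<beta>]

lemma \<beta>_m: "\<beta> (x \<odot> y) = \<beta> x \<odot> \<beta> y" and \<beta>_u: "\<beta> u = u"
  and \<epsilon>_\<beta>: "\<epsilon> (\<beta> x) = \<epsilon> x" and S_\<beta>: "S (\<beta> x) = \<beta> (S x)"
  using \<epsilon>_\<alpha>[of "\<beta> x"] S_\<alpha>[of "\<beta> x"] by (simp_all add: \<beta>_eq_iff \<alpha>_m \<alpha>_u)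

lemma T_\<beta>: "T (\<beta> x) = \<beta> (T x)"
  by (simp add: T_eq_iff S_\<beta>)

lemma sw_\<alpha>:
  assumes "\<And>b. lf (\<lambda>a. G a b)" "\<And>a. lf (G a)"
  shows "sw G (\<alpha> h) = sw (\<lambda>a b. G (\<alpha> a) (\<alpha> b)) h"
  unfolding sw_def by (rule \<alpha>_\<delta>) (use assms in auto)

lemma sw_\<beta>:
  assumes "\<And>b. lf (\<lambda>a. G a b)" "\<And>a. lf (G a)"
  shows "sw G (\<beta> h) = sw (\<lambda>a b. G (\<beta> a) (\<beta> b)) h"
  using sw_\<alpha>[of "\<lambda>a b. G (\<beta> a) (\<beta> b)" "\<beta> h"] by (simp add: lf_o[OF assms(1)] lf_o[OF assms(2)] lin)

lemma conv_\<beta>: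
  assumes "lf f" "lf g"
  shows "((\<lambda>z. f (\<beta> z)) \<star> (\<lambda>z. g (\<beta> z))) x = (f \<star> g) (\<beta> x)"
  by (simp add: conv_def sw_\<beta> lf_o[OF assms(1)] lf_o[OF assms(2)] assms lin)

lemma act_\<beta>: "act (\<alpha> a) (\<alpha> c) (\<lambda>z. f (\<beta> z)) = (\<lambda>x. act a c f (\<beta> x))"
  by (simp add: act_def fun_eq_iff \<beta>_m S_\<alpha>)

text \<open>\<alpha> and the dual of its inverse together act on the ordinary double by an
  automorphism. In pairings the twist passes to the test data: \<open>\<phi>\<close> absorbs
  \<alpha> and \<open>x\<close> absorbs \<beta>.\<close>

lemma dm_natural:
  assumes \<phi>: "lf \<phi>" and f: "lf f" and g: "lf g"
  shows "dm \<phi> x (\<alpha> h) (\<lambda>z. f (\<beta> z)) (\<alpha> k) (\<lambda>z. g (\<beta> z)) = dm (\<lambda>z. \<phi> (\<alpha> z)) (\<beta> x) h f k g"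
proof -
  note [lin] = lf_o[OF \<phi>] lf_o[OF f] lf_o[OF g] f g
  have "dm \<phi> x (\<alpha> h) (\<lambda>z. f (\<beta> z)) (\<alpha> k) (\<lambda>z. g (\<beta> z)) =
    sw (\<lambda>k1 k'. sw (\<lambda>k2 k3. \<phi> (\<alpha> k2 \<odot> \<alpha> h) * (act (\<alpha> k1) (\<alpha> k3) (\<lambda>z. f (\<beta> z)) \<star> (\<lambda>z. g (\<beta> z))) x) k') k"
    unfolding dmul_def by (simp add: sw_\<alpha> lin conv_def act_def)
  also have "\<dots> = dm (\<lambda>z. \<phi> (\<alpha> z)) (\<beta> x) h f k g"
    by (simp add: dmul_def act_\<beta> conv_\<beta> lin \<alpha>_m)
  finally show ?thesis .
qed

end

section \<open>Linear maps on tensor products\<close>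

lemma linear_on_id: "linear_on V V (\<lambda>x. x)"
  by (simp add: linear_on_def)

lemma linear_on_comp: "linear_on W X g \<Longrightarrow> linear_on V W f \<Longrightarrow> linear_on V X (\<lambda>x. g (f x))"
  by (simp add: linear_on_def)

lemma linear_on_zero:
  assumes "is_vsp V" "linear_on V W f"
  shows "f 0 = 0"
  using linear_onD(2)[OF assms(2), of 0 0] is_vspD(1)[OF assms(1)] by simp

lemma carr_sum: "is_vsp V \<Longrightarrow> (\<And>i. i \<in> J \<Longrightarrow> g i \<in> carr V) \<Longrightarrow> (\<Sum>i\<in>J. g i) \<in> carr V"
  by (induction J rule: infinite_finite_induct) (simp_all add: is_vspD)

lemma linear_on_sum:
  assumes "is_vsp V" "linear_on V W f" "\<And>i. i \<in> J \<Longrightarrow> g i \<in> carr V"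
  shows "f (\<Sum>i\<in>J. g i) = (\<Sum>i\<in>J. f (g i))"
  using assms(3)
  by (induction J rule: infinite_finite_induct)
    (simp_all add: linear_on_zero[OF assms(1,2)] linear_onD[OF assms(2)] carr_sum[OF assms(1)])

lemma linear_on_sum_fun:
  assumes W: "is_vsp W" and "\<And>i. i \<in> J \<Longrightarrow> linear_on V W (f i)"
  shows "linear_on V W (\<lambda>x. \<Sum>i\<in>J. f i x)"
proof -
  have "smul W c (\<Sum>i\<in>J. g i) = (\<Sum>i\<in>J. smul W c (g i))" for c g
    using module.scale_sum_right[OF is_vspD(5)[OF W]] by simp
  then show ?thesis using assms(2)
    by (auto simp: linear_on_def sum.distrib intro!: carr_sum[OF W])
qed

lemma linear_on_smul: 
  assumes "is_vsp W" "linear_on V base_field f" "w \<in> carr W"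
  shows "linear_on V W (\<lambda>x. smul W (f x) w)"
  using assms is_vspD(3)[OF assms(1)] vector_space.vector_space_assms[OF is_vspD(4)[OF assms(1)]]
  by (simp add: linear_on_def base_field_def)

lemma linear_on_smul_const: 
  assumes "is_vsp W" "linear_on V W f"
  shows "linear_on V W (\<lambda>x. smul W c (f x))"
  using assms is_vspD(3)[OF assms(1)] vector_space.vector_space_assms[OF is_vspD(4)[OF assms(1)]]
  by (simp add: linear_on_def mult.commute)

lemma linear_on_mult:
  "linear_on V base_field f \<Longrightarrow> linear_on V base_field (\<lambda>x. f x * c)"
  "linear_on V base_field f \<Longrightarrow> linear_on V base_field (\<lambda>x. c * f x)"
  by (simp_all add: linear_on_def base_field_def algebra_simps)

lemma bilinear_onI:
  "(\<And>v. v \<in> carr V \<Longrightarrow> linear_on W X (f v)) \<Longrightarrow> (\<And>w. w \<in> carr W \<Longrightarrow> linear_on V X (\<lambda>v. f v w)) \<Longrightarrow>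
    bilinear_on V W X f"
  by (simp add: bilinear_on_def)

lemma bilinear_onD:
  assumes "bilinear_on V W X f"
  shows "v \<in> carr V \<Longrightarrow> linear_on W X (f v)" "w \<in> carr W \<Longrightarrow> linear_on V X (\<lambda>v. f v w)"
    "v \<in> carr V \<Longrightarrow> w \<in> carr W \<Longrightarrow> f v w \<in> carr X"
  using assms by (simp_all add: bilinear_on_def linear_on_def)

lemma bilinear_on_comp:
  assumes "bilinear_on V W X f"
  shows "linear_on Y V g \<Longrightarrow> w \<in> carr W \<Longrightarrow> linear_on Y X (\<lambda>y. f (g y) w)"
    and "linear_on Y W h \<Longrightarrow> v \<in> carr V \<Longrightarrow> linear_on Y X (\<lambda>y. f v (h y))"
  using linear_on_comp[OF bilinear_onD(2)[OF assms]] linear_on_comp[OF bilinear_onD(1)[OF assms]] by blast+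

lemmas tlift_linear = tensor_universal(1)
lemmas tlift_tens = tensor_universal(2)

lemma tensor_eqI:
  assumes "is_vsp V" "is_vsp W" "is_vsp X" "linear_on (tensor V W) X F" "linear_on (tensor V W) X G"
    "\<And>v w. v \<in> carr V \<Longrightarrow> w \<in> carr W \<Longrightarrow> F (tens V W v w) = G (tens V W v w)" "t \<in> carr (tensor V W)"
  shows "F t = G t"
proof -
  have "bilinear_on V W X (\<lambda>v w. G (tens V W v w))"
    using assms(5) bilinear_on_tens[OF assms(1,2)] by (rule bilinear_on_compose[rotated])
  from tensor_universal(3)[OF assms(1-3) this] assms(4-7) show ?thesis by metis
qed

text \<open>One fixed representation of \<open>t\<close> as a finite sum of pure tensors serves all
  \<open>x\<close>; the lift is then a finite sum of the values of \<open>G x\<close>, linear term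
  by term.\<close>

lemma linear_on_tlift_param:
  assumes V: "is_vsp V" and W: "is_vsp W" and Y: "is_vsp Y" and X: "is_vsp X"
    and G1: "\<And>x. x \<in> carr X \<Longrightarrow> bilinear_on V W Y (G x)"
    and G2: "\<And>v w. v \<in> carr V \<Longrightarrow> w \<in> carr W \<Longrightarrow> linear_on X Y (\<lambda>x. G x v w)"
    and t: "t \<in> carr (tensor V W)"
  shows "linear_on X Y (\<lambda>x. tlift V W (G x) t)"
proof -
  obtain ps where ps: "set ps \<subseteq> carr V \<times> carr W" "t = (\<Sum>(v, w)\<leftarrow>ps. tens V W v w)"
    using tensor_cases[OF V t] by blast
  have 1: "tlift V W (G x) t = (\<Sum>p\<leftarrow>ps. G x (fst p) (snd p))" if "x \<in> carr X" for x
    unfolding ps(2) by (subst tlift_sum_list[OF Y G1[OF that] ps(1)]) (simp add: case_prod_unfold)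
  have "linear_on X Y (\<lambda>x. \<Sum>p\<leftarrow>ps. G x (fst p) (snd p))"
    using ps(1)
  proof (induction ps)
    case Nil
    then show ?case using is_vspD(1)[OF Y] module.scale_zero_right[OF is_vspD(5)[OF Y]]
      by (simp add: linear_on_def)
  next
    case (Cons p ps)
    then have "linear_on X Y (\<lambda>x. G x (fst p) (snd p))" by (intro G2) auto
    with Cons show ?case using is_vspD(2)[OF Y] module.scale_right_distrib[OF is_vspD(5)[OF Y]]
      by (simp add: linear_on_def)
  qed
  then show ?thesis using is_vspD(2,3)[OF X] by (simp add: linear_on_def 1)
qed

lemma bilinear_on_tmap:
  assumes "is_vsp V'" "is_vsp W'" "linear_on V V' f" "linear_on W W' g"
  shows "bilinear_on V W (tensor V' W') (\<lambda>v w. tens V' W' (f v) (g w))"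
  by (intro bilinear_onI bilinear_on_comp[OF bilinear_on_tens[OF assms(1,2)]] assms(3,4)
    linear_onD(1)[OF assms(3)] linear_onD(1)[OF assms(4)])

context
  fixes V :: "('k::field, 'a::ab_group_add, 'm) vsp_scheme"
    and W :: "('k, 'b::ab_group_add, 'n) vsp_scheme"
  assumes V: "is_vsp V" and W: "is_vsp W"
begin

lemma tmap_linear:
  assumes "is_vsp V'" "is_vsp W'" "linear_on V V' f" "linear_on W W' g"
  shows "linear_on (tensor V W) (tensor V' W') (tmap V W V' W' f g)"
  unfolding tmap_def by (intro tlift_linear V W is_vsp_tensor bilinear_on_tmap assms)

lemma tmap_tens:
  assumes "is_vsp V'" "is_vsp W'" "linear_on V V' f" "linear_on W W' g" "v \<in> carr V" "w \<in> carr W"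
  shows "tmap V W V' W' f g (tens V W v w) = tens V' W' (f v) (g w)"
  unfolding tmap_def by (rule tlift_tens[OF V W is_vsp_tensor bilinear_on_tmap]) (use assms in auto)

lemma bilinear_on_flip: "bilinear_on V W (tensor W V) (\<lambda>v w. tens W V w v)"
  using bilinear_onD[OF bilinear_on_tens[OF W V]] by (intro bilinear_onI)

lemma tflip_linear: "linear_on (tensor V W) (tensor W V) (tflip V W)"
  unfolding tflip_def by (intro tlift_linear V W is_vsp_tensor bilinear_on_flip)

lemma tflip_tens: "v \<in> carr V \<Longrightarrow> w \<in> carr W \<Longrightarrow> tflip V W (tens V W v w) = tens W V w v"
  unfolding tflip_def by (rule tlift_tens[OF V W is_vsp_tensor bilinear_on_flip])

context
  fixes U :: "('k, 'c::ab_group_add, 'l) vsp_scheme"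
  assumes U: "is_vsp U"
begin

lemma bilinear_on_tassoc_inner: "w \<in> carr W \<Longrightarrow> bilinear_on U V (tensor U (tensor V W)) (\<lambda>u v. tens U (tensor V W) u (tens V W v w))"
  by (rule bilinear_on_tmap[OF U is_vsp_tensor linear_on_id]) (rule bilinear_onD(2)[OF bilinear_on_tens[OF V W]])

lemma bilinear_on_tassoc:
  "bilinear_on (tensor U V) W (tensor U (tensor V W))
    (\<lambda>t w. tlift U V (\<lambda>u v. tens U (tensor V W) u (tens V W v w)) t)"
proof (rule bilinear_onI)
  fix t assume t: "t \<in> carr (tensor U V)"
  show "linear_on W (tensor U (tensor V W)) (\<lambda>w. tlift U V (\<lambda>u v. tens U (tensor V W) u (tens V W v w)) t)"
    by (intro linear_on_tlift_param U V W is_vsp_tensor bilinear_on_tassoc_inner t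
        bilinear_on_comp(2)[OF bilinear_on_tens[OF U is_vsp_tensor]] bilinear_onD(1)[OF bilinear_on_tens[OF V W]])
next
  fix w assume w: "w \<in> carr W"
  show "linear_on (tensor U V) (tensor U (tensor V W)) (\<lambda>t. tlift U V (\<lambda>u v. tens U (tensor V W) u (tens V W v w)) t)"
    by (intro tlift_linear U V is_vsp_tensor bilinear_on_tassoc_inner w)
qed

lemma tassoc_linear: "linear_on (tensor (tensor U V) W) (tensor U (tensor V W)) (tassoc U V W)"
  unfolding tassoc_def by (intro tlift_linear is_vsp_tensor W bilinear_on_tassoc)

lemma tassoc_tens:
  assumes "x \<in> carr U" "v \<in> carr V" "w \<in> carr W"
  shows "tassoc U V W (tens (tensor U V) W (tens U V x v) w) = tens U (tensor V W) x (tens V W v w)"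
  unfolding tassoc_def
  by (simp add: tlift_tens[OF is_vsp_tensor W is_vsp_tensor bilinear_on_tassoc] assms tens_in
     tlift_tens[OF U V is_vsp_tensor bilinear_on_tassoc_inner])

end

context
  fixes m n
  assumes m: "bilinear_on V V V m" and n: "bilinear_on W W W n"
begin

lemma bilinear_on_tmul_inner: "v \<in> carr V \<Longrightarrow> w \<in> carr W \<Longrightarrow>
  bilinear_on V W (tensor V W) (\<lambda>v' w'. tens V W (m v v') (n w w'))"
  using bilinear_on_tmap[OF V W bilinear_onD(1)[OF m] bilinear_onD(1)[OF n]] by blast

lemma bilinear_on_tmul: "bilinear_on (tensor V W) (tensor V W) (tensor V W) (tmul V W m n)"
proof (rule bilinear_onI)
  have 1: "bilinear_on V W (tensor V W) (\<lambda>v w. tlift V W (\<lambda>v' w'. tens V W (m v v') (n w w')) t)"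
    if t: "t \<in> carr (tensor V W)" for t
    using bilinear_onD[OF m] bilinear_onD[OF n]
    by (intro bilinear_onI linear_on_tlift_param V W is_vsp_tensor bilinear_on_tmul_inner t
        bilinear_on_comp[OF bilinear_on_tens[OF V W]]) auto
  show "linear_on (tensor V W) (tensor V W) (\<lambda>s. tmul V W m n s t)" if t: "t \<in> carr (tensor V W)" for t
    unfolding tmul_def by (intro tlift_linear V W is_vsp_tensor 1 t)
  show "linear_on (tensor V W) (tensor V W) (tmul V W m n s)" if s: "s \<in> carr (tensor V W)" for s
    unfolding tmul_def
    by (intro linear_on_tlift_param V W is_vsp_tensor 1 s tlift_linear bilinear_on_tmul_inner)
qed

lemma tmul_tens:
  assumes "v \<in> carr V" "w \<in> carr W" "v' \<in> carr V" "w' \<in> carr W"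
  shows "tmul V W m n (tens V W v w) (tens V W v' w') = tens V W (m v v') (n w w')"
proof -
  have t: "tens V W v' w' \<in> carr (tensor V W)" by (intro tens_in assms)
  have 1: "bilinear_on V W (tensor V W) (\<lambda>v w. tlift V W (\<lambda>v' w'. tens V W (m v v') (n w w')) (tens V W v' w'))"
    using bilinear_onD[OF m] bilinear_onD[OF n]
    by (intro bilinear_onI linear_on_tlift_param V W is_vsp_tensor bilinear_on_tmul_inner t
        bilinear_on_comp[OF bilinear_on_tens[OF V W]]) auto
  show ?thesis unfolding tmul_def
    by (simp add: tlift_tens[OF V W is_vsp_tensor 1] assms tlift_tens[OF V W is_vsp_tensor bilinear_on_tmul_inner])
qed

end

end

text \<open>A finite spanning family \<open>b\<close> together with coordinate functionals \<open>c\<close>.\<close>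

definition frame ::
  "('k::field, 'a::ab_group_add, 'm) vsp_scheme \<Rightarrow> 'j set \<Rightarrow> ('j \<Rightarrow> 'a) \<Rightarrow> ('j \<Rightarrow> 'a \<Rightarrow> 'k) \<Rightarrow> bool" where
  "frame V J b c \<longleftrightarrow> is_vsp V \<and>
     (\<forall>j\<in>J. b j \<in> carr V \<and> linear_on V base_field (c j)) \<and>
     (\<forall>v\<in>carr V. (\<Sum>j\<in>J. smul V (c j v) (b j)) = v)"

lemma frameD:
  assumes "frame V J b c"
  shows "is_vsp V" "j \<in> J \<Longrightarrow> b j \<in> carr V" "j \<in> J \<Longrightarrow> linear_on V base_field (c j)"
    "v \<in> carr V \<Longrightarrow> (\<Sum>j\<in>J. smul V (c j v) (b j)) = v"
  using assms by (auto simp: frame_def)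

lemma frame_eqI:
  assumes "frame V J b c" "x \<in> carr V" "y \<in> carr V" "\<And>j. j \<in> J \<Longrightarrow> c j x = c j y"
  shows "x = y"
  using frameD(4)[OF assms(1,2)] frameD(4)[OF assms(1,3)] assms(4) by (metis (mono_tags, lifting) sum.cong)

lemma frame_linear:
  assumes F: "frame V J b c" and X: "is_vsp X" and "\<And>x. x \<in> carr X \<Longrightarrow> f x \<in> carr V"
    and lin: "\<And>j. j \<in> J \<Longrightarrow> linear_on X base_field (\<lambda>x. c j (f x))"
  shows "linear_on X V f"
proof -
  have "linear_on X V (\<lambda>x. \<Sum>j\<in>J. smul V (c j (f x)) (b j))"
    using frameD[OF F] by (intro linear_on_sum_fun linear_on_smul lin) auto
  then show ?thesis
    using frameD(4)[OF F] assms(3) is_vspD(2,3)[OF X] by (simp add: linear_on_def)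
qed

lemma bilinear_on_mult:
  "linear_on V base_field f \<Longrightarrow> linear_on W base_field g \<Longrightarrow> bilinear_on V W base_field (\<lambda>v w. f v * g w)"
  by (intro bilinear_onI linear_on_mult)

text \<open>With \<open>frame_eqI\<close> this reduces equations in \<open>D\<close> and its tensor
  powers to coordinates, which are products of coordinates of the factors.\<close>

lemma frame_tensor:
  assumes VF: "frame V J b c" and WF: "frame W L d c'"
  shows "frame (tensor V W) (J \<times> L) (\<lambda>(j, l). tens V W (b j) (d l))
    (\<lambda>(j, l). tlift V W (\<lambda>v w. c j v * c' l w))"
proof -
  note V = frameD[OF VF] and W = frameD[OF WF]
  have bil: "bilinear_on V W base_field (\<lambda>v w. c j v * c' l w)" if "j \<in> J" "l \<in> L" for j l
    using that V W by (intro bilinear_on_mult)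
  note lin = tlift_linear[OF V(1) W(1) is_vsp_base_field bil]
  have "(\<Sum>(j, l)\<in>J \<times> L. smul (tensor V W) (tlift V W (\<lambda>v w. c j v * c' l w) t) (tens V W (b j) (d l))) = t"
    if t: "t \<in> carr (tensor V W)" for t
  proof (rule tensor_eqI[OF V(1) W(1) is_vsp_tensor _ linear_on_id _ t])
    show "linear_on (tensor V W) (tensor V W)
      (\<lambda>t. \<Sum>(j, l)\<in>J \<times> L. smul (tensor V W) (tlift V W (\<lambda>v w. c j v * c' l w) t) (tens V W (b j) (d l)))"
      unfolding case_prod_unfold using V W
      by (intro linear_on_sum_fun linear_on_smul is_vsp_tensor lin tens_in) auto
    fix v w assume vw: "v \<in> carr V" "w \<in> carr W"
    note B = bilinear_on_tens[OF V(1) W(1)]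
    have "(\<Sum>(j, l)\<in>J \<times> L. smul (tensor V W) (tlift V W (\<lambda>v w. c j v * c' l w) (tens V W v w)) (tens V W (b j) (d l)))
      = (\<Sum>(j, l)\<in>J \<times> L. tens V W (smul V (c j v) (b j)) (smul W (c' l w) (d l)))"
      using V W vw
      by (intro sum.cong refl) (auto simp: tlift_tens[OF V(1) W(1) is_vsp_base_field bil] is_vspD(3)
        linear_onD(3)[OF bilinear_onD(1)[OF B]] linear_onD(3)[OF bilinear_onD(2)[OF B]]
        module.scale_scale[OF is_vspD(5)[OF is_vsp_tensor]] mult.commute)
    also have "\<dots> = (\<Sum>j\<in>J. \<Sum>l\<in>L. tens V W (smul V (c j v) (b j)) (smul W (c' l w) (d l)))"
      by (simp add: sum.cartesian_product)
    also have "\<dots> = (\<Sum>j\<in>J. tens V W (smul V (c j v) (b j)) w)"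
      using V W vw is_vspD(3)[OF V(1)] is_vspD(3)[OF W(1)]
      by (intro sum.cong refl) (simp flip: linear_on_sum[OF W(1) bilinear_onD(1)[OF B]])
    also have "\<dots> = tens V W v w"
      using V W vw is_vspD(3)[OF V(1)] 
      by (simp flip: linear_on_sum[OF V(1) bilinear_onD(2)[OF B]])
    finally show "(\<Sum>(j, l)\<in>J \<times> L. smul (tensor V W) (tlift V W (\<lambda>v w. c j v * c' l w) (tens V W v w)) (tens V W (b j) (d l)))
      = tens V W v w" .
  qed
  then show ?thesis
    using V W lin by (auto simp: frame_def is_vsp_tensor tens_in case_prod_unfold)
qed

text \<open>Tensor products take whole records as arguments. Different records with the same carrier
  and scalar multiplication occur, such as \<open>dual_vsp H\<close> and \<open>dual_hom H\<close>,
  and have to be exchanged.\<close>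

lemma tens_cong:
  "carr V = carr V' \<Longrightarrow> smul V = smul V' \<Longrightarrow> carr W = carr W' \<Longrightarrow> smul W = smul W' \<Longrightarrow> tens V W = tens V' W'"
  by (simp add: tens_def bilinear_on_def linear_on_def fun_eq_iff)

lemma tensor_cong:
  assumes "carr V = carr V'" "smul V = smul V'" "carr W = carr W'" "smul W = smul W'"
  shows "tensor V W = tensor V' W'"
  by (simp add: tensor_def tens_cong[OF assms] assms)

lemma tlift_cong:
  assumes "carr V = carr V'" "smul V = smul V'" "carr W = carr W'" "smul W = smul W'"
  shows "tlift V W = tlift V' W'"
  unfolding tlift_def[abs_def] tens_cong[OF assms] by (simp add: assms)

lemma linear_on_cong:
  "is_vsp V \<Longrightarrow> (\<And>x. x \<in> carr V \<Longrightarrow> f x = g x) \<Longrightarrow> linear_on V W f \<longleftrightarrow> linear_on V W g"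
  by (simp add: linear_on_def is_vspD)

section \<open>Untwisting a Hom-Hopf algebra\<close>

locale hom_hopf_basis = hom_hopf_algebra H S
  for H :: "('k::field, 'h::ab_group_add) hom_data" and S :: "'h \<Rightarrow> 'h" +
  fixes I :: "'i set" and e :: "'i \<Rightarrow> 'h" and e' :: "'i \<Rightarrow> 'h \<Rightarrow> 'k"
  assumes whole_type: "carr H = UNIV"
    and bij_twist: "bij (twist H)"
    and inj_e: "inj_on e I"
    and basis_e: "finite_dimensional_vector_space (smul H) (e ` I)"
    and e'_in: "\<And>i. i \<in> I \<Longrightarrow> e' i \<in> carr (dual_hom H)"
    and e'_e: "\<And>i j. i \<in> I \<Longrightarrow> j \<in> I \<Longrightarrow> e' i (e j) = (if i = j then 1 else 0)"
begin

abbreviation \<alpha> :: "'h \<Rightarrow> 'h" where "\<alpha> \<equiv> twist H"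
abbreviation \<beta> :: "'h \<Rightarrow> 'h" where "\<beta> \<equiv> inv (twist H)"
abbreviation u :: 'h where "u \<equiv> one H"
abbreviation \<epsilon> :: "'h \<Rightarrow> 'k" where "\<epsilon> \<equiv> counit H"

text \<open>The dual basis is constrained at indices in \<open>I\<close>, while
  \<open>linear_e'\<close> of \<open>fd_hopf\<close> concerns every index; zero is a linear default
  outside \<open>I\<close>.\<close>

definition c :: "'i \<Rightarrow> 'h \<Rightarrow> 'k" where "c i = (if i \<in> I then e' i else (\<lambda>_. 0))"

text \<open>
  The ordinary Hopf algebra of which \<open>H\<close> is the twist by \<open>\<alpha>\<close>: its product is \<open>m\<close>, its
  coproduct is \<open>h \<mapsto> (\<Sum>i\<in>I. e i \<otimes> \<delta> i h)\<close>.
\<close>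

definition m :: "'h \<Rightarrow> 'h \<Rightarrow> 'h" (infixl "\<odot>" 70) where "x \<odot> y = \<beta> (mul H x y)"
definition \<delta> :: "'i \<Rightarrow> 'h \<Rightarrow> 'h" where "\<delta> i h = tlift H H (\<lambda>a b. smul H (c i a) b) (comul H (\<beta> h))"

lemma \<alpha>_\<beta> [simp]: "\<alpha> (\<beta> x) = x" and \<beta>_\<alpha> [simp]: "\<beta> (\<alpha> x) = x"
  using bij_twist by (simp_all add: bij_is_surj surj_f_inv_f bij_is_inj)

lemma vsp_H: "is_vsp H"
  by (rule hom_algebra.vsp[OF hom_algebra_axioms])

lemma vector_space_H: "vector_space (smul H)"
  using vsp_H by (rule is_vspD)

lemma linear_on_iff:
  "linear_on H base_field f \<longleftrightarrow> Vector_Spaces.linear (smul H) (*) f"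
  "linear_on H H g \<longleftrightarrow> Vector_Spaces.linear (smul H) (smul H) g"
proof -
  have "vector_space ((*) :: 'k \<Rightarrow> 'k \<Rightarrow> 'k)"
    by unfold_locales (auto simp: algebra_simps)
  then show "linear_on H base_field f \<longleftrightarrow> Vector_Spaces.linear (smul H) (*) f"
    "linear_on H H g \<longleftrightarrow> Vector_Spaces.linear (smul H) (smul H) g"
    using vector_space_H by (simp_all add: linear_on_def Vector_Spaces.linear_iff whole_type base_field_def)
qed

lemma finite_I: "finite I"
  using finite_dimensional_vector_space.finite_Basis[OF basis_e] inj_e by (rule finite_imageD)

lemma linear_c: "linear_on H base_field (c i)"
  using e'_in[of i] by (auto simp: c_def dual_hom_def dual_vsp_def linear_on_def base_field_def)

lemma frame_H: "frame H I e c"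
proof -
  interpret finite_dimensional_vector_space "smul H" "e ` I" by (rule basis_e)
  have "(\<Sum>i\<in>I. smul H (c i x) (e i)) = x" for x
  proof -
    have "x \<in> span (e ` I)" using span_Basis by simp
    then show ?thesis
    proof (induction rule: span_induct_alt)
      case base
      show ?case using linear_on_zero[OF vsp_H linear_c] by simp
    next
      case (step k x y)
      then obtain j where j: "x = e j" "j \<in> I" by auto
      have "(\<Sum>i\<in>I. smul H (c i x) (e i)) = (\<Sum>i\<in>I. if i = j then e i else 0)"
        using j e'_e by (intro sum.cong refl) (auto simp: c_def)
      also have "\<dots> = x" using j finite_I by simp
      finally have "(\<Sum>i\<in>I. smul H (c i x) (e i)) = x" .
      with step(2) show ?case
        using linear_onD(2,3)[OF linear_c]
        by (simp add: whole_type base_field_def scale_left_distrib sum.distrib flip: scale_scale scale_sum_right)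
    qed
  qed
  then show ?thesis using vsp_H linear_c by (simp add: frame_def whole_type)
qed

text \<open>Expanding the first leg in the basis gives a representation whose second legs depend
  linearly on the tensor. The coproduct thereby becomes a fixed finite sum with linear maps
  \<open>\<delta> i\<close>, in place of a representation chosen anew for each element.\<close>

lemma sum_slices:
  assumes "t \<in> carr (tensor H H)"
  shows "(\<Sum>i\<in>I. tens H H (e i) (tlift H H (\<lambda>a b. smul H (c i a) b) t)) = t"
proof (rule tensor_eqI[OF vsp_H vsp_H is_vsp_tensor _ linear_on_id _ assms])
  note B = bilinear_on_tens[OF vsp_H vsp_H]
  have bil: "bilinear_on H H H (\<lambda>a b. smul H (c i a) b)" for i
    using linear_c by (intro bilinear_onI linear_on_smul linear_on_smul_const vsp_H linear_on_id)
  note lin = tlift_linear[OF vsp_H vsp_H vsp_H bil]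
  show "linear_on (tensor H H) (tensor H H) (\<lambda>t. \<Sum>i\<in>I. tens H H (e i) (tlift H H (\<lambda>a b. smul H (c i a) b) t))"
    by (intro linear_on_sum_fun is_vsp_tensor bilinear_on_comp(2)[OF B] lin) (simp add: whole_type)
  fix v w
  have "(\<Sum>i\<in>I. tens H H (e i) (tlift H H (\<lambda>a b. smul H (c i a) b) (tens H H v w))) =
     (\<Sum>i\<in>I. tens H H (smul H (c i v) (e i)) w)"
    using linear_onD(3)[OF bilinear_onD(1)[OF B]] linear_onD(3)[OF bilinear_onD(2)[OF B]]
    by (simp add: tlift_tens[OF vsp_H vsp_H vsp_H bil] whole_type)
  also have "\<dots> = tens H H v w"
    using frameD(4)[OF frame_H, of v]
    by (simp add: whole_type flip: linear_on_sum[OF vsp_H bilinear_onD(2)[OF B]])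
  finally show "(\<Sum>i\<in>I. tens H H (e i) (tlift H H (\<lambda>a b. smul H (c i a) b) (tens H H v w))) = tens H H v w" .
qed

text \<open>The \<alpha> compensates the \<beta> built into \<open>\<delta>\<close>: the given
  coproduct is the ordinary one after \<alpha>.\<close>

lemma comul_eq: "comul H h = (\<Sum>i\<in>I. tens H H (e i) (\<delta> i (\<alpha> h)))"
  using sum_slices[of "comul H h"] linear_onD(1)[OF comul_linear, of h] by (simp add: \<delta>_def whole_type)

lemma tlift_comul:
  assumes "is_vsp X" "bilinear_on H H X F"
  shows "tlift H H F (comul H h) = (\<Sum>i\<in>I. F (e i) (\<delta> i (\<alpha> h)))"
  unfolding comul_eq using assms
  by (simp add: linear_on_sum[OF is_vsp_tensor tlift_linear[OF vsp_H vsp_H assms]]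
      tens_in whole_type tlift_tens[OF vsp_H vsp_H assms])

lemma sweedler_eq:
  assumes "is_vsp X" "bilinear_on H H X F"
  shows "sweedler H F h = (\<Sum>i\<in>I. F (e i) (\<delta> i (\<alpha> h)))"
  unfolding sweedler_def by (rule tlift_comul[OF assms])

lemma linear_\<beta>: "linear_on H H \<beta>"
  using twist_linear[unfolded linear_on_def]
  by (auto simp: linear_on_def whole_type intro!: inv_f_eq bij_is_inj[OF bij_twist])

lemma linear_\<delta>: "linear_on H H (\<delta> i)"
proof -
  have 1: "bilinear_on H H H (\<lambda>a b. smul H (c i a) b)" for i
    using linear_c by (intro bilinear_onI linear_on_smul linear_on_smul_const vsp_H linear_on_id)
  show ?thesis unfolding \<delta>_def
    by (intro linear_on_comp[OF tlift_linear[OF vsp_H vsp_H vsp_H 1]] linear_on_comp[OF comul_linear] linear_\<beta>)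
qed

lemma mul_eq: "mul H x y = \<alpha> (x \<odot> y)"
  by (simp add: m_def)

lemma \<alpha>_m: "\<alpha> (x \<odot> y) = \<alpha> x \<odot> \<alpha> y"
  using twist_mul[of x y] by (simp add: m_def whole_type) (metis \<alpha>_\<beta> \<beta>_\<alpha> twist_mul UNIV_I whole_type)

lemma \<beta>_m: "\<beta> (x \<odot> y) = \<beta> x \<odot> \<beta> y"
  using \<alpha>_m[of "\<beta> x" "\<beta> y"] by (metis \<alpha>_\<beta> \<beta>_\<alpha>)

text \<open>Each of the two products and the twist of Hom-associativity contribute powers of
  \<alpha>; starting at \<beta>(\<beta> x), \<beta>(\<beta> y), \<beta>(\<beta> z) cancels
  them.\<close>

lemma m_assoc: "(x \<odot> y) \<odot> z = x \<odot> (y \<odot> z)"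
  using hom_assoc[of "\<beta> (\<beta> x)" "\<beta> (\<beta> y)" "\<beta> (\<beta> z)"] by (simp add: whole_type mul_eq \<alpha>_m)

lemma bilinear_on_m: "bilinear_on H H H (\<odot>)"
  unfolding m_def using mul_bilinear linear_\<beta> by (rule bilinear_on_compose)

lemma tlift_comul_\<alpha>:
  assumes "is_vsp X" "bilinear_on H H X G"
  shows "(\<Sum>i\<in>I. G (e i) (\<delta> i (\<alpha> h))) = (\<Sum>i\<in>I. G (\<alpha> (e i)) (\<alpha> (\<delta> i h)))"
proof -
  have G: "bilinear_on H H X (\<lambda>a b. G (\<alpha> a) (\<alpha> b))"
    using bilinear_on_comp[OF assms(2)] twist_linear by (intro bilinear_onI) (auto simp: whole_type)
  have "tlift H H G (comul H (\<alpha> (\<beta> h))) = tlift H H G (tmap H H H H \<alpha> \<alpha> (comul H (\<beta> h)))"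
    by (subst twist_comul) (simp_all add: whole_type)
  also have "\<dots> = tlift H H (\<lambda>a b. G (\<alpha> a) (\<alpha> b)) (comul H (\<beta> h))"
  proof (rule tensor_eqI[where F = "\<lambda>t. tlift H H G (tmap H H H H \<alpha> \<alpha> t)", OF vsp_H vsp_H assms(1)])
    show "linear_on (tensor H H) X (\<lambda>t. tlift H H G (tmap H H H H \<alpha> \<alpha> t))"
      by (intro linear_on_comp[OF tlift_linear[OF vsp_H vsp_H assms]] tmap_linear vsp_H twist_linear)
    show "linear_on (tensor H H) X (tlift H H (\<lambda>a b. G (\<alpha> a) (\<alpha> b)))"
      by (intro tlift_linear vsp_H assms G)
    show "comul H (\<beta> h) \<in> carr (tensor H H)"
      using linear_onD(1)[OF comul_linear] by (simp add: whole_type)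
  qed (simp_all add: tmap_tens vsp_H twist_linear whole_type tlift_tens[OF vsp_H vsp_H assms] tlift_tens[OF vsp_H vsp_H assms(1) G])
  finally show ?thesis by (simp add: tlift_comul[OF assms] tlift_comul[OF assms(1) G])
qed

lemma coassoc_\<delta>:
  assumes F: "\<And>b c. linear_on H base_field (\<lambda>a. F a b c)" "\<And>a c. linear_on H base_field (\<lambda>b. F a b c)"
    "\<And>a b. linear_on H base_field (F a b)"
  shows "(\<Sum>i\<in>I. \<Sum>j\<in>I. F (e j) (\<delta> j (e i)) (\<delta> i h)) = (\<Sum>i\<in>I. \<Sum>j\<in>I. F (e i) (e j) (\<delta> j (\<delta> i h)))"
proof -
  note K = is_vsp_base_field
  have F1: "bilinear_on H H base_field (F a)" for a
    using F by (intro bilinear_onI) auto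
  have F2: "bilinear_on H (tensor H H) base_field (\<lambda>a. tlift H H (F a))"
    by (intro bilinear_onI tlift_linear linear_on_tlift_param vsp_H K F1 F)
  define \<Phi> where "\<Phi> = tlift H (tensor H H) (\<lambda>a. tlift H H (F a))"
  have \<Phi>: "linear_on (tensor H (tensor H H)) base_field \<Phi>"
    unfolding \<Phi>_def by (intro tlift_linear vsp_H is_vsp_tensor K F2)
  have \<Phi>_tens: "\<Phi> (tens H (tensor H H) a (comul H b)) = (\<Sum>j\<in>I. F a (e j) (\<delta> j (\<alpha> b)))" for a b
    using linear_onD(1)[OF comul_linear]
    by (simp add: \<Phi>_def tlift_tens[OF vsp_H is_vsp_tensor K F2] whole_type tlift_comul[OF K F1])
  have \<Phi>_tens': "\<Phi> (tassoc H H H (tens (tensor H H) H (comul H a) b)) = (\<Sum>j\<in>I. F (e j) (\<delta> j (\<alpha> a)) b)" for a b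
  proof -
    have "linear_on (tensor H H) base_field (\<lambda>t. \<Phi> (tassoc H H H (tens (tensor H H) H t b)))"
      by (intro linear_on_comp[OF \<Phi>] linear_on_comp[OF tassoc_linear] vsp_H
          bilinear_onD(2)[OF bilinear_on_tens[OF is_vsp_tensor vsp_H]]) (simp add: whole_type)
    then have "\<Phi> (tassoc H H H (tens (tensor H H) H (comul H a) b)) =
      (\<Sum>j\<in>I. \<Phi> (tassoc H H H (tens (tensor H H) H (tens H H (e j) (\<delta> j (\<alpha> a))) b)))"
      unfolding comul_eq by (rule linear_on_sum[OF is_vsp_tensor]) (simp add: tens_in whole_type)
    then show ?thesis
      by (simp add: tassoc_tens vsp_H whole_type \<Phi>_def tlift_tens[OF vsp_H is_vsp_tensor K F2]
          tens_in tlift_tens[OF vsp_H vsp_H K F1])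
  qed
  have B1: "bilinear_on H H base_field (\<lambda>a b. \<Sum>j\<in>I. F a (e j) (\<delta> j b))"
    "bilinear_on H H base_field (\<lambda>a b. \<Sum>j\<in>I. F (e j) (\<delta> j a) b)"
    by (intro bilinear_onI linear_on_sum_fun K linear_on_comp[OF F(2)] linear_on_comp[OF F(3)] F linear_\<delta>)+
  \<comment> \<open>One \<beta> is consumed by the outer coproduct. The other cancels the \<alpha>
    that Hom-coassociativity puts on one leg and the inner coproduct on the other, once
    \<open>tlift_comul_\<alpha>\<close> has pulled both into the argument.\<close>
  let ?z = "\<beta> (\<beta> h)"
  have "\<Phi> (tassoc H H H (tmap H H (tensor H H) H (comul H) \<alpha> (comul H ?z))) =
    (\<Sum>i\<in>I. \<Sum>j\<in>I. F (e j) (\<delta> j (\<alpha> (e i))) (\<alpha> (\<delta> i (\<alpha> ?z))))"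
  proof -
    have "linear_on (tensor H H) base_field (\<lambda>t. \<Phi> (tassoc H H H (tmap H H (tensor H H) H (comul H) \<alpha> t)))"
      by (intro linear_on_comp[OF \<Phi>] linear_on_comp[OF tassoc_linear] vsp_H tmap_linear is_vsp_tensor comul_linear twist_linear)
    then have "\<Phi> (tassoc H H H (tmap H H (tensor H H) H (comul H) \<alpha> (\<Sum>i\<in>I. tens H H (e i) (\<delta> i (\<alpha> ?z))))) =
       (\<Sum>i\<in>I. \<Phi> (tassoc H H H (tmap H H (tensor H H) H (comul H) \<alpha> (tens H H (e i) (\<delta> i (\<alpha> ?z))))))"
      by (rule linear_on_sum[OF is_vsp_tensor]) (simp add: tens_in whole_type)
    then show ?thesis
      by (simp add: comul_eq[of ?z] tmap_tens vsp_H is_vsp_tensor comul_linear twist_linear whole_type \<Phi>_tens')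
  qed
  also have "\<dots> = (\<Sum>i\<in>I. \<Sum>j\<in>I. F (e j) (\<delta> j (e i)) (\<delta> i h))"
    using tlift_comul_\<alpha>[OF K B1(2), of "\<alpha> ?z"] by simp
  finally have 1: "\<Phi> (tassoc H H H (tmap H H (tensor H H) H (comul H) \<alpha> (comul H ?z))) =
    (\<Sum>i\<in>I. \<Sum>j\<in>I. F (e j) (\<delta> j (e i)) (\<delta> i h))" .
  have "\<Phi> (tmap H H H (tensor H H) \<alpha> (comul H) (comul H ?z)) =
    (\<Sum>i\<in>I. \<Sum>j\<in>I. F (\<alpha> (e i)) (e j) (\<delta> j (\<alpha> (\<delta> i (\<alpha> ?z)))))"
  proof -
    have "linear_on (tensor H H) base_field (\<lambda>t. \<Phi> (tmap H H H (tensor H H) \<alpha> (comul H) t))"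
      by (intro linear_on_comp[OF \<Phi>] vsp_H tmap_linear is_vsp_tensor comul_linear twist_linear)
    then have "\<Phi> (tmap H H H (tensor H H) \<alpha> (comul H) (\<Sum>i\<in>I. tens H H (e i) (\<delta> i (\<alpha> ?z)))) =
       (\<Sum>i\<in>I. \<Phi> (tmap H H H (tensor H H) \<alpha> (comul H) (tens H H (e i) (\<delta> i (\<alpha> ?z)))))"
      by (rule linear_on_sum[OF is_vsp_tensor]) (simp add: tens_in whole_type)
    then show ?thesis
      by (simp add: comul_eq[of ?z] tmap_tens vsp_H is_vsp_tensor comul_linear twist_linear whole_type \<Phi>_tens)
  qed
  also have "\<dots> = (\<Sum>i\<in>I. \<Sum>j\<in>I. F (e i) (e j) (\<delta> j (\<delta> i h)))"
    using tlift_comul_\<alpha>[OF K B1(1), of "\<alpha> ?z"] by simp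
  finally show ?thesis using 1 hom_coassoc[of ?z] by (simp add: whole_type)
qed

lemma comul_m_\<delta>:
  assumes G: "bilinear_on H H base_field G"
  shows "(\<Sum>i\<in>I. G (e i) (\<delta> i (x \<odot> y))) = (\<Sum>i\<in>I. \<Sum>j\<in>I. G (e i \<odot> e j) (\<delta> i x \<odot> \<delta> j y))"
proof -
  note K = is_vsp_base_field
  \<comment> \<open>The product of \<open>H\<close> leaves one \<alpha> on each tensor factor;
    \<open>G'\<close> cancels both.\<close>
  define G' where "G' = (\<lambda>a b. G (\<beta> a) (\<beta> b))"
  have G': "bilinear_on H H base_field G'" unfolding G'_def
    using bilinear_on_comp[OF G] linear_\<beta> by (intro bilinear_onI) (auto simp: whole_type)
  note B = bilinear_on_tmul[OF vsp_H vsp_H mul_bilinear mul_bilinear]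
  have "(\<Sum>i\<in>I. G (e i) (\<delta> i (x \<odot> y))) = (\<Sum>i\<in>I. G' (e i) (\<delta> i (\<alpha> (x \<odot> y))))"
    using tlift_comul_\<alpha>[OF K G', of "x \<odot> y"] by (simp add: G'_def)
  also have "\<dots> = tlift H H G' (comul H (mul H (\<beta> x) (\<beta> y)))"
    by (simp add: tlift_comul[OF K G'] mul_eq \<alpha>_m)
  also have "\<dots> = tlift H H G' (tmul H H (mul H) (mul H) (comul H (\<beta> x)) (comul H (\<beta> y)))"
    by (subst comul_mul) (simp_all add: whole_type)
  also have "\<dots> = (\<Sum>i\<in>I. \<Sum>j\<in>I. G' (mul H (e i) (e j)) (mul H (\<delta> i x) (\<delta> j y)))"
    unfolding comul_eq using bilinear_onD(3)[OF mul_bilinear]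
    by (simp add: linear_on_sum[OF is_vsp_tensor bilinear_onD(1)[OF B]] linear_on_sum[OF is_vsp_tensor bilinear_onD(2)[OF B]]
        carr_sum[OF is_vsp_tensor] tens_in whole_type tmul_tens[OF vsp_H vsp_H mul_bilinear mul_bilinear]
        linear_on_sum[OF is_vsp_tensor tlift_linear[OF vsp_H vsp_H K G']] tlift_tens[OF vsp_H vsp_H K G'])
      (rule sum.swap)
  finally show ?thesis by (simp add: G'_def mul_eq)
qed

lemma \<beta>_u: "\<beta> u = u"
  using twist_one \<beta>_\<alpha> by metis

lemma m_u: "x \<odot> u = x" and u_m: "u \<odot> x = x"
  by (simp_all add: m_def mul_one one_mul whole_type)

lemma \<beta>_antipode: "\<beta> (smul H k u) = smul H k u"
  using linear_onD(3)[OF linear_\<beta>] by (simp add: whole_type \<beta>_u)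

lemma bilinear_on_smul_counit:
  "bilinear_on H H H (\<lambda>a b. smul H (\<epsilon> a) b)" "bilinear_on H H H (\<lambda>a b. smul H (\<epsilon> b) a)"
  using counit_linear by (auto intro!: bilinear_onI linear_on_smul linear_on_smul_const vsp_H linear_on_id)

lemma bilinear_on_antipode:
  "bilinear_on H H H (\<lambda>a b. mul H (S a) b)" "bilinear_on H H H (\<lambda>a b. mul H a (S b))"
  using bilinear_on_comp[OF mul_bilinear] bilinear_onD[OF mul_bilinear] antipode_linear
  by (auto intro!: bilinear_onI simp: whole_type)

lemma bilinear_on_iff:
  "bilinear_on H H base_field G \<longleftrightarrow>
     (\<forall>b. Vector_Spaces.linear (smul H) (*) (\<lambda>a. G a b)) \<and> (\<forall>a. Vector_Spaces.linear (smul H) (*) (G a))"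
  by (auto simp: bilinear_on_def whole_type linear_on_iff)

lemma comul_u_\<delta>:
  assumes "bilinear_on H H base_field G"
  shows "(\<Sum>i\<in>I. G (e i) (\<delta> i u)) = G u u"
  using tlift_comul[OF is_vsp_base_field assms, of u] tlift_tens[OF vsp_H vsp_H is_vsp_base_field assms]
  by (simp add: comul_one twist_one whole_type)

lemma antipode_\<delta>:
  "(\<Sum>i\<in>I. S (e i) \<odot> \<delta> i h) = smul H (\<epsilon> h) u" "(\<Sum>i\<in>I. e i \<odot> S (\<delta> i h)) = smul H (\<epsilon> h) u"
proof -
  have mul: "(\<Sum>i\<in>I. mul H (S (e i)) (\<delta> i h)) = smul H (\<epsilon> h) u"
    "(\<Sum>i\<in>I. mul H (e i) (S (\<delta> i h))) = smul H (\<epsilon> h) u"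
    using antipode_left[of "\<beta> h"] antipode_right[of "\<beta> h"] counit_twist[of "\<beta> h"]
    by (simp_all add: sweedler_eq[OF vsp_H bilinear_on_antipode(1)] sweedler_eq[OF vsp_H bilinear_on_antipode(2)] whole_type)
  have "(\<Sum>i\<in>I. S (e i) \<odot> \<delta> i h) = \<beta> (\<Sum>i\<in>I. mul H (S (e i)) (\<delta> i h))"
    "(\<Sum>i\<in>I. e i \<odot> S (\<delta> i h)) = \<beta> (\<Sum>i\<in>I. mul H (e i) (S (\<delta> i h)))"
    by (simp_all add: linear_on_sum[OF vsp_H linear_\<beta>] whole_type m_def)
  then show "(\<Sum>i\<in>I. S (e i) \<odot> \<delta> i h) = smul H (\<epsilon> h) u" "(\<Sum>i\<in>I. e i \<odot> S (\<delta> i h)) = smul H (\<epsilon> h) u"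
    by (simp_all add: mul \<beta>_antipode)
qed

sublocale hopf: fd_hopf_aut "smul H" I e c m u \<delta> \<epsilon> S \<alpha> \<beta>
proof (rule fd_hopf_aut.intro[OF fd_hopf.intro fd_hopf_aut_axioms.intro])
  show "vector_space (smul H)" by (rule vector_space_H)
  show "finite I" by (rule finite_I)
  show "Vector_Spaces.linear (smul H) (*) (c i)" for i using linear_c by (simp add: linear_on_iff)
  show "(\<Sum>i\<in>I. smul H (c i x) (e i)) = x" for x using frameD(4)[OF frame_H] by (simp add: whole_type)
  show "Vector_Spaces.linear (smul H) (smul H) (\<lambda>x. x \<odot> y)" "Vector_Spaces.linear (smul H) (smul H) ((\<odot>) x)" for x y
    using bilinear_onD[OF bilinear_on_m] by (simp_all add: linear_on_iff whole_type)
  show "Vector_Spaces.linear (smul H) (smul H) (\<delta> i)" for i using linear_\<delta> by (simp add: linear_on_iff)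
  show "Vector_Spaces.linear (smul H) (*) \<epsilon>" using counit_linear by (simp add: linear_on_iff)
  show "Vector_Spaces.linear (smul H) (smul H) S" using antipode_linear by (simp add: linear_on_iff)
  show "Vector_Spaces.linear (smul H) (smul H) \<alpha>" using twist_linear by (simp add: linear_on_iff)
  show "(\<Sum>i\<in>I. smul H (\<epsilon> (e i)) (\<delta> i h)) = h" "(\<Sum>i\<in>I. smul H (\<epsilon> (\<delta> i h)) (e i)) = h" for h
    using counit_left[of "\<beta> h"] counit_right[of "\<beta> h"]
    by (simp_all add: sweedler_eq[OF vsp_H bilinear_on_smul_counit(1)] sweedler_eq[OF vsp_H bilinear_on_smul_counit(2)] whole_type)
  show "\<epsilon> (x \<odot> y) = \<epsilon> x * \<epsilon> y" for x y
    using counit_mul[of x y] counit_twist[of "x \<odot> y"] by (simp add: whole_type mul_eq)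
  show "\<epsilon> u = 1" by (rule counit_one)
qed (use coassoc_\<delta> comul_m_\<delta> comul_u_\<delta> tlift_comul_\<alpha>[OF is_vsp_base_field] m_assoc m_u u_m \<alpha>_m twist_one
    counit_twist antipode_twist antipode_\<delta> in \<open>auto simp: bilinear_on_iff linear_on_iff whole_type\<close>)

section \<open>Structure maps of the double\<close>

abbreviation Hd :: "('k, 'h \<Rightarrow> 'k) hom_data" where "Hd \<equiv> dual_hom H"
abbreviation D where "D \<equiv> drinfeld_double H S"

lemma carr_Hd: "carr Hd = {f. hopf.lf f}"
  by (simp add: dual_hom_def dual_vsp_def linear_on_iff)

lemma smul_Hd: "smul Hd = fun_smul"
  by (simp add: dual_hom_def dual_vsp_def)

lemma lf_\<beta>: "hopf.lf f \<Longrightarrow> hopf.lf (\<lambda>z. f (\<beta> z))" and lf_\<alpha>: "hopf.lf f \<Longrightarrow> hopf.lf (\<lambda>z. f (\<alpha> z))"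
  by (simp_all add: hopf.lf_o hopf.linear_\<alpha> hopf.linear_\<beta>)

lemma vsp_Hd: "is_vsp Hd"
proof -
  interpret F: module "fun_smul :: 'k \<Rightarrow> ('h \<Rightarrow> 'k) \<Rightarrow> _" by (rule module_fun_smul)
  have "F.subspace {f. hopf.lf f}"
    by (auto simp: F.subspace_def hopf.lf_iff fun_smul_def algebra_simps)
  then show ?thesis by (simp add: is_vsp_def carr_Hd smul_Hd vector_space_fun_smul)
qed

lemma linear_on_apply: "linear_on Hd base_field (\<lambda>f. f x)"
  by (simp add: linear_on_def base_field_def smul_Hd fun_smul_def)

lemma sum_fun_apply: "(\<Sum>i\<in>J. F i) x = (\<Sum>i\<in>J. (F i x :: 'b::comm_monoid_add))"
  by (induction J rule: infinite_finite_induct) simp_all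

lemma frame_Hd: "frame Hd I c (\<lambda>i f. f (e i))"
  unfolding frame_def
  using hopf.expand_lf(2) hopf.linear_e' linear_on_apply vsp_Hd
  by (auto simp: carr_Hd smul_Hd fun_eq_iff fun_smul_def sum_fun_apply mult.commute)

lemma carr_D: "carr D = carr (tensor H Hd)" and smul_D: "smul D = smul (tensor H Hd)"
  by (simp_all add: drinfeld_double_def)

lemma linear_on_D: "linear_on D X f \<longleftrightarrow> linear_on (tensor H Hd) X f" "linear_on Y D g \<longleftrightarrow> linear_on Y (tensor H Hd) g"
  by (simp_all add: linear_on_def carr_D smul_D)

lemma vsp_D: "is_vsp D"
  using is_vsp_tensor[of H Hd] by (simp add: is_vsp_def carr_D smul_D)

lemmas tlift_D_linear = tlift_linear[OF vsp_H vsp_Hd, folded linear_on_D]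

text \<open>
  With the second leg twisted by \<open>\<beta>\<close>, all structure maps of the double become the ones of the
  ordinary Drinfel'd double of the untwisted Hopf algebra, followed by the twist.
\<close>

definition E :: "'h \<Rightarrow> ('h \<Rightarrow> 'k) \<Rightarrow> ('h \<Rightarrow> ('h \<Rightarrow> 'k) \<Rightarrow> 'k) \<Rightarrow> 'k" where
  "E h f = tens H Hd h (\<lambda>z. f (\<beta> z))"

text \<open>The \<alpha> undoes the \<beta> hidden in \<open>E\<close>, so that pairing with
  \<open>E h f\<close> gives \<open>\<phi> h * f x\<close>.\<close>

definition ev :: "('h \<Rightarrow> 'k) \<Rightarrow> 'h \<Rightarrow> (('h \<Rightarrow> ('h \<Rightarrow> 'k) \<Rightarrow> 'k) \<Rightarrow> 'k) \<Rightarrow> 'k" where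
  "ev \<phi> x = tlift H Hd (\<lambda>h f. \<phi> h * f (\<alpha> x))"

lemma bilinear_on_ev: "hopf.lf \<phi> \<Longrightarrow> bilinear_on H Hd base_field (\<lambda>h f. \<phi> h * f x)"
  by (intro bilinear_on_mult linear_on_apply) (simp add: linear_on_iff)

lemma ev_linear: "hopf.lf \<phi> \<Longrightarrow> linear_on D base_field (ev \<phi> x)"
  unfolding ev_def by (intro tlift_D_linear is_vsp_base_field bilinear_on_ev)

lemma tens_in_D: "hopf.lf f \<Longrightarrow> tens H Hd h f \<in> carr D"
  by (simp add: carr_D tens_in whole_type carr_Hd)

lemma E_in: "hopf.lf f \<Longrightarrow> E h f \<in> carr D"
  unfolding E_def by (intro tens_in_D lf_\<beta>)

lemma tens_eq_E: "tens H Hd h f = E h (\<lambda>z. f (\<alpha> z))"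
  by (simp add: E_def)

lemma ev_tens: "hopf.lf \<phi> \<Longrightarrow> hopf.lf f \<Longrightarrow> ev \<phi> x (tens H Hd h f) = \<phi> h * f (\<alpha> x)"
  unfolding ev_def by (subst tlift_tens[OF vsp_H vsp_Hd is_vsp_base_field bilinear_on_ev])
    (simp_all add: whole_type carr_Hd)

lemma ev_E: "hopf.lf \<phi> \<Longrightarrow> hopf.lf f \<Longrightarrow> ev \<phi> x (E h f) = \<phi> h * f x"
  by (simp add: E_def ev_tens lf_\<beta>)

lemma frame_D: "frame D (I \<times> I) (\<lambda>(i, j). tens H Hd (e i) (c j)) (\<lambda>(i, j). ev (c i) (\<beta> (e j)))"
  using frame_tensor[OF frame_H frame_Hd] vsp_D
  by (simp add: frame_def carr_D smul_D linear_on_D ev_def)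

lemma D_eqI:
  assumes "s \<in> carr D" "t \<in> carr D" "\<And>\<phi> x. hopf.lf \<phi> \<Longrightarrow> ev \<phi> x s = ev \<phi> x t"
  shows "s = t"
  by (rule frame_eqI[OF frame_D assms(1,2)]) (auto simp: assms(3) hopf.linear_e')

lemma linear_on_D_I:
  assumes "is_vsp X" "\<And>v. v \<in> carr X \<Longrightarrow> f v \<in> carr D"
    "\<And>\<phi> x. hopf.lf \<phi> \<Longrightarrow> linear_on X base_field (\<lambda>v. ev \<phi> x (f v))"
  shows "linear_on X D f"
  by (rule frame_linear[OF frame_D assms(1,2)]) (auto intro: assms(3) hopf.linear_e')

lemma D_linear_eqI:
  assumes "is_vsp X" "linear_on D X F" "linear_on D X G" "\<And>h f. hopf.lf f \<Longrightarrow> F (E h f) = G (E h f)" "t \<in> carr D"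
  shows "F t = G t"
proof (rule tensor_eqI[where F = F and G = G, OF vsp_H vsp_Hd assms(1)])
  fix h f assume "f \<in> carr Hd"
  then show "F (tens H Hd h f) = G (tens H Hd h f)"
    unfolding tens_eq_E by (intro assms(4) lf_\<alpha>) (simp add: carr_Hd)
qed (use assms(2,3,5) in \<open>simp_all add: linear_on_D carr_D\<close>)

section \<open>The multiplication of the double in untwisted form\<close>

lemma sweedler_sw:
  assumes "is_vsp X" "bilinear_on H H X F"
  shows "sweedler H F h = hopf.sw F (\<alpha> h)"
  unfolding hopf.sw_def by (rule sweedler_eq[OF assms])

text \<open>One \<beta> is the shift carried by both factors, the other the twist of the dual: the
  exponent -2 in the product meets the \<alpha> of the coproduct, and -1 remains.\<close>

lemma dual_mul_eq:
  assumes f: "hopf.lf f" and g: "hopf.lf g"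
  shows "dual_mul H (\<lambda>z. f (\<beta> z)) (\<lambda>z. g (\<beta> z)) = (\<lambda>x. hopf.conv f g (\<beta> (\<beta> x)))"
proof
  fix x
  note [hopf.lin] = hopf.lf_o[OF f] hopf.lf_o[OF g]
  have "bilinear_on H H base_field (\<lambda>a b. f (\<beta> (\<beta> (\<beta> a))) * g (\<beta> (\<beta> (\<beta> b))))"
    by (simp add: bilinear_on_iff hopf.lin)
  then show "dual_mul H (\<lambda>z. f (\<beta> z)) (\<lambda>z. g (\<beta> z)) x = hopf.conv f g (\<beta> (\<beta> x))"
    by (simp add: dual_mul_def twist_neg_def numeral_2_eq_2 sweedler_sw[OF is_vsp_base_field]
       hopf.conv_def hopf.sw_\<beta> hopf.sw_\<alpha> hopf.lin)
qed

text \<open>The powers of \<beta> on \<open>k1\<close> and \<open>k3\<close> differ because in the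
  nested Hom-coproduct the inner legs carry one \<alpha> more than the outer leg;
  \<open>pmul_eq\<close> evens this out.\<close>

lemma double_mul_leg:
  assumes f: "hopf.lf f" and g: "hopf.lf g"
  shows "mul Hd (harpoon_right H (twist_neg H 3 k3) (harpoon_left H ((\<lambda>z. f (\<beta> z)) \<circ> \<alpha> \<circ> \<alpha>) (S (twist_neg H 3 k1))))
      (\<lambda>z. g (\<beta> z)) = (\<lambda>x. hopf.conv (hopf.act (\<beta> k1) (\<beta> (\<beta> k3)) f) g (\<beta> (\<beta> x)))"
proof -
  have "harpoon_right H (twist_neg H 3 k3) (harpoon_left H ((\<lambda>z. f (\<beta> z)) \<circ> \<alpha> \<circ> \<alpha>) (S (twist_neg H 3 k1))) =
     (\<lambda>z. hopf.act (\<beta> k1) (\<beta> (\<beta> k3)) f (\<beta> z))"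
    by (simp add: fun_eq_iff harpoon_right_def harpoon_left_def twist_neg_def numeral_2_eq_2 numeral_3_eq_3
      mul_eq hopf.act_def \<alpha>_m \<beta>_m hopf.S_\<beta>)
  then show ?thesis
    using dual_mul_eq[OF hopf.lf_act[OF f] g] by (simp add: dual_hom_def)
qed

lemma twist_neg_2: "twist_neg H 2 x = \<beta> (\<beta> x)"
  by (simp add: twist_neg_def numeral_2_eq_2)

definition pmul :: "'h \<Rightarrow> ('h \<Rightarrow> 'k) \<Rightarrow> 'h \<Rightarrow> ('h \<Rightarrow> 'k) \<Rightarrow> ('h \<Rightarrow> ('h \<Rightarrow> 'k) \<Rightarrow> 'k) \<Rightarrow> 'k" where
  "pmul h f k g = sweedler H (\<lambda>k1 k2. sweedler H (\<lambda>k21 k22. tens H Hd (mul H (twist_neg H 2 k21) h)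
           (mul Hd (harpoon_right H (twist_neg H 3 k22) (harpoon_left H (f \<circ> \<alpha> \<circ> \<alpha>) (S (twist_neg H 3 k1)))) g)) k2) k"

lemma sum_in_D: "(\<And>i. i \<in> J \<Longrightarrow> g i \<in> carr D) \<Longrightarrow> (\<Sum>i\<in>J. g i) \<in> carr D"
  by (rule carr_sum[OF vsp_D])

lemma sw_in_D: "(\<And>a b. F a b \<in> carr D) \<Longrightarrow> hopf.sw F h \<in> carr D"
  unfolding hopf.sw_def by (rule sum_in_D)

lemma ev_sum: "hopf.lf \<phi> \<Longrightarrow> (\<And>i. i \<in> J \<Longrightarrow> g i \<in> carr D) \<Longrightarrow> ev \<phi> x (\<Sum>i\<in>J. g i) = (\<Sum>i\<in>J. ev \<phi> x (g i))"
  by (rule linear_on_sum[OF vsp_D ev_linear])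

lemma ev_sw: "hopf.lf \<phi> \<Longrightarrow> (\<And>a b. F a b \<in> carr D) \<Longrightarrow> ev \<phi> x (hopf.sw F h) = hopf.sw (\<lambda>a b. ev \<phi> x (F a b)) h"
  unfolding hopf.sw_def by (rule ev_sum)

lemma dmul_in_D: "hopf.lf f \<Longrightarrow> hopf.lf g \<Longrightarrow> (\<And>h f. hopf.lf f \<Longrightarrow> \<Psi> h f \<in> carr D) \<Longrightarrow> hopf.dmul \<Psi> h f k g \<in> carr D"
  unfolding hopf.dmul_def by (intro sw_in_D) (simp add: hopf.lin)

text \<open>Once all twists are pulled out of the nested coproduct, the legs receive \<alpha>,
  \<alpha>\<alpha>, \<alpha>\<alpha>, exactly what the powers of \<beta> in \<open>P\<close> cancel.
  What remains is the ordinary product followed by the twist.\<close>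

lemma pmul_eq:
  assumes f: "hopf.lf f" and g: "hopf.lf g"
  shows "pmul h (\<lambda>z. f (\<beta> z)) k (\<lambda>z. g (\<beta> z)) = hopf.dmul (\<lambda>h f. E (\<alpha> h) (\<lambda>z. f (\<beta> z))) h f k g"
proof -
  note [hopf.lin] = f g hopf.lf_o[OF f] hopf.lf_o[OF g]
  define P where "P k1 k2 k3 = E (\<alpha> (\<beta> (\<beta> k2) \<odot> h)) (\<lambda>z. hopf.conv (hopf.act (\<beta> k1) (\<beta> (\<beta> k3)) f) g (\<beta> z))" for k1 k2 k3
  have lf: "hopf.lf (\<lambda>z. hopf.conv (hopf.act (\<beta> k1) (\<beta> (\<beta> k3)) f) g (\<beta> z))" for k1 k3
    by (intro lf_\<beta> hopf.lin)
  have P_in: "P k1 k2 k3 \<in> carr D" for k1 k2 k3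
    unfolding P_def by (intro E_in lf)
  have ev_P: "ev \<phi> x (P k1 k2 k3) =
    \<phi> (\<alpha> (\<beta> (\<beta> k2) \<odot> h)) * hopf.sw (\<lambda>a b. f (S (\<beta> k1) \<odot> (a \<odot> \<beta> (\<beta> k3))) * g b) (\<beta> x)" if "hopf.lf \<phi>" for \<phi> x k1 k2 k3
    unfolding P_def by (subst ev_E[OF that lf]) (simp add: hopf.conv_def hopf.act_def)
  \<comment> \<open>\<open>sweedler\<close> evaluates to a finite sum only for bilinear arguments.
    Bilinearity into \<open>D\<close> is tested by pairings, where \<open>ev_P\<close> is
    explicit.\<close>
  have P1: "bilinear_on H H D (\<lambda>k2 k3. P k1 k2 k3)" for k1
  proof (intro bilinear_onI linear_on_D_I vsp_H P_in)
    fix \<phi> x k2 k3 assume \<phi>: "hopf.lf \<phi>"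
    note [hopf.lin] = \<phi> hopf.lf_o[OF \<phi>]
    show "linear_on H base_field (\<lambda>k3. ev \<phi> x (P k1 k2 k3))" "linear_on H base_field (\<lambda>k2. ev \<phi> x (P k1 k2 k3))"
      by (simp_all add: ev_P[OF \<phi>] linear_on_iff hopf.lin)
  qed
  have P2: "bilinear_on H H D (\<lambda>k1 k2. hopf.sw (P k1) (\<alpha> k2))"
  proof (intro bilinear_onI linear_on_D_I vsp_H sw_in_D P_in)
    fix \<phi> x k2 k1 assume \<phi>: "hopf.lf \<phi>"
    note [hopf.lin] = \<phi> hopf.lf_o[OF \<phi>]
    show "linear_on H base_field (\<lambda>k2. ev \<phi> x (hopf.sw (P k1) (\<alpha> k2)))"
      "linear_on H base_field (\<lambda>k1. ev \<phi> x (hopf.sw (P k1) (\<alpha> k2)))"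
      by (simp_all add: ev_sw[OF \<phi>] P_in ev_P[OF \<phi>] linear_on_iff hopf.lin)
  qed
  have "pmul h (\<lambda>z. f (\<beta> z)) k (\<lambda>z. g (\<beta> z)) = sweedler H (\<lambda>k1 k2. sweedler H (P k1) k2) k"
    by (simp add: pmul_def double_mul_leg f g P_def[abs_def] E_def twist_neg_2 mul_eq)
  also have "\<dots> = hopf.sw (\<lambda>k1 k2. hopf.sw (P k1) (\<alpha> k2)) (\<alpha> k)"
    using P1 P2 by (simp add: sweedler_sw[OF vsp_D])
  also have "\<dots> = hopf.dmul (\<lambda>h f. E (\<alpha> h) (\<lambda>z. f (\<beta> z))) h f k g"
  proof (rule D_eqI)
    show "hopf.sw (\<lambda>k1 k2. hopf.sw (P k1) (\<alpha> k2)) (\<alpha> k) \<in> carr D"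
      by (intro sw_in_D P_in)
    show "hopf.dmul (\<lambda>h f. E (\<alpha> h) (\<lambda>z. f (\<beta> z))) h f k g \<in> carr D"
      by (intro dmul_in_D f g E_in lf_\<beta>)
    fix \<phi> x assume \<phi>: "hopf.lf \<phi>"
    note [hopf.lin] = \<phi> hopf.lf_o[OF \<phi>]
    have "ev \<phi> x (E (\<alpha> (k2 \<odot> h)) (\<lambda>z. hopf.conv (hopf.act k1 k3 f) g (\<beta> z))) =
      \<phi> (\<alpha> (k2 \<odot> h)) * hopf.sw (\<lambda>a b. f (S k1 \<odot> (a \<odot> k3)) * g b) (\<beta> x)" for k1 k2 k3
      by (subst ev_E) (simp_all add: \<phi> lf_\<beta> hopf.lin, simp add: hopf.conv_def hopf.act_def)
    moreover have "E h (\<lambda>z. hopf.conv (hopf.act k1 k3 f) g (\<beta> z)) \<in> carr D" for h k1 k3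
      by (intro E_in lf_\<beta> hopf.lin)
    ultimately show "ev \<phi> x (hopf.sw (\<lambda>k1 k2. hopf.sw (P k1) (\<alpha> k2)) (\<alpha> k)) =
       ev \<phi> x (hopf.dmul (\<lambda>h f. E (\<alpha> h) (\<lambda>z. f (\<beta> z))) h f k g)"
      unfolding hopf.dmul_def
      by (simp add: ev_sw[OF \<phi>] sw_in_D P_in ev_P[OF \<phi>] hopf.sw_\<alpha> hopf.lin)
  qed
  finally show ?thesis .
qed

lemma linear_on_sw:
  "is_vsp X \<Longrightarrow> (\<And>a b. linear_on Y X (\<lambda>y. F y a b)) \<Longrightarrow> linear_on Y X (\<lambda>y. hopf.sw (F y) h)"
  unfolding hopf.sw_def by (rule linear_on_sum_fun)

lemma pmul_tens:
  assumes "hopf.lf f" "hopf.lf g"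
  shows "pmul h f k g = hopf.dmul (\<lambda>h f. E (\<alpha> h) (\<lambda>z. f (\<beta> z))) h (\<lambda>z. f (\<alpha> z)) k (\<lambda>z. g (\<alpha> z))"
  using pmul_eq[OF lf_\<alpha>[OF assms(1)] lf_\<alpha>[OF assms(2)]] by simp

lemma pmul_in: "hopf.lf f \<Longrightarrow> hopf.lf g \<Longrightarrow> pmul h f k g \<in> carr D"
  by (simp add: pmul_tens dmul_in_D lf_\<alpha> lf_\<beta> E_in)

lemma ev_dmul:
  assumes "hopf.lf \<phi>" "hopf.lf f" "hopf.lf g" "\<And>h f. hopf.lf f \<Longrightarrow> \<Psi> h f \<in> carr D"
  shows "ev \<phi> x (hopf.dmul \<Psi> h f k g) = hopf.dmul (\<lambda>h f. ev \<phi> x (\<Psi> h f)) h f k g"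
  unfolding hopf.dmul_def using assms by (simp add: ev_sw sw_in_D hopf.lin)

lemma ev_pmul:
  assumes "hopf.lf \<phi>" "hopf.lf f" "hopf.lf g"
  shows "ev \<phi> x (pmul h f k g) = hopf.dm (\<lambda>h. \<phi> (\<alpha> h)) (\<beta> x) h (\<lambda>z. f (\<alpha> z)) k (\<lambda>z. g (\<alpha> z))"
  using assms by (simp add: pmul_tens ev_dmul lf_\<alpha> lf_\<beta> E_in ev_E cong: hopf.dmul_cong)

text \<open>The multiplication of \<open>D\<close> is a lift inside a lift, which has the expected
  values only for multilinear arguments; this separate linearity in all four variables secures both
  lifts.\<close>

lemma pmul_linear:
  assumes "hopf.lf f" "hopf.lf g"
  shows "linear_on H D (\<lambda>h. pmul h f k g)" "linear_on H D (\<lambda>k. pmul h f k g)"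
    "linear_on Hd D (\<lambda>f. pmul h f k g)" "linear_on Hd D (\<lambda>g. pmul h f k g)"
proof -
  note [hopf.lin] = hopf.lf_o[OF assms(1)] hopf.lf_o[OF assms(2)]
  show "linear_on H D (\<lambda>h. pmul h f k g)" "linear_on H D (\<lambda>k. pmul h f k g)"
  proof (rule_tac [!] linear_on_D_I[OF vsp_H])
    fix \<phi> x assume \<phi>: "hopf.lf \<phi>"
    note [hopf.lin] = hopf.lf_o[OF \<phi>]
    show "linear_on H base_field (\<lambda>h. ev \<phi> x (pmul h f k g))" "linear_on H base_field (\<lambda>k. ev \<phi> x (pmul h f k g))"
      using \<phi> assms by (simp_all add: ev_pmul linear_on_iff hopf.dmul_def hopf.conv_def hopf.act_def hopf.lin)
  qed (simp_all add: pmul_in assms)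
  have cong: "linear_on Hd base_field F \<longleftrightarrow> linear_on Hd base_field G" if "\<And>f. hopf.lf f \<Longrightarrow> F f = G f" for F G
    using that is_vspD(2,3)[OF vsp_Hd] by (simp add: linear_on_def carr_Hd)
  show "linear_on Hd D (\<lambda>f. pmul h f k g)" "linear_on Hd D (\<lambda>g. pmul h f k g)"
  proof (rule_tac [!] linear_on_D_I[OF vsp_Hd])
    fix \<phi> x assume \<phi>: "hopf.lf \<phi>"
    show "linear_on Hd base_field (\<lambda>f. ev \<phi> x (pmul h f k g))"
      by (subst cong[OF ev_pmul[OF \<phi> _ assms(2)]], assumption)
        (auto simp: hopf.dmul_def hopf.conv_def hopf.act_def intro!: linear_on_sw is_vsp_base_field linear_on_mult linear_on_apply)
    show "linear_on Hd base_field (\<lambda>g. ev \<phi> x (pmul h f k g))"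
      by (subst cong[OF ev_pmul[OF \<phi> assms(1)]], assumption)
        (auto simp: hopf.dmul_def hopf.conv_def hopf.act_def intro!: linear_on_sw is_vsp_base_field linear_on_mult linear_on_apply)
  qed (simp_all add: pmul_in assms carr_Hd)
qed

lemma mul_D: "mul D x y = tlift H Hd (\<lambda>h f. tlift H Hd (\<lambda>k g. pmul h f k g) y) x"
  by (simp add: drinfeld_double_def double_mul_def pmul_def)

lemma bilinear_on_pmul: "hopf.lf f \<Longrightarrow> bilinear_on H Hd D (\<lambda>k g. pmul h f k g)"
  by (intro bilinear_onI pmul_linear) (simp_all add: carr_Hd hopf.linear_\<epsilon>)

lemma bilinear_on_pmul2: "y \<in> carr D \<Longrightarrow> bilinear_on H Hd D (\<lambda>h f. tlift H Hd (\<lambda>k g. pmul h f k g) y)"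
  by (intro bilinear_onI linear_on_tlift_param vsp_H vsp_Hd vsp_D bilinear_on_pmul pmul_linear)
    (simp_all add: carr_Hd carr_D)

lemma bilinear_on_mul_D: "bilinear_on D D D (mul D)"
proof (rule bilinear_onI)
  show "linear_on D D (\<lambda>x. mul D x y)" if "y \<in> carr D" for y
    unfolding mul_D by (intro tlift_D_linear vsp_D bilinear_on_pmul2 that)
  fix x assume x: "x \<in> carr D"
  show "linear_on D D (mul D x)"
    unfolding mul_D[abs_def]
  proof (rule linear_on_tlift_param[OF vsp_H vsp_Hd vsp_D vsp_D])
    show "linear_on D D (\<lambda>y. tlift H Hd (\<lambda>k g. pmul h f k g) y)" if "f \<in> carr Hd" for h f
      using that by (intro tlift_D_linear vsp_D bilinear_on_pmul) (simp add: carr_Hd)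
  qed (use x in \<open>auto simp: carr_D intro: bilinear_on_pmul2[unfolded carr_D]\<close>)
qed

lemma mul_E:
  assumes "hopf.lf f" "hopf.lf g"
  shows "mul D (E h f) (E k g) = hopf.dmul (\<lambda>h f. E (\<alpha> h) (\<lambda>z. f (\<beta> z))) h f k g"
  using tlift_tens[OF vsp_H vsp_Hd vsp_D bilinear_on_pmul2[OF E_in[of g k]]]
    tlift_tens[OF vsp_H vsp_Hd vsp_D bilinear_on_pmul] assms
  by (simp add: mul_D E_def whole_type carr_Hd lf_\<beta> pmul_tens)

lemma tens_D: "tens (tensor H Hd) (tensor H Hd) = tens D D"
  by (rule tens_cong) (simp_all add: carr_D smul_D)

section \<open>The comultiplication of the double\<close>

lemma dual_pairing_unique:
  assumes "s \<in> carr (tensor Hd Hd)" "t \<in> carr (tensor Hd Hd)"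
    "\<And>x y. tlift Hd Hd (\<lambda>f1 f2. f1 x * f2 y) s = tlift Hd Hd (\<lambda>f1 f2. f1 x * f2 y) t"
  shows "s = t"
  by (rule frame_eqI[OF frame_tensor[OF frame_Hd frame_Hd] assms(1,2)]) (auto intro: assms(3))

text \<open>The defining value \<open>f (\<beta> (\<beta> (mul H x y)))\<close> is
  \<open>f (\<beta> (x \<odot> y))\<close>; expanding \<open>x\<close> in the basis suggests this
  tensor, and evaluations at pairs of basis vectors show that it is the only one.\<close>

lemma dual_comul_eq:
  assumes f: "hopf.lf f"
  shows "comul Hd f = (\<Sum>i\<in>I. tens Hd Hd (c i) (\<lambda>y. f (\<beta> (e i \<odot> y))))" (is "_ = ?t")
proof -
  note [hopf.lin] = hopf.lf_o[OF f]
  note K = is_vsp_base_field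
  have bil: "bilinear_on Hd Hd base_field (\<lambda>f1 f2. f1 x * f2 y)" for x y
    by (intro bilinear_on_mult linear_on_apply)
  have in_Hd: "c i \<in> carr Hd" "(\<lambda>y. f (\<beta> (e i \<odot> y))) \<in> carr Hd" for i
    using hopf.linear_e' by (simp_all add: carr_Hd hopf.lin)
  have t_in: "?t \<in> carr (tensor Hd Hd)"
    by (intro carr_sum is_vsp_tensor tens_in in_Hd)
  have t_eq: "tlift Hd Hd (\<lambda>f1 f2. f1 x * f2 y) ?t = f (\<beta> (x \<odot> y))" for x y
    using hopf.expand_lf(1)[of "\<lambda>z. f (\<beta> (z \<odot> y))" x]
    by (simp add: linear_on_sum[OF is_vsp_tensor tlift_linear[OF vsp_Hd vsp_Hd K bil]] tens_in in_Hd
        tlift_tens[OF vsp_Hd vsp_Hd K bil] hopf.lin)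
  have dual: "tensor (dual_vsp H) (dual_vsp H) = tensor Hd Hd" "tlift (dual_vsp H) (dual_vsp H) = tlift Hd Hd"
    by (intro tensor_cong tlift_cong; simp add: dual_hom_def)+
  have "dual_comul H f = ?t"
    unfolding dual_comul_def
  proof (rule the_equality)
    show "?t \<in> carr (tensor (dual_vsp H) (dual_vsp H)) \<and> (\<forall>h\<in>carr H. \<forall>k\<in>carr H.
      tlift (dual_vsp H) (dual_vsp H) (\<lambda>f1 f2. f1 h * f2 k) ?t = f (twist_neg H 2 (mul H h k)))"
      using t_in t_eq by (simp add: dual twist_neg_2 mul_eq \<beta>_m)
    fix s assume "s \<in> carr (tensor (dual_vsp H) (dual_vsp H)) \<and> (\<forall>h\<in>carr H. \<forall>k\<in>carr H.
      tlift (dual_vsp H) (dual_vsp H) (\<lambda>f1 f2. f1 h * f2 k) s = f (twist_neg H 2 (mul H h k)))"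
    then show "s = ?t"
      using t_in t_eq by (intro dual_pairing_unique) (simp_all add: dual twist_neg_2 mul_eq \<beta>_m whole_type)
  qed
  then show ?thesis by (simp add: dual_hom_def)
qed

lemma sweedler_Hd:
  assumes "is_vsp X" "bilinear_on Hd Hd X F" "hopf.lf f"
  shows "sweedler Hd F f = (\<Sum>i\<in>I. F (c i) (\<lambda>y. f (\<beta> (e i \<odot> y))))"
proof -
  note [hopf.lin] = hopf.lf_o[OF assms(3)]
  have in_Hd: "c i \<in> carr Hd" "(\<lambda>y. f (\<beta> (e i \<odot> y))) \<in> carr Hd" for i
    using hopf.linear_e' by (simp_all add: carr_Hd hopf.lin)
  show ?thesis
    by (simp add: sweedler_def dual_comul_eq assms(3) linear_on_sum[OF is_vsp_tensor tlift_linear[OF vsp_Hd vsp_Hd assms(1,2)]]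
        tens_in in_Hd tlift_tens[OF vsp_Hd vsp_Hd assms(1,2)])
qed

definition ev2 :: "('h \<Rightarrow> 'k) \<Rightarrow> 'h \<Rightarrow> ('h \<Rightarrow> 'k) \<Rightarrow> 'h \<Rightarrow> _ \<Rightarrow> 'k" where
  "ev2 \<phi> x \<psi> y = tlift D D (\<lambda>s t. ev \<phi> x s * ev \<psi> y t)"

definition ev3 :: "('h \<Rightarrow> 'k) \<Rightarrow> 'h \<Rightarrow> ('h \<Rightarrow> 'k) \<Rightarrow> 'h \<Rightarrow> ('h \<Rightarrow> 'k) \<Rightarrow> 'h \<Rightarrow> _ \<Rightarrow> 'k" where
  "ev3 \<phi> x \<psi> y \<chi> z = tlift D (tensor D D) (\<lambda>s t. ev \<phi> x s * ev2 \<psi> y \<chi> z t)"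

lemma ev2_linear: "hopf.lf \<phi> \<Longrightarrow> hopf.lf \<psi> \<Longrightarrow> linear_on (tensor D D) base_field (ev2 \<phi> x \<psi> y)"
  unfolding ev2_def by (intro tlift_linear vsp_D is_vsp_base_field bilinear_on_mult ev_linear)

lemma ev2_tens: "hopf.lf \<phi> \<Longrightarrow> hopf.lf \<psi> \<Longrightarrow> s \<in> carr D \<Longrightarrow> t \<in> carr D \<Longrightarrow>
    ev2 \<phi> x \<psi> y (tens D D s t) = ev \<phi> x s * ev \<psi> y t"
  unfolding ev2_def by (subst tlift_tens[OF vsp_D vsp_D is_vsp_base_field])
    (simp_all add: bilinear_on_mult ev_linear)

lemma ev3_linear: "hopf.lf \<phi> \<Longrightarrow> hopf.lf \<psi> \<Longrightarrow> hopf.lf \<chi> \<Longrightarrow>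
    linear_on (tensor D (tensor D D)) base_field (ev3 \<phi> x \<psi> y \<chi> z)"
  unfolding ev3_def by (intro tlift_linear vsp_D is_vsp_tensor is_vsp_base_field bilinear_on_mult ev_linear ev2_linear)

lemma ev3_tens: "hopf.lf \<phi> \<Longrightarrow> hopf.lf \<psi> \<Longrightarrow> hopf.lf \<chi> \<Longrightarrow> s \<in> carr D \<Longrightarrow> t \<in> carr (tensor D D) \<Longrightarrow>
    ev3 \<phi> x \<psi> y \<chi> z (tens D (tensor D D) s t) = ev \<phi> x s * ev2 \<psi> y \<chi> z t"
  unfolding ev3_def by (subst tlift_tens[OF vsp_D is_vsp_tensor is_vsp_base_field])
    (simp_all add: bilinear_on_mult ev_linear ev2_linear)

lemma DD_eqI:
  assumes "s \<in> carr (tensor D D)" "t \<in> carr (tensor D D)"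
    "\<And>\<phi> x \<psi> y. hopf.lf \<phi> \<Longrightarrow> hopf.lf \<psi> \<Longrightarrow> ev2 \<phi> x \<psi> y s = ev2 \<phi> x \<psi> y t"
  shows "s = t"
  by (rule frame_eqI[OF frame_tensor[OF frame_D frame_D] assms(1,2)])
    (auto simp: assms(3)[unfolded ev2_def] hopf.linear_e')

lemma DDD_eqI:
  assumes "s \<in> carr (tensor D (tensor D D))" "t \<in> carr (tensor D (tensor D D))"
    "\<And>\<phi> x \<psi> y \<chi> z. hopf.lf \<phi> \<Longrightarrow> hopf.lf \<psi> \<Longrightarrow> hopf.lf \<chi> \<Longrightarrow> ev3 \<phi> x \<psi> y \<chi> z s = ev3 \<phi> x \<psi> y \<chi> z t"
  shows "s = t"
  by (rule frame_eqI[OF frame_tensor[OF frame_D frame_tensor[OF frame_D frame_D]] assms(1,2)])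
    (auto simp: assms(3)[unfolded ev3_def ev2_def] hopf.linear_e')

lemma ev2_sum: "hopf.lf \<phi> \<Longrightarrow> hopf.lf \<psi> \<Longrightarrow> (\<And>i. i \<in> J \<Longrightarrow> g i \<in> carr (tensor D D)) \<Longrightarrow>
    ev2 \<phi> x \<psi> y (\<Sum>i\<in>J. g i) = (\<Sum>i\<in>J. ev2 \<phi> x \<psi> y (g i))"
  by (rule linear_on_sum[OF is_vsp_tensor ev2_linear])

lemma ev3_sum: "hopf.lf \<phi> \<Longrightarrow> hopf.lf \<psi> \<Longrightarrow> hopf.lf \<chi> \<Longrightarrow> (\<And>i. i \<in> J \<Longrightarrow> g i \<in> carr (tensor D (tensor D D))) \<Longrightarrow>
    ev3 \<phi> x \<psi> y \<chi> z (\<Sum>i\<in>J. g i) = (\<Sum>i\<in>J. ev3 \<phi> x \<psi> y \<chi> z (g i))"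
  by (rule linear_on_sum[OF is_vsp_tensor ev3_linear])

definition pcomul :: "'h \<Rightarrow> ('h \<Rightarrow> 'k) \<Rightarrow> _" where
  "pcomul h f = sweedler H (\<lambda>h1 h2. sweedler Hd (\<lambda>f1 f2.
     tens D D (tens H Hd h1 f1) (tens H Hd h2 f2)) f) h"

lemma comul_D: "comul D = tlift H Hd pcomul"
proof -
  have "comul D = double_comul H" by (simp add: drinfeld_double_def)
  also have "\<dots> = tlift H Hd pcomul"
    unfolding double_comul_def Let_def pcomul_def[abs_def] tens_D ..
  finally show ?thesis .
qed

lemma linear_on_tens_HHd:
  "f \<in> carr Hd \<Longrightarrow> linear_on H D (\<lambda>h. tens H Hd h f)" "linear_on Hd D (tens H Hd h)"
  using bilinear_onD[OF bilinear_on_tens[OF vsp_H vsp_Hd]] by (simp_all add: linear_on_D whole_type)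

lemma pcomul_eq:
  assumes f: "hopf.lf f"
  shows "pcomul h f = (\<Sum>i\<in>I. \<Sum>j\<in>I. tens D D (tens H Hd (e i) (c j)) (tens H Hd (\<delta> i (\<alpha> h)) (\<lambda>y. f (\<beta> (e j \<odot> y)))))"
proof -
  note [hopf.lin] = hopf.lf_o[OF f]
  have in_Hd: "c i \<in> carr Hd" "(\<lambda>y. f (\<beta> (e i \<odot> y))) \<in> carr Hd" for i
    using hopf.linear_e' by (simp_all add: carr_Hd hopf.lin)
  note B = bilinear_on_comp[OF bilinear_on_tens[OF vsp_D vsp_D]]
  have B1: "bilinear_on Hd Hd (tensor D D) (\<lambda>f1 f2. tens D D (tens H Hd h1 f1) (tens H Hd h2 f2))" for h1 h2
    by (intro bilinear_onI B linear_on_tens_HHd tens_in_D) (simp_all add: carr_Hd)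
  have B2: "bilinear_on H H (tensor D D)
    (\<lambda>h1 h2. \<Sum>j\<in>I. tens D D (tens H Hd h1 (c j)) (tens H Hd h2 (\<lambda>y. f (\<beta> (e j \<odot> y)))))"
    using in_Hd by (intro bilinear_onI linear_on_sum_fun is_vsp_tensor B linear_on_tens_HHd tens_in_D) (simp_all add: carr_Hd)
  show ?thesis
    unfolding pcomul_def sweedler_Hd[OF is_vsp_tensor B1 f] by (rule sweedler_eq[OF is_vsp_tensor B2])
qed

lemma bilinear_on_pcomul: "bilinear_on H Hd (tensor D D) pcomul"
proof (rule bilinear_onI)
  note B = bilinear_on_comp[OF bilinear_on_tens[OF vsp_D vsp_D]]
  have in_Hd: "c i \<in> carr Hd" for i
    using hopf.linear_e' by (simp add: carr_Hd)
  have "linear_on Hd Hd (\<lambda>f y. f (\<beta> (e j \<odot> y)))" for j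
    unfolding linear_on_def by (auto simp: carr_Hd smul_Hd fun_smul_def fun_eq_iff intro!: hopf.lf_o[of _ "\<lambda>y. \<beta> (e j \<odot> y)"] hopf.lin)
  then have "linear_on Hd (tensor D D) (\<lambda>f. \<Sum>i\<in>I. \<Sum>j\<in>I. tens D D (tens H Hd (e i) (c j)) (tens H Hd (\<delta> i (\<alpha> h)) (\<lambda>y. f (\<beta> (e j \<odot> y)))))" for h
    by (intro linear_on_sum_fun is_vsp_tensor B(2) linear_on_comp[OF linear_on_tens_HHd(2)] tens_in_D hopf.linear_e')
  then show "linear_on Hd (tensor D D) (pcomul h)" for h
    by (subst linear_on_cong[OF vsp_Hd pcomul_eq]) (simp_all add: carr_Hd)
  fix f assume "f \<in> carr Hd"
  then have f: "hopf.lf f" by (simp add: carr_Hd)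
  show "linear_on H (tensor D D) (\<lambda>h. pcomul h f)"
    unfolding pcomul_eq[OF f] using linear_on_comp[OF linear_\<delta> twist_linear]
    by (intro linear_on_sum_fun is_vsp_tensor B(2) linear_on_comp[OF linear_on_tens_HHd(1)] tens_in_D hopf.linear_e')
      (simp_all add: carr_Hd hopf.lin hopf.lf_o[OF f])
qed

lemma comul_D_linear: "linear_on D (tensor D D) (comul D)"
  unfolding comul_D by (intro tlift_D_linear is_vsp_tensor bilinear_on_pcomul)

lemma E_shift_lf: "hopf.lf f \<Longrightarrow> hopf.lf (\<lambda>y. f (a \<odot> \<beta> y))"
  by (rule hopf.lf_o[of f "\<lambda>y. a \<odot> \<beta> y"]) (simp_all add: hopf.lin)

lemma comul_E_in: "hopf.lf f \<Longrightarrow>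
    tens D D (E a (\<lambda>z. c j (\<beta> z))) (E b (\<lambda>y. f (e j \<odot> \<beta> y))) \<in> carr (tensor D D)"
  by (intro tens_in E_in E_shift_lf lf_\<beta> hopf.linear_e')

text \<open>The two sums over dual bases differ term by term, since one uses \<open>c j\<close> and
  the other its composition with \<beta>, but they represent the same tensor: both pair to
  \<open>f (\<beta> x \<odot> \<beta> y)\<close> on the dual leg. The form on the right exhibits
  both legs as twisted elements.\<close>

lemma comul_E:
  assumes f: "hopf.lf f"
  shows "comul D (E h f) = hopf.sw (\<lambda>h1 h2. \<Sum>j\<in>I. tens D D (E (\<alpha> h1) (\<lambda>z. c j (\<beta> z))) (E (\<alpha> h2) (\<lambda>y. f (e j \<odot> \<beta> y)))) h"
proof (rule DD_eqI)
  show "comul D (E h f) \<in> carr (tensor D D)"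
    using comul_D_linear E_in[OF f] by (rule linear_onD)
  show "hopf.sw (\<lambda>h1 h2. \<Sum>j\<in>I. tens D D (E (\<alpha> h1) (\<lambda>z. c j (\<beta> z))) (E (\<alpha> h2) (\<lambda>y. f (e j \<odot> \<beta> y)))) h \<in> carr (tensor D D)"
    unfolding hopf.sw_def by (intro carr_sum is_vsp_tensor comul_E_in f)
  fix \<phi> x \<psi> y assume \<phi>: "hopf.lf \<phi>" and \<psi>: "hopf.lf \<psi>"
  note [hopf.lin] = hopf.lf_o[OF f] hopf.lf_o[OF \<phi>] hopf.lf_o[OF \<psi>]
  have "comul D (E h f) = pcomul h (\<lambda>z. f (\<beta> z))"
    using lf_\<beta>[OF f] by (simp add: comul_D E_def tlift_tens[OF vsp_H vsp_Hd is_vsp_tensor bilinear_on_pcomul] whole_type carr_Hd)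
  then have "ev2 \<phi> x \<psi> y (comul D (E h f)) =
    hopf.sw (\<lambda>a b. \<Sum>j\<in>I. \<phi> a * c j (\<alpha> x) * (\<psi> b * f (\<beta> (\<beta> (e j \<odot> \<alpha> y))))) (\<alpha> h)"
    by (simp add: pcomul_eq lf_\<beta> f hopf.sw_def ev2_sum \<phi> \<psi> carr_sum[OF is_vsp_tensor] tens_in tens_in_D hopf.linear_e' hopf.lin
       ev2_tens ev_tens)
  also have "\<dots> = hopf.sw (\<lambda>a b. \<phi> a * \<psi> b) (\<alpha> h) * f (\<beta> x \<odot> \<beta> y)"
    using hopf.expand_lf(1)[of "\<lambda>z. f (\<beta> (\<beta> (z \<odot> \<alpha> y)))" "\<alpha> x"]
    by (simp add: hopf.lin mult_ac hopf.sw_mult_left \<beta>_m flip: sum_distrib_left)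
  also have "\<dots> = hopf.sw (\<lambda>h1 h2. \<Sum>j\<in>I. \<phi> (\<alpha> h1) * c j (\<beta> x) * (\<psi> (\<alpha> h2) * f (e j \<odot> \<beta> y))) h"
    using hopf.expand_lf(1)[of "\<lambda>z. f (z \<odot> \<beta> y)" "\<beta> x"]
    by (simp add: hopf.lin mult_ac hopf.sw_mult_left hopf.sw_\<alpha> \<phi> \<psi> flip: sum_distrib_left)
  also have "\<dots> = ev2 \<phi> x \<psi> y (hopf.sw (\<lambda>h1 h2. \<Sum>j\<in>I. tens D D (E (\<alpha> h1) (\<lambda>z. c j (\<beta> z))) (E (\<alpha> h2) (\<lambda>y. f (e j \<odot> \<beta> y)))) h)"
    by (simp add: hopf.sw_def ev2_sum \<phi> \<psi> carr_sum[OF is_vsp_tensor] comul_E_in f ev2_tens E_in ev_E lf_\<beta> hopf.linear_e' E_shift_lf)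
  finally show "ev2 \<phi> x \<psi> y (comul D (E h f)) = ev2 \<phi> x \<psi> y
    (hopf.sw (\<lambda>h1 h2. \<Sum>j\<in>I. tens D D (E (\<alpha> h1) (\<lambda>z. c j (\<beta> z))) (E (\<alpha> h2) (\<lambda>y. f (e j \<odot> \<beta> y)))) h)" .
qed

section \<open>The Drinfel'd double is a Hom-bialgebra\<close>

lemma one_D: "one D = E u \<epsilon>"
  by (simp add: drinfeld_double_def E_def hopf.\<epsilon>_\<beta>)

lemma counit_D: "counit D = ev \<epsilon> u"
  by (simp add: drinfeld_double_def ev_def hopf.\<alpha>_u)

lemma twist_D: "twist D = tmap H Hd H Hd \<alpha> (\<lambda>f. f \<circ> \<beta>)"
  by (simp add: drinfeld_double_def dual_hom_def)

lemma linear_twist_Hd: "linear_on Hd Hd (\<lambda>f. f \<circ> \<beta>)"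
  by (auto simp: linear_on_def carr_Hd smul_Hd fun_smul_def fun_eq_iff o_def lf_\<beta>)

lemma twist_D_linear: "linear_on D D (twist D)"
  unfolding twist_D linear_on_D by (intro tmap_linear vsp_H vsp_Hd twist_linear linear_twist_Hd)

lemma twist_E: "hopf.lf f \<Longrightarrow> twist D (E h f) = E (\<alpha> h) (\<lambda>z. f (\<beta> z))"
  unfolding twist_D E_def by (subst tmap_tens)
    (simp_all add: vsp_H vsp_Hd twist_linear linear_twist_Hd[unfolded o_def] whole_type carr_Hd lf_\<beta> o_def)

lemma lf_\<epsilon>: "hopf.lf \<epsilon>" and lf_c: "hopf.lf (c i)"
  by (rule hopf.linear_\<epsilon> hopf.linear_e')+

lemmas lf_simps = lf_\<alpha> lf_\<beta> lf_\<epsilon> lf_c E_shift_lf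

lemma dmul_linear:
  assumes "linear_on D X L" "hopf.lf f" "hopf.lf g" "\<And>h f. hopf.lf f \<Longrightarrow> \<Psi> h f \<in> carr D"
  shows "L (hopf.dmul \<Psi> h f k g) = hopf.dmul (\<lambda>h f. L (\<Psi> h f)) h f k g"
  unfolding hopf.dmul_def hopf.sw_def using assms(2-4)
  by (simp add: linear_on_sum[OF vsp_D assms(1)] sum_in_D hopf.lin)

lemma mul_D_in: "a \<in> carr D \<Longrightarrow> b \<in> carr D \<Longrightarrow> mul D a b \<in> carr D"
  using bilinear_on_mul_D by (rule bilinear_onD)

lemma twist_D_in: "a \<in> carr D \<Longrightarrow> twist D a \<in> carr D"
  using twist_D_linear by (rule linear_onD)

lemma comul_D_in: "a \<in> carr D \<Longrightarrow> comul D a \<in> carr (tensor D D)"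
  using comul_D_linear by (rule linear_onD)

lemma linear_on_mul_E:
  assumes "linear_on D X L" "hopf.lf f" "hopf.lf g"
  shows "L (mul D (E h f) (E k g)) = hopf.dmul (\<lambda>h f. L (E (\<alpha> h) (\<lambda>z. f (\<beta> z)))) h f k g"
  by (simp add: mul_E assms dmul_linear[OF assms] E_in lf_\<beta>)

lemma linear_on_comul_E:
  assumes "linear_on (tensor D D) X L" "hopf.lf f"
  shows "L (comul D (E h f)) = hopf.sw (\<lambda>h1 h2. \<Sum>j\<in>I.
    L (tens D D (E (\<alpha> h1) (\<lambda>z. c j (\<beta> z))) (E (\<alpha> h2) (\<lambda>y. f (e j \<odot> \<beta> y))))) h"
  by (simp add: comul_E assms(2) hopf.sw_def linear_on_sum[OF is_vsp_tensor assms(1)] carr_sum[OF is_vsp_tensor] comul_E_in)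

lemma ev_mul_E:
  assumes "hopf.lf \<phi>" "hopf.lf f" "hopf.lf g"
  shows "ev \<phi> x (mul D (E h f) (E k g)) = hopf.dm (\<lambda>h. \<phi> (\<alpha> h)) (\<beta> x) h f k g"
  using assms by (simp add: linear_on_mul_E[OF ev_linear] ev_E lf_\<beta> cong: hopf.dmul_cong)

lemma ev_mul_E_twist:
  assumes "hopf.lf \<phi>" "hopf.lf f" "hopf.lf g"
  shows "ev \<phi> x (mul D (E (\<alpha> h) (\<lambda>z. f (\<beta> z))) (E (\<alpha> k) (\<lambda>z. g (\<beta> z)))) =
    hopf.dm (\<lambda>h. \<phi> (\<alpha> (\<alpha> h))) (\<beta> (\<beta> x)) h f k g"
  using assms hopf.dm_natural[OF lf_\<alpha>[OF assms(1)] assms(2,3), of "\<beta> x" h k] by (simp add: ev_mul_E lf_\<beta>)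

lemma ev_twist_E:
  assumes "hopf.lf \<phi>" "hopf.lf f"
  shows "ev \<phi> x (twist D (E h f)) = \<phi> (\<alpha> h) * f (\<beta> x)"
  using assms by (simp add: twist_E ev_E lf_\<beta>)

lemma ev_twist:
  assumes \<phi>: "hopf.lf \<phi>" and t: "t \<in> carr D"
  shows "ev \<phi> x (twist D t) = ev (\<lambda>z. \<phi> (\<alpha> z)) (\<beta> x) t"
  by (rule D_linear_eqI[where F = "\<lambda>t. ev \<phi> x (twist D t)", OF is_vsp_base_field])
    (simp_all add: linear_on_comp[OF ev_linear twist_D_linear] ev_linear \<phi> lf_\<alpha> ev_twist_E ev_E t)

lemma ev2_comul_E:
  assumes "hopf.lf \<phi>" "hopf.lf \<psi>" "hopf.lf f"
  shows "ev2 \<phi> x \<psi> y (comul D (E h f)) = hopf.sw (\<lambda>a b. \<phi> (\<alpha> a) * \<psi> (\<alpha> b)) h * f (\<beta> x \<odot> \<beta> y)"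
proof -
  have "ev2 \<phi> x \<psi> y (comul D (E h f)) =
    hopf.sw (\<lambda>a b. \<Sum>j\<in>I. \<phi> (\<alpha> a) * \<psi> (\<alpha> b) * (c j (\<beta> x) * f (e j \<odot> \<beta> y))) h"
    using assms by (simp add: linear_on_comul_E[OF ev2_linear] ev2_tens E_in ev_E lf_simps mult_ac)
  then show ?thesis
    using hopf.expand_lf(1)[OF hopf.lf_o[OF assms(3)], of "\<lambda>z. z \<odot> \<beta> y" "\<beta> x"]
    by (simp add: hopf.lin hopf.sw_mult_right flip: sum_distrib_left)
qed

lemma D_bilinear_eqI:
  assumes X: "is_vsp X" and F: "bilinear_on D D X F" and G: "bilinear_on D D X G"
    and eq: "\<And>h f k g. hopf.lf f \<Longrightarrow> hopf.lf g \<Longrightarrow> F (E h f) (E k g) = G (E h f) (E k g)"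
    and ab: "a \<in> carr D" "b \<in> carr D"
  shows "F a b = G a b"
proof (rule D_linear_eqI[where F = "\<lambda>a. F a b" and G = "\<lambda>a. G a b", OF X _ _ _ ab(1)])
  fix h f assume f: "hopf.lf f"
  show "F (E h f) b = G (E h f) b"
    by (rule D_linear_eqI[OF X bilinear_onD(1)[OF F] bilinear_onD(1)[OF G] eq ab(2)]) (simp_all add: f E_in)
qed (intro bilinear_onD(2)[OF F] bilinear_onD(2)[OF G] ab)+

text \<open>On elements \<open>E h f\<close>, the twist in the axiom and the one produced by the
  inner product make both factors of the outer product twisted. \<open>dm_natural\<close> then moves
  two twists to the test data, and ordinary associativity \<open>dm_assoc\<close> remains.\<close>

lemma hom_assoc_D:
  assumes abc: "a \<in> carr D" "b \<in> carr D" "t \<in> carr D"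
  shows "mul D (twist D a) (mul D b t) = mul D (mul D a b) (twist D t)"
proof -
  note B = bilinear_on_comp[OF bilinear_on_mul_D]
  have EEE: "mul D (twist D (E h f)) (mul D (E k g) (E l q)) = mul D (mul D (E h f) (E k g)) (twist D (E l q))"
    if f: "hopf.lf f" and g: "hopf.lf g" and q: "hopf.lf q" for h f k g l q
  proof (rule D_eqI)
    fix \<phi> x assume \<phi>: "hopf.lf \<phi>"
    have L1: "linear_on D base_field (\<lambda>t. ev \<phi> x (mul D (E (\<alpha> h) (\<lambda>z. f (\<beta> z))) t))"
      by (intro linear_on_comp[OF ev_linear] bilinear_onD(1)[OF bilinear_on_mul_D] E_in lf_\<beta> f \<phi>)
    have L2: "linear_on D base_field (\<lambda>t. ev \<phi> x (mul D t (E (\<alpha> l) (\<lambda>z. q (\<beta> z)))))"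
      by (intro linear_on_comp[OF ev_linear] bilinear_onD(2)[OF bilinear_on_mul_D] E_in lf_\<beta> q \<phi>)
    have "ev \<phi> x (mul D (twist D (E h f)) (mul D (E k g) (E l q))) =
      hopf.dmul (\<lambda>k' g'. hopf.dm (\<lambda>h. \<phi> (\<alpha> (\<alpha> h))) (\<beta> (\<beta> x)) h f k' g') k g l q"
      using f g q \<phi> by (simp add: linear_on_mul_E[OF L1] twist_E ev_mul_E_twist cong: hopf.dmul_cong)
    moreover have "ev \<phi> x (mul D (mul D (E h f) (E k g)) (twist D (E l q))) =
      hopf.dmul (\<lambda>h' f'. hopf.dm (\<lambda>h. \<phi> (\<alpha> (\<alpha> h))) (\<beta> (\<beta> x)) h' f' l q) h f k g"
      using f g q \<phi> by (simp add: linear_on_mul_E[OF L2] twist_E ev_mul_E_twist cong: hopf.dmul_cong)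
    ultimately show "ev \<phi> x (mul D (twist D (E h f)) (mul D (E k g) (E l q))) =
       ev \<phi> x (mul D (mul D (E h f) (E k g)) (twist D (E l q)))"
      using hopf.dm_assoc[OF lf_\<alpha>[OF lf_\<alpha>[OF \<phi>]] f g q] by simp
  qed (use f g q in \<open>auto intro!: mul_D_in twist_D_in E_in\<close>)
  have EE: "mul D (twist D (E h f)) (mul D (E k g) t) = mul D (mul D (E h f) (E k g)) (twist D t)"
    if f: "hopf.lf f" and g: "hopf.lf g" for h f k g
    by (rule D_linear_eqI[where F = "\<lambda>t. mul D (twist D (E h f)) (mul D (E k g) t)", OF vsp_D])
      (use f g abc in \<open>auto intro!: B linear_on_id bilinear_onD(1)[OF bilinear_on_mul_D] twist_D_linear EEE mul_D_in twist_D_in E_in\<close>)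
  show ?thesis
    by (rule D_bilinear_eqI[where F = "\<lambda>a b. mul D (twist D a) (mul D b t)", OF vsp_D])
      (use abc in \<open>auto intro!: bilinear_onI B linear_on_id twist_D_linear EE mul_D_in twist_D_in
        bilinear_onD(1)[OF bilinear_on_mul_D] bilinear_onD(2)[OF bilinear_on_mul_D]\<close>)
qed

lemma hom_algebra_D: "hom_algebra D"
proof
  note B = bilinear_on_comp[OF bilinear_on_mul_D]
  show "is_vsp D" by (rule vsp_D)
  show "bilinear_on D D D (mul D)" by (rule bilinear_on_mul_D)
  show "one D \<in> carr D" by (simp add: one_D E_in lf_\<epsilon>)
  show "linear_on D D (twist D)" by (rule twist_D_linear)
  show "twist D (one D) = one D" by (simp add: one_D twist_E lf_\<epsilon> hopf.\<alpha>_u hopf.\<epsilon>_\<beta>)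
  show "mul D (twist D a) (mul D b t) = mul D (mul D a b) (twist D t)"
    if "a \<in> carr D" "b \<in> carr D" "t \<in> carr D" for a b t
    using that by (rule hom_assoc_D)
  show "twist D (mul D a b) = mul D (twist D a) (twist D b)" if "a \<in> carr D" "b \<in> carr D" for a b
  proof (rule D_bilinear_eqI[where F = "\<lambda>a b. twist D (mul D a b)", OF vsp_D _ _ _ that])
    show "bilinear_on D D D (\<lambda>a b. twist D (mul D a b))"
      using bilinear_on_mul_D twist_D_linear by (rule bilinear_on_compose)
    show "bilinear_on D D D (\<lambda>a b. mul D (twist D a) (twist D b))"
      by (intro bilinear_onI B twist_D_linear twist_D_in)
    fix h f k g assume "hopf.lf f" "hopf.lf g"
    then show "twist D (mul D (E h f) (E k g)) = mul D (twist D (E h f)) (twist D (E k g))"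
      by (intro D_eqI) (simp_all add: twist_D_in mul_D_in E_in ev_twist ev_mul_E_twist ev_mul_E[OF lf_\<alpha>] twist_E lf_simps)
  qed
  show "mul D (one D) a = twist D a" if "a \<in> carr D" for a
  proof (rule D_linear_eqI[OF vsp_D _ twist_D_linear _ that])
    show "linear_on D D (mul D (one D))"
      by (intro bilinear_onD[OF bilinear_on_mul_D]) (simp add: one_D E_in lf_\<epsilon>)
    fix h f assume "hopf.lf f"
    then show "mul D (one D) (E h f) = twist D (E h f)"
      by (intro D_eqI) (simp_all add: one_D twist_D_in mul_D_in E_in ev_twist_E ev_mul_E lf_simps hopf.dm_\<epsilon> m_u)
  qed
  show "mul D a (one D) = twist D a" if "a \<in> carr D" for a
  proof (rule D_linear_eqI[where F = "\<lambda>a. mul D a (one D)", OF vsp_D _ twist_D_linear _ that])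
    show "linear_on D D (\<lambda>a. mul D a (one D))"
      by (intro bilinear_onD[OF bilinear_on_mul_D]) (simp add: one_D E_in lf_\<epsilon>)
    fix h f assume "hopf.lf f"
    then show "mul D (E h f) (one D) = twist D (E h f)"
      by (intro D_eqI) (simp_all add: one_D twist_D_in mul_D_in E_in ev_twist_E ev_mul_E lf_simps hopf.dm_u hopf.conv_\<epsilon>)
  qed
qed

lemma ev_smul: "hopf.lf \<phi> \<Longrightarrow> t \<in> carr D \<Longrightarrow> ev \<phi> x (smul D k t) = k * ev \<phi> x t"
  using linear_onD(3)[OF ev_linear] by (simp add: base_field_def)

lemma tlift_comul_E:
  assumes "is_vsp X" "bilinear_on D D X G" "hopf.lf f"
  shows "tlift D D G (comul D (E h f)) = hopf.sw (\<lambda>h1 h2. \<Sum>j\<in>I.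
    G (E (\<alpha> h1) (\<lambda>z. c j (\<beta> z))) (E (\<alpha> h2) (\<lambda>y. f (e j \<odot> \<beta> y)))) h"
  using assms by (simp add: linear_on_comul_E[OF tlift_linear[OF vsp_D vsp_D assms(1,2)]]
    tlift_tens[OF vsp_D vsp_D assms(1,2)] E_in lf_simps)

lemma counit_D_linear: "linear_on D base_field (counit D)"
  unfolding counit_D by (intro ev_linear lf_\<epsilon>)

lemma counit_E: "hopf.lf f \<Longrightarrow> counit D (E h f) = \<epsilon> h * f u"
  by (simp add: counit_D ev_E lf_\<epsilon>)

lemma smul_D_in: "t \<in> carr D \<Longrightarrow> smul D k t \<in> carr D"
  using vsp_D by (rule is_vspD)

lemma bilinear_on_counit:
  "bilinear_on D D D (\<lambda>a b. smul D (counit D a) b)" "bilinear_on D D D (\<lambda>a b. smul D (counit D b) a)"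
  using counit_D_linear by (auto intro!: bilinear_onI linear_on_smul linear_on_smul_const vsp_D linear_on_id)

lemma ev2_tmap_twist:
  assumes \<phi>: "hopf.lf \<phi>" "hopf.lf \<psi>" and t: "t \<in> carr (tensor D D)"
  shows "ev2 \<phi> x \<psi> y (tmap D D D D (twist D) (twist D) t) = ev2 (\<lambda>z. \<phi> (\<alpha> z)) (\<beta> x) (\<lambda>z. \<psi> (\<alpha> z)) (\<beta> y) t"
proof (rule tensor_eqI[where F = "\<lambda>t. ev2 \<phi> x \<psi> y (tmap D D D D (twist D) (twist D) t)", OF vsp_D vsp_D is_vsp_base_field _ _ _ t])
  show "linear_on (tensor D D) base_field (\<lambda>t. ev2 \<phi> x \<psi> y (tmap D D D D (twist D) (twist D) t))"
    by (intro linear_on_comp[OF ev2_linear] tmap_linear vsp_D twist_D_linear \<phi>)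
qed (simp_all add: ev2_linear \<phi> lf_\<alpha> tmap_tens vsp_D twist_D_linear ev2_tens twist_D_in ev_twist)

lemma ev3_tassoc:
  assumes \<phi>: "hopf.lf \<phi>" "hopf.lf \<psi>" "hopf.lf \<chi>" and s: "s \<in> carr (tensor D D)" and t: "t \<in> carr D"
  shows "ev3 \<phi> x \<psi> y \<chi> z (tassoc D D D (tens (tensor D D) D s t)) = ev2 \<phi> x \<psi> y s * ev \<chi> z t"
proof (rule tensor_eqI[where F = "\<lambda>s. ev3 \<phi> x \<psi> y \<chi> z (tassoc D D D (tens (tensor D D) D s t))",
      OF vsp_D vsp_D is_vsp_base_field _ _ _ s])
  show "linear_on (tensor D D) base_field (\<lambda>s. ev3 \<phi> x \<psi> y \<chi> z (tassoc D D D (tens (tensor D D) D s t)))"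
    by (intro linear_on_comp[OF ev3_linear] linear_on_comp[OF tassoc_linear] vsp_D \<phi> 
        bilinear_onD(2)[OF bilinear_on_tens[OF is_vsp_tensor vsp_D]] t)
  show "linear_on (tensor D D) base_field (\<lambda>s. ev2 \<phi> x \<psi> y s * ev \<chi> z t)"
    by (intro linear_on_mult ev2_linear \<phi>)
qed (simp_all add: tassoc_tens vsp_D t ev3_tens ev2_tens tens_in \<phi>)

lemma ev3_tassoc_tmap:
  assumes \<phi>: "hopf.lf \<phi>" "hopf.lf \<psi>" "hopf.lf \<chi>"
  shows "linear_on (tensor D D) base_field
      (\<lambda>t. ev3 \<phi> x \<psi> y \<chi> z (tassoc D D D (tmap D D (tensor D D) D (comul D) (twist D) t)))"
    and "s \<in> carr D \<Longrightarrow> t \<in> carr D \<Longrightarrow>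
      ev3 \<phi> x \<psi> y \<chi> z (tassoc D D D (tmap D D (tensor D D) D (comul D) (twist D) (tens D D s t))) =
      ev2 \<phi> x \<psi> y (comul D s) * ev \<chi> z (twist D t)"
    and "linear_on (tensor D D) base_field (\<lambda>t. ev3 \<phi> x \<psi> y \<chi> z (tmap D D D (tensor D D) (twist D) (comul D) t))"
    and "s \<in> carr D \<Longrightarrow> t \<in> carr D \<Longrightarrow>
      ev3 \<phi> x \<psi> y \<chi> z (tmap D D D (tensor D D) (twist D) (comul D) (tens D D s t)) =
      ev \<phi> x (twist D s) * ev2 \<psi> y \<chi> z (comul D t)"
proof -
  show "linear_on (tensor D D) base_field
      (\<lambda>t. ev3 \<phi> x \<psi> y \<chi> z (tassoc D D D (tmap D D (tensor D D) D (comul D) (twist D) t)))"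
    by (intro linear_on_comp[OF ev3_linear] linear_on_comp[OF tassoc_linear] tmap_linear vsp_D is_vsp_tensor
        comul_D_linear twist_D_linear \<phi>)
  show "linear_on (tensor D D) base_field (\<lambda>t. ev3 \<phi> x \<psi> y \<chi> z (tmap D D D (tensor D D) (twist D) (comul D) t))"
    by (intro linear_on_comp[OF ev3_linear] tmap_linear vsp_D is_vsp_tensor comul_D_linear twist_D_linear \<phi>)
qed (simp_all add: tmap_tens vsp_D is_vsp_tensor comul_D_linear twist_D_linear ev3_tassoc ev3_tens comul_D_in twist_D_in \<phi>)

lemma hom_coalgebra_D: "hom_coalgebra D"
proof
  show "is_vsp D" by (rule vsp_D)
  show "linear_on D (tensor D D) (comul D)" by (rule comul_D_linear)
  show "linear_on D base_field (counit D)" by (rule counit_D_linear)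
  show "linear_on D D (twist D)" by (rule twist_D_linear)
  show "counit D (twist D t) = counit D t" if "t \<in> carr D" for t
    using ev_twist[OF lf_\<epsilon> that, of u] by (simp add: counit_D hopf.\<epsilon>_\<alpha> \<beta>_u)
  show "tmap D D D D (twist D) (twist D) (comul D t) = comul D (twist D t)" if "t \<in> carr D" for t
  proof (rule D_linear_eqI[where F = "\<lambda>t. tmap D D D D (twist D) (twist D) (comul D t)", OF is_vsp_tensor _ _ _ that])
    have lin: "linear_on (tensor D D) (tensor D D) (tmap D D D D (twist D) (twist D))"
      by (intro tmap_linear vsp_D twist_D_linear)
    then show "linear_on D (tensor D D) (\<lambda>t. tmap D D D D (twist D) (twist D) (comul D t))"
      using comul_D_linear by (rule linear_on_comp)
    show "linear_on D (tensor D D) (\<lambda>t. comul D (twist D t))"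
      using comul_D_linear twist_D_linear by (rule linear_on_comp)
    fix h f assume f: "hopf.lf f"
    show "tmap D D D D (twist D) (twist D) (comul D (E h f)) = comul D (twist D (E h f))"
    proof (rule DD_eqI)
      fix \<phi> x \<psi> y assume \<phi>: "hopf.lf \<phi>" "hopf.lf \<psi>"
      note [hopf.lin] = hopf.lf_o[OF \<phi>(1)] hopf.lf_o[OF \<phi>(2)]
      show "ev2 \<phi> x \<psi> y (tmap D D D D (twist D) (twist D) (comul D (E h f))) = ev2 \<phi> x \<psi> y (comul D (twist D (E h f)))"
        by (simp add: ev2_tmap_twist ev2_comul_E comul_D_in E_in twist_E f \<phi> lf_simps hopf.sw_\<alpha> hopf.lin \<beta>_m)
    qed (auto intro!: linear_onD(1)[OF lin] comul_D_in twist_D_in E_in f)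
  qed
  show "sweedler D (\<lambda>a b. smul D (counit D a) b) t = twist D t" if "t \<in> carr D" for t
    unfolding sweedler_def
  proof (rule D_linear_eqI[where F = "\<lambda>t. tlift D D (\<lambda>a b. smul D (counit D a) b) (comul D t)", OF vsp_D _ twist_D_linear _ that])
    show "linear_on D D (\<lambda>t. tlift D D (\<lambda>a b. smul D (counit D a) b) (comul D t))"
      by (intro linear_on_comp[OF tlift_linear] vsp_D bilinear_on_counit comul_D_linear)
    fix h f assume f: "hopf.lf f"
    show "tlift D D (\<lambda>a b. smul D (counit D a) b) (comul D (E h f)) = twist D (E h f)"
    proof (rule D_eqI)
      fix \<phi> x assume \<phi>: "hopf.lf \<phi>"
      note [hopf.lin] = hopf.lf_o[OF \<phi>] hopf.lf_o[OF f]
      have "ev \<phi> x (tlift D D (\<lambda>a b. smul D (counit D a) b) (comul D (E h f))) =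
        hopf.sw (\<lambda>a b. \<Sum>j\<in>I. \<epsilon> a * (\<phi> (\<alpha> b) * (c j u * f (e j \<odot> \<beta> x)))) h"
        by (simp add: tlift_comul_E[OF vsp_D bilinear_on_counit(1) f] ev_sw sum_in_D ev_sum \<phi> smul_D_in E_in lf_simps f
            ev_smul counit_E ev_E hopf.\<epsilon>_\<alpha> \<beta>_u mult_ac)
      also have "\<dots> = ev \<phi> x (twist D (E h f))"
        using hopf.expand_lf(1)[of "\<lambda>z. f (z \<odot> \<beta> x)" u]
        by (simp add: hopf.lin u_m ev_twist_E \<phi> f flip: sum_distrib_left)
          (simp add: hopf.lin hopf.counit_left flip: hopf.sw_mult_right mult.assoc)
      finally show "ev \<phi> x (tlift D D (\<lambda>a b. smul D (counit D a) b) (comul D (E h f))) = ev \<phi> x (twist D (E h f))" .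
    qed (auto intro!: linear_onD(1)[OF tlift_linear] vsp_D bilinear_on_counit comul_D_in twist_D_in E_in f)
  qed
  show "sweedler D (\<lambda>a b. smul D (counit D b) a) t = twist D t" if "t \<in> carr D" for t
    unfolding sweedler_def
  proof (rule D_linear_eqI[where F = "\<lambda>t. tlift D D (\<lambda>a b. smul D (counit D b) a) (comul D t)", OF vsp_D _ twist_D_linear _ that])
    show "linear_on D D (\<lambda>t. tlift D D (\<lambda>a b. smul D (counit D b) a) (comul D t))"
      by (intro linear_on_comp[OF tlift_linear] vsp_D bilinear_on_counit comul_D_linear)
    fix h f assume f: "hopf.lf f"
    show "tlift D D (\<lambda>a b. smul D (counit D b) a) (comul D (E h f)) = twist D (E h f)"
    proof (rule D_eqI)
      fix \<phi> x assume \<phi>: "hopf.lf \<phi>"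
      note [hopf.lin] = hopf.lf_o[OF \<phi>] hopf.lf_o[OF f]
      have "ev \<phi> x (tlift D D (\<lambda>a b. smul D (counit D b) a) (comul D (E h f))) =
        hopf.sw (\<lambda>a b. \<Sum>j\<in>I. \<epsilon> b * (\<phi> (\<alpha> a) * (c j (\<beta> x) * f (e j)))) h"
        by (simp add: tlift_comul_E[OF vsp_D bilinear_on_counit(2) f] ev_sw sum_in_D ev_sum \<phi> smul_D_in E_in lf_simps f
            ev_smul counit_E ev_E hopf.\<epsilon>_\<alpha> \<beta>_u m_u mult_ac)
      also have "\<dots> = ev \<phi> x (twist D (E h f))"
        by (simp add: hopf.lin hopf.expand_lf f ev_twist_E \<phi> f flip: sum_distrib_left)
          (simp add: hopf.lin hopf.counit_right flip: hopf.sw_mult_right mult.assoc)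
      finally show "ev \<phi> x (tlift D D (\<lambda>a b. smul D (counit D b) a) (comul D (E h f))) = ev \<phi> x (twist D (E h f))" .
    qed (auto intro!: linear_onD(1)[OF tlift_linear] vsp_D bilinear_on_counit comul_D_in twist_D_in E_in f)
  qed
  show "tassoc D D D (tmap D D (tensor D D) D (comul D) (twist D) (comul D t)) =
     tmap D D D (tensor D D) (twist D) (comul D) (comul D t)" if "t \<in> carr D" for t
  proof (rule D_linear_eqI[where F = "\<lambda>t. tassoc D D D (tmap D D (tensor D D) D (comul D) (twist D) (comul D t))",
        OF is_vsp_tensor _ _ _ that])
    have lin1: "linear_on (tensor D D) (tensor D (tensor D D)) (\<lambda>t. tassoc D D D (tmap D D (tensor D D) D (comul D) (twist D) t))"
      by (intro linear_on_comp[OF tassoc_linear] tmap_linear vsp_D is_vsp_tensor comul_D_linear twist_D_linear)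
    then show "linear_on D (tensor D (tensor D D)) (\<lambda>t. tassoc D D D (tmap D D (tensor D D) D (comul D) (twist D) (comul D t)))"
      using comul_D_linear by (rule linear_on_comp)
    have lin2: "linear_on (tensor D D) (tensor D (tensor D D)) (tmap D D D (tensor D D) (twist D) (comul D))"
      by (intro tmap_linear vsp_D is_vsp_tensor comul_D_linear twist_D_linear)
    then show "linear_on D (tensor D (tensor D D)) (\<lambda>t. tmap D D D (tensor D D) (twist D) (comul D) (comul D t))"
      using comul_D_linear by (rule linear_on_comp)
    fix h f assume f: "hopf.lf f"
    show "tassoc D D D (tmap D D (tensor D D) D (comul D) (twist D) (comul D (E h f))) =
       tmap D D D (tensor D D) (twist D) (comul D) (comul D (E h f))"
    proof (rule DDD_eqI)
      fix \<phi> x \<psi> y \<chi> z assume \<phi>: "hopf.lf \<phi>" "hopf.lf \<psi>" "hopf.lf \<chi>"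
      note [hopf.lin] = hopf.lf_o[OF \<phi>(1)] hopf.lf_o[OF \<phi>(2)] hopf.lf_o[OF \<phi>(3)] hopf.lf_o[OF f]
      \<comment> \<open>The two tensor legs separate: the first needs coassociativity of
        \<open>H\<close>, and the dual leg gives this value on both sides by associativity of
        \<open>\<odot>\<close>.\<close>
      let ?C = "f (\<beta> (\<beta> x \<odot> \<beta> y) \<odot> \<beta> (\<beta> z))"
      have "ev3 \<phi> x \<psi> y \<chi> z (tassoc D D D (tmap D D (tensor D D) D (comul D) (twist D) (comul D (E h f)))) =
        hopf.sw (\<lambda>h1 h2. \<Sum>j\<in>I. hopf.sw (\<lambda>a b. \<phi> (\<alpha> (\<alpha> a)) * \<psi> (\<alpha> (\<alpha> b)) * \<chi> (\<alpha> (\<alpha> h2))) h1 *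
          (c j (\<beta> (\<beta> x \<odot> \<beta> y)) * f (e j \<odot> \<beta> (\<beta> z)))) h"
        by (simp add: linear_on_comul_E[OF ev3_tassoc_tmap(1)] ev3_tassoc_tmap(2) E_in f \<phi> lf_simps ev2_comul_E ev_twist_E
           hopf.sw_\<alpha> hopf.lin hopf.sw_mult_right hopf.sw_mult_left mult_ac)
      also have "\<dots> = hopf.sw (\<lambda>h1 h2. hopf.sw (\<lambda>a b. \<phi> (\<alpha> (\<alpha> a)) * \<psi> (\<alpha> (\<alpha> b)) * \<chi> (\<alpha> (\<alpha> h2))) h1) h * ?C"
        using hopf.expand_lf(1)[of "\<lambda>w. f (w \<odot> \<beta> (\<beta> z))" "\<beta> (\<beta> x \<odot> \<beta> y)"]
        by (simp add: hopf.lin flip: sum_distrib_left) (simp add: hopf.sw_mult_right)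
      also have "\<dots> = hopf.sw (\<lambda>h1 h2. hopf.sw (\<lambda>a b. \<phi> (\<alpha> (\<alpha> h1)) * \<psi> (\<alpha> (\<alpha> a)) * \<chi> (\<alpha> (\<alpha> b))) h2) h * ?C"
        by (subst hopf.coassoc) (simp_all add: hopf.lin)
      also have "\<dots> = hopf.sw (\<lambda>h1 h2. \<Sum>j\<in>I. hopf.sw (\<lambda>a b. \<phi> (\<alpha> (\<alpha> h1)) * \<psi> (\<alpha> (\<alpha> a)) * \<chi> (\<alpha> (\<alpha> b))) h2 *
          (c j (\<beta> (\<beta> x)) * f (e j \<odot> \<beta> (\<beta> y \<odot> \<beta> z)))) h"
        using hopf.expand_lf(1)[of "\<lambda>w. f (w \<odot> \<beta> (\<beta> y \<odot> \<beta> z))" "\<beta> (\<beta> x)"]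
        by (simp add: hopf.lin \<beta>_m m_assoc flip: sum_distrib_left) (simp add: hopf.sw_mult_right)
      also have "\<dots> = ev3 \<phi> x \<psi> y \<chi> z (tmap D D D (tensor D D) (twist D) (comul D) (comul D (E h f)))"
        by (simp add: linear_on_comul_E[OF ev3_tassoc_tmap(3)] ev3_tassoc_tmap(4) E_in f \<phi> lf_simps ev2_comul_E ev_twist_E
           hopf.sw_\<alpha> hopf.lin hopf.sw_mult_right hopf.sw_mult_left mult_ac)
      finally show "ev3 \<phi> x \<psi> y \<chi> z (tassoc D D D (tmap D D (tensor D D) D (comul D) (twist D) (comul D (E h f)))) =
         ev3 \<phi> x \<psi> y \<chi> z (tmap D D D (tensor D D) (twist D) (comul D) (comul D (E h f)))" .
    qed (auto intro!: linear_onD(1)[OF lin1] linear_onD(1)[OF lin2] comul_D_in E_in f)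
  qed
qed

lemma comul_mul_D:
  assumes "a \<in> carr D" "b \<in> carr D"
  shows "comul D (mul D a b) = tmul D D (mul D) (mul D) (comul D a) (comul D b)"
proof (rule D_bilinear_eqI[where F = "\<lambda>a b. comul D (mul D a b)" and
      G = "\<lambda>a b. tmul D D (mul D) (mul D) (comul D a) (comul D b)", OF is_vsp_tensor _ _ _ assms])
  note M = bilinear_on_tmul[OF vsp_D vsp_D bilinear_on_mul_D bilinear_on_mul_D]
  show "bilinear_on D D (tensor D D) (\<lambda>a b. comul D (mul D a b))"
    using bilinear_on_mul_D comul_D_linear by (rule bilinear_on_compose)
  show "bilinear_on D D (tensor D D) (\<lambda>a b. tmul D D (mul D) (mul D) (comul D a) (comul D b))"
    by (intro bilinear_onI bilinear_on_comp[OF M] comul_D_linear comul_D_in)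
  fix h f k g assume f: "hopf.lf f" and g: "hopf.lf g"
  show "comul D (mul D (E h f) (E k g)) = tmul D D (mul D) (mul D) (comul D (E h f)) (comul D (E k g))"
  proof (rule DD_eqI)
    show "comul D (mul D (E h f) (E k g)) \<in> carr (tensor D D)"
      by (intro comul_D_in mul_D_in E_in f g)
    show "tmul D D (mul D) (mul D) (comul D (E h f)) (comul D (E k g)) \<in> carr (tensor D D)"
      by (intro bilinear_onD(3)[OF M] comul_D_in E_in f g)
    fix \<phi> x \<psi> y assume \<phi>: "hopf.lf \<phi>" "hopf.lf \<psi>"
    note [hopf.lin] = hopf.lf_o[OF \<phi>(1)] hopf.lf_o[OF \<phi>(2)] hopf.lf_o[OF f] hopf.lf_o[OF g]
    let ?\<phi> = "\<lambda>z. \<phi> (\<alpha> (\<alpha> z))" and ?\<psi> = "\<lambda>z. \<psi> (\<alpha> (\<alpha> z))" and ?x = "\<beta> (\<beta> x)" and ?y = "\<beta> (\<beta> y)"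
    have L1: "linear_on D base_field (\<lambda>t. ev2 \<phi> x \<psi> y (comul D t))"
      by (intro linear_on_comp[OF ev2_linear] comul_D_linear \<phi>)
    have L2: "linear_on (tensor D D) base_field (\<lambda>t. ev2 \<phi> x \<psi> y (tmul D D (mul D) (mul D) t (comul D (E k g))))"
      by (intro linear_on_comp[OF ev2_linear] bilinear_onD(2)[OF M] \<phi> comul_D_in E_in g)
    have L3: "linear_on (tensor D D) base_field (\<lambda>t. ev2 \<phi> x \<psi> y (tmul D D (mul D) (mul D) (tens D D s s') t))"
      if "s \<in> carr D" "s' \<in> carr D" for s s'
      by (intro linear_on_comp[OF ev2_linear] bilinear_onD(1)[OF M] \<phi> tens_in that)
    have "ev2 \<phi> x \<psi> y (comul D (mul D (E h f) (E k g))) =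
      hopf.dmul (\<lambda>h' f'. hopf.sw (\<lambda>a b. ?\<phi> a * ?\<psi> b) h' * f' (?x \<odot> ?y)) h f k g"
      by (simp add: linear_on_mul_E[OF L1] f g \<phi> lf_simps ev2_comul_E hopf.sw_\<alpha> hopf.lin \<beta>_m cong: hopf.dmul_cong)
    also have "\<dots> = hopf.sw (\<lambda>h1 h2. \<Sum>i\<in>I. hopf.sw (\<lambda>k1 k2. \<Sum>j\<in>I. hopf.dm ?\<phi> ?x h1 (c i) k1 (c j) *
      hopf.dm ?\<psi> ?y h2 (\<lambda>z. f (e i \<odot> z)) k2 (\<lambda>z. g (e j \<odot> z))) k) h"
      by (rule hopf.dm_comul) (intro lf_\<alpha> \<phi> f g)+
    also have "\<dots> = ev2 \<phi> x \<psi> y (tmul D D (mul D) (mul D) (comul D (E h f)) (comul D (E k g)))"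
    proof -
      have dm: "ev \<psi> y (mul D (E (\<alpha> h2) (\<lambda>z. f (e i \<odot> \<beta> z))) (E (\<alpha> k2) (\<lambda>z. g (e j \<odot> \<beta> z)))) =
        hopf.dm ?\<psi> ?y h2 (\<lambda>z. f (e i \<odot> z)) k2 (\<lambda>z. g (e j \<odot> z))" for h2 k2 i j
        using ev_mul_E_twist[OF \<phi>(2), of "\<lambda>z. f (e i \<odot> z)" "\<lambda>z. g (e j \<odot> z)"] by (simp add: hopf.lin)
      show ?thesis
        by (simp add: linear_on_comul_E[OF L2] linear_on_comul_E[OF L3] f g E_in lf_simps
            tmul_tens[OF vsp_D vsp_D bilinear_on_mul_D bilinear_on_mul_D] ev2_tens \<phi> mul_D_in ev_mul_E_twist dm)
    qed
    finally show "ev2 \<phi> x \<psi> y (comul D (mul D (E h f) (E k g))) =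
      ev2 \<phi> x \<psi> y (tmul D D (mul D) (mul D) (comul D (E h f)) (comul D (E k g)))" .
  qed
qed

lemma hom_bialgebra_D: "hom_bialgebra D"
proof (intro hom_bialgebra.intro hom_algebra_D hom_coalgebra_D hom_bialgebra_axioms.intro)
  show "comul D (one D) = tens D D (one D) (one D)"
  proof (rule DD_eqI)
    fix \<phi> x \<psi> y assume \<phi>: "hopf.lf \<phi>" "hopf.lf \<psi>"
    note [hopf.lin] = hopf.lf_o[OF \<phi>(1)] hopf.lf_o[OF \<phi>(2)]
    show "ev2 \<phi> x \<psi> y (comul D (one D)) = ev2 \<phi> x \<psi> y (tens D D (one D) (one D))"
      by (simp add: one_D ev2_comul_E \<phi> lf_\<epsilon> hopf.sw_u hopf.lin ev2_tens E_in ev_E hopf.\<alpha>_u hopf.\<epsilon>_m hopf.\<epsilon>_\<beta>)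
  qed (auto simp: one_D intro!: comul_D_in tens_in E_in lf_\<epsilon>)
  show "comul D (mul D a b) = tmul D D (mul D) (mul D) (comul D a) (comul D b)" if "a \<in> carr D" "b \<in> carr D" for a b
    using that by (rule comul_mul_D)
  show "counit D (one D) = 1"
    by (simp add: one_D counit_E lf_\<epsilon> hopf.\<epsilon>_u)
  show "counit D (mul D a b) = counit D a * counit D b" if "a \<in> carr D" "b \<in> carr D" for a b
  proof (rule D_bilinear_eqI[where F = "\<lambda>a b. counit D (mul D a b)", OF is_vsp_base_field _ _ _ that])
    show "bilinear_on D D base_field (\<lambda>a b. counit D (mul D a b))"
      using bilinear_on_mul_D counit_D_linear by (rule bilinear_on_compose)
    show "bilinear_on D D base_field (\<lambda>a b. counit D a * counit D b)"
      by (intro bilinear_on_mult counit_D_linear)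
    fix h f k g assume "hopf.lf f" "hopf.lf g"
    then show "counit D (mul D (E h f) (E k g)) = counit D (E h f) * counit D (E k g)"
      by (simp add: counit_E) (simp add: counit_D ev_mul_E lf_\<epsilon> hopf.\<epsilon>_\<alpha> \<beta>_u hopf.dm_counit)
  qed
qed

section \<open>The canonical element and the quasitriangularity axioms\<close>

definition R where "R = (\<Sum>i\<in>I. tens D D (E u (c i)) (E (hopf.T (e i)) \<epsilon>))"

lemma R_in: "R \<in> carr (tensor D D)"
  unfolding R_def by (intro carr_sum is_vsp_tensor tens_in E_in lf_c lf_\<epsilon>)

lemma linear_on_R:
  "linear_on (tensor D D) X L \<Longrightarrow> L R = (\<Sum>i\<in>I. L (tens D D (E u (c i)) (E (hopf.T (e i)) \<epsilon>)))"
  unfolding R_def by (rule linear_on_sum[OF is_vsp_tensor[of D D]]) (auto intro: tens_in E_in lf_c lf_\<epsilon>)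

text \<open>A canonical element does not depend on the dual bases, and \<alpha> carries one pair to
  another. Legs of a coproduct are already twisted elements, so this form lets
  \<open>ev_mul_E_twist\<close> handle their products with \<open>R\<close>.\<close>

lemma R_twist: "R = (\<Sum>i\<in>I. tens D D (E (\<alpha> u) (\<lambda>z. c i (\<beta> z))) (E (\<alpha> (hopf.T (e i))) (\<lambda>z. \<epsilon> (\<beta> z))))" (is "_ = ?R")
proof (rule DD_eqI[OF R_in])
  show "?R \<in> carr (tensor D D)"
    by (intro carr_sum is_vsp_tensor tens_in E_in lf_simps)
  fix \<phi> x \<psi> y assume \<phi>: "hopf.lf \<phi>" "hopf.lf \<psi>"
  note [hopf.lin] = hopf.lf_o[OF \<phi>(2)]
  have "ev2 \<phi> x \<psi> y R = (\<Sum>i\<in>I. \<phi> u * \<epsilon> y * (c i x * \<psi> (hopf.T (e i))))"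
    using \<phi> by (simp add: linear_on_R[OF ev2_linear] ev2_tens ev_E E_in lf_simps mult_ac)
  also have "\<dots> = \<phi> u * \<epsilon> y * \<psi> (hopf.T x)"
    using hopf.expand_lf(1)[of "\<lambda>z. \<psi> (hopf.T z)" x] by (simp add: hopf.lin flip: sum_distrib_left)
  also have "\<dots> = (\<Sum>i\<in>I. \<phi> u * \<epsilon> y * (c i (\<beta> x) * \<psi> (\<alpha> (hopf.T (e i)))))"
    using hopf.expand_lf(1)[of "\<lambda>z. \<psi> (\<alpha> (hopf.T z))" "\<beta> x"]
    by (simp add: hopf.lin hopf.T_\<beta> flip: sum_distrib_left)
  also have "\<dots> = ev2 \<phi> x \<psi> y ?R"
    using \<phi> by (simp add: ev2_sum ev2_tens ev_E E_in tens_in lf_simps hopf.\<alpha>_u hopf.\<epsilon>_\<beta> mult_ac)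
  finally show "ev2 \<phi> x \<psi> y R = ev2 \<phi> x \<psi> y ?R" .
qed

text \<open>With \<open>R\<close> in the form of \<open>R_twist\<close>, each product has two
  twisted factors. The twists pass to \<phi>, \<psi>, \<open>x\<close>, \<open>y\<close>, and the
  two sides become those of \<open>dm_R_left\<close> and \<open>dm_R_right\<close>.\<close>

lemma R_comul_D:
  assumes "t \<in> carr D"
  shows "tmul D D (mul D) (mul D) (tflip D D (comul D t)) R = tmul D D (mul D) (mul D) R (comul D t)"
proof (rule D_linear_eqI[where F = "\<lambda>t. tmul D D (mul D) (mul D) (tflip D D (comul D t)) R", OF is_vsp_tensor _ _ _ assms])
  note M = bilinear_on_tmul[OF vsp_D vsp_D bilinear_on_mul_D bilinear_on_mul_D]
  note Mt = tmul_tens[OF vsp_D vsp_D bilinear_on_mul_D bilinear_on_mul_D]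
  have lin1: "linear_on (tensor D D) (tensor D D) (\<lambda>s. tmul D D (mul D) (mul D) (tflip D D s) R)"
    by (intro bilinear_on_comp[OF M] tflip_linear vsp_D R_in)
  then show "linear_on D (tensor D D) (\<lambda>t. tmul D D (mul D) (mul D) (tflip D D (comul D t)) R)"
    using comul_D_linear by (rule linear_on_comp)
  show "linear_on D (tensor D D) (\<lambda>t. tmul D D (mul D) (mul D) R (comul D t))"
    by (intro bilinear_on_comp[OF M] comul_D_linear R_in)
  fix h f assume f: "hopf.lf f"
  show "tmul D D (mul D) (mul D) (tflip D D (comul D (E h f))) R = tmul D D (mul D) (mul D) R (comul D (E h f))"
  proof (rule DD_eqI)
    show "tmul D D (mul D) (mul D) (tflip D D (comul D (E h f))) R \<in> carr (tensor D D)"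
      by (intro linear_onD(1)[OF lin1] comul_D_in E_in f)
    show "tmul D D (mul D) (mul D) R (comul D (E h f)) \<in> carr (tensor D D)"
      by (intro bilinear_onD(3)[OF M] comul_D_in E_in f R_in)
    fix \<phi> x \<psi> y assume \<phi>: "hopf.lf \<phi>" "hopf.lf \<psi>"
    let ?\<phi> = "\<lambda>z. \<phi> (\<alpha> (\<alpha> z))" and ?\<psi> = "\<lambda>z. \<psi> (\<alpha> (\<alpha> z))" and ?x = "\<beta> (\<beta> x)" and ?y = "\<beta> (\<beta> y)"
    have \<phi>': "hopf.lf ?\<phi>" "hopf.lf ?\<psi>" by (intro lf_\<alpha> \<phi>)+
    have shift: "hopf.lf (\<lambda>z. f (a \<odot> z))" for a
      by (intro hopf.lf_o[OF f] hopf.lin)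
    have L1: "linear_on (tensor D D) base_field (\<lambda>s. ev2 \<phi> x \<psi> y (tmul D D (mul D) (mul D) (tflip D D s) R))"
      using ev2_linear[OF \<phi>] lin1 by (rule linear_on_comp)
    have L2: "linear_on (tensor D D) base_field (\<lambda>s. ev2 \<phi> x \<psi> y (tmul D D (mul D) (mul D) R s))"
      by (intro linear_on_comp[OF ev2_linear] bilinear_onD(1)[OF M] \<phi> R_in)
    have R_left: "ev2 \<phi> x \<psi> y (tmul D D (mul D) (mul D) (tens D D s s') R) = (\<Sum>i\<in>I.
      ev \<phi> x (mul D s (E (\<alpha> u) (\<lambda>z. c i (\<beta> z)))) * ev \<psi> y (mul D s' (E (\<alpha> (hopf.T (e i))) (\<lambda>z. \<epsilon> (\<beta> z)))))"
      if s: "s \<in> carr D" "s' \<in> carr D" for s s'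
    proof -
      have L: "linear_on (tensor D D) base_field (\<lambda>t. ev2 \<phi> x \<psi> y (tmul D D (mul D) (mul D) (tens D D s s') t))"
        by (intro linear_on_comp[OF ev2_linear] bilinear_onD(1)[OF M] \<phi> tens_in s)
      show ?thesis unfolding R_twist
        using s by (subst linear_on_sum[OF is_vsp_tensor L])
          (simp_all add: tens_in E_in lf_simps Mt ev2_tens \<phi> mul_D_in)
    qed
    have R_right: "ev2 \<phi> x \<psi> y (tmul D D (mul D) (mul D) R (tens D D s s')) = (\<Sum>i\<in>I.
      ev \<phi> x (mul D (E (\<alpha> u) (\<lambda>z. c i (\<beta> z))) s) * ev \<psi> y (mul D (E (\<alpha> (hopf.T (e i))) (\<lambda>z. \<epsilon> (\<beta> z))) s'))"
      if s: "s \<in> carr D" "s' \<in> carr D" for s s'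
    proof -
      have L: "linear_on (tensor D D) base_field (\<lambda>t. ev2 \<phi> x \<psi> y (tmul D D (mul D) (mul D) t (tens D D s s')))"
        by (intro linear_on_comp[OF ev2_linear] bilinear_onD(2)[OF M] \<phi> tens_in s)
      show ?thesis unfolding R_twist
        using s by (subst linear_on_sum[OF is_vsp_tensor L])
          (simp_all add: tens_in E_in lf_simps Mt ev2_tens \<phi> mul_D_in)
    qed
    have "ev2 \<phi> x \<psi> y (tmul D D (mul D) (mul D) (tflip D D (comul D (E h f))) R) =
      hopf.sw (\<lambda>h1 h2. \<Sum>j\<in>I. \<Sum>i\<in>I. hopf.dm ?\<phi> ?x h2 (\<lambda>z. f (e j \<odot> z)) u (c i) *
         hopf.dm ?\<psi> ?y h1 (c j) (hopf.T (e i)) \<epsilon>) h"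
    proof -
      have "ev \<phi> x (mul D (E (\<alpha> h2) (\<lambda>z. f (e j \<odot> \<beta> z))) (E (\<alpha> k) (\<lambda>z. c i (\<beta> z)))) =
        hopf.dm ?\<phi> ?x h2 (\<lambda>z. f (e j \<odot> z)) k (c i)" for h2 k i j
        using ev_mul_E_twist[OF \<phi>(1) shift lf_c] .
      then show ?thesis
        using ev_mul_E_twist[OF \<phi>(2) lf_c lf_\<epsilon>]
        by (simp add: linear_on_comul_E[OF L1 f] tflip_tens vsp_D E_in lf_simps f R_left)
    qed
    also have "\<dots> = hopf.sw (\<lambda>h1 h2. ?\<phi> h2 * hopf.sw (\<lambda>a b. ?\<psi> (hopf.T a \<odot> h1) * f (b \<odot> ?y)) ?x) h"
      by (subst sum.swap) (simp add: hopf.dm_R_left[OF \<phi>' f])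
    also have "\<dots> = hopf.sw (\<lambda>h1 h2. \<Sum>i\<in>I. \<Sum>j\<in>I. hopf.dm ?\<phi> ?x u (c i) h1 (c j) *
         hopf.dm ?\<psi> ?y (hopf.T (e i)) \<epsilon> h2 (\<lambda>z. f (e j \<odot> z))) h"
      by (rule hopf.dm_R_right[OF \<phi>' f, symmetric])
    also have "\<dots> = ev2 \<phi> x \<psi> y (tmul D D (mul D) (mul D) R (comul D (E h f)))"
    proof -
      have "ev \<psi> y (mul D (E (\<alpha> k) (\<lambda>z. \<epsilon> (\<beta> z))) (E (\<alpha> h2) (\<lambda>z. f (e j \<odot> \<beta> z)))) =
        hopf.dm ?\<psi> ?y k \<epsilon> h2 (\<lambda>z. f (e j \<odot> z))" for h2 k j
        using ev_mul_E_twist[OF \<phi>(2) lf_\<epsilon> shift] .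
      then show ?thesis
        using ev_mul_E_twist[OF \<phi>(1) lf_c lf_c]
        by (subst sum.swap) (simp add: linear_on_comul_E[OF L2 f] E_in lf_simps f R_right)
    qed
    finally show "ev2 \<phi> x \<psi> y (tmul D D (mul D) (mul D) (tflip D D (comul D (E h f))) R) =
       ev2 \<phi> x \<psi> y (tmul D D (mul D) (mul D) R (comul D (E h f)))" .
  qed
qed

lemma bilinear_on_mul3: "bilinear_on (tensor D (tensor D D)) (tensor D (tensor D D)) (tensor D (tensor D D)) (mul3 D)"
  unfolding mul3_def by (intro bilinear_on_tmul vsp_D is_vsp_tensor bilinear_on_mul_D)

lemma mul3_tens:
  assumes "a \<in> carr D" "b \<in> carr D" "s \<in> carr D" "a' \<in> carr D" "b' \<in> carr D" "s' \<in> carr D"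
  shows "mul3 D (tens D (tensor D D) a (tens D D b s)) (tens D (tensor D D) a' (tens D D b' s')) =
    tens D (tensor D D) (mul D a a') (tens D D (mul D b b') (mul D s s'))"
  unfolding mul3_def using assms
  by (simp add: tmul_tens[OF vsp_D is_vsp_tensor bilinear_on_mul_D bilinear_on_tmul[OF vsp_D vsp_D bilinear_on_mul_D bilinear_on_mul_D]]
      tens_in tmul_tens[OF vsp_D vsp_D bilinear_on_mul_D bilinear_on_mul_D])

lemma one_D_in: "one D \<in> carr D"
  by (simp add: one_D E_in lf_\<epsilon>)

lemma R_legs:
  "R12 D R = (\<Sum>i\<in>I. tens D (tensor D D) (E u (c i)) (tens D D (E (hopf.T (e i)) \<epsilon>) (one D)))"
  "R13 D R = (\<Sum>i\<in>I. tens D (tensor D D) (E u (c i)) (tens D D (one D) (E (hopf.T (e i)) \<epsilon>)))"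
  "R23 D R = (\<Sum>i\<in>I. tens D (tensor D D) (one D) (tens D D (E u (c i)) (E (hopf.T (e i)) \<epsilon>)))"
proof -
  note B = bilinear_on_comp[OF bilinear_on_tens[OF vsp_D vsp_D]]
    bilinear_on_comp[OF bilinear_on_tens[OF vsp_D is_vsp_tensor]]
  have 12: "bilinear_on D D (tensor D (tensor D D)) (\<lambda>r r'. tens D (tensor D D) r (tens D D r' (one D)))"
    by (intro bilinear_onI B linear_on_id tens_in one_D_in)
  have 13: "bilinear_on D D (tensor D (tensor D D)) (\<lambda>r r'. tens D (tensor D D) r (tens D D (one D) r'))"
    by (intro bilinear_onI B linear_on_id tens_in one_D_in)
  have 23: "bilinear_on D D (tensor D (tensor D D)) (\<lambda>r r'. tens D (tensor D D) (one D) (tens D D r r'))"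
    by (intro bilinear_onI B linear_on_id tens_in one_D_in)
  note L = linear_on_R[OF tlift_linear[OF vsp_D vsp_D is_vsp_tensor]]
  note T = tlift_tens[OF vsp_D vsp_D is_vsp_tensor]
  show "R12 D R = (\<Sum>i\<in>I. tens D (tensor D D) (E u (c i)) (tens D D (E (hopf.T (e i)) \<epsilon>) (one D)))"
    unfolding R12_def by (simp add: L[OF 12] T[OF 12] E_in lf_c lf_\<epsilon>)
  show "R13 D R = (\<Sum>i\<in>I. tens D (tensor D D) (E u (c i)) (tens D D (one D) (E (hopf.T (e i)) \<epsilon>)))"
    unfolding R13_def by (simp add: L[OF 13] T[OF 13] E_in lf_c lf_\<epsilon>)
  show "R23 D R = (\<Sum>i\<in>I. tens D (tensor D D) (one D) (tens D D (E u (c i)) (E (hopf.T (e i)) \<epsilon>)))"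
    unfolding R23_def by (simp add: L[OF 23] T[OF 23] E_in lf_c lf_\<epsilon>)
qed

lemma mul3_sum:
  assumes "\<And>i. i \<in> J \<Longrightarrow> s i \<in> carr (tensor D (tensor D D))" "\<And>j. j \<in> K \<Longrightarrow> t j \<in> carr (tensor D (tensor D D))"
  shows "mul3 D (\<Sum>i\<in>J. s i) (\<Sum>j\<in>K. t j) = (\<Sum>i\<in>J. \<Sum>j\<in>K. mul3 D (s i) (t j))"
  using assms by (simp add: linear_on_sum[OF is_vsp_tensor bilinear_onD(2)[OF bilinear_on_mul3]]
    linear_on_sum[OF is_vsp_tensor bilinear_onD(1)[OF bilinear_on_mul3]] carr_sum[OF is_vsp_tensor])
    (rule sum.swap)

lemma mul_one_D: "t \<in> carr D \<Longrightarrow> mul D t (one D) = twist D t" "t \<in> carr D \<Longrightarrow> mul D (one D) t = twist D t"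
  using hom_algebra.mul_one[OF hom_algebra_D] hom_algebra.one_mul[OF hom_algebra_D] by blast+

text \<open>\<open>T\<close> is a homomorphism into the opposite algebra, which is how the double
  multiplies its first factor; the coproduct on the dual leg evaluates a functional at
  \<open>\<beta> x \<odot> \<beta> y\<close>. The inverse antipode in \<open>R\<close> is what makes
  the orders agree.\<close>

lemma comul_twist_R_D:
  "tassoc D D D (tmap D D (tensor D D) D (comul D) (twist D) R) = mul3 D (R13 D R) (R23 D R)"
proof (rule DDD_eqI)
  have lin: "linear_on (tensor D D) (tensor D (tensor D D)) (\<lambda>t. tassoc D D D (tmap D D (tensor D D) D (comul D) (twist D) t))"
    by (intro linear_on_comp[OF tassoc_linear] tmap_linear vsp_D is_vsp_tensor comul_D_linear twist_D_linear)
  show "tassoc D D D (tmap D D (tensor D D) D (comul D) (twist D) R) \<in> carr (tensor D (tensor D D))"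
    by (intro linear_onD(1)[OF lin] R_in)
  have eq: "mul3 D (R13 D R) (R23 D R) = (\<Sum>i\<in>I. \<Sum>j\<in>I. tens D (tensor D D) (twist D (E u (c i)))
      (tens D D (twist D (E u (c j))) (mul D (E (hopf.T (e i)) \<epsilon>) (E (hopf.T (e j)) \<epsilon>))))"
    unfolding R_legs by (simp add: mul3_sum mul3_tens tens_in E_in one_D_in lf_c lf_\<epsilon> mul_one_D)
  show "mul3 D (R13 D R) (R23 D R) \<in> carr (tensor D (tensor D D))"
    unfolding eq by (intro carr_sum is_vsp_tensor tens_in twist_D_in mul_D_in E_in lf_c lf_\<epsilon>)
  fix \<phi> x \<psi> y \<chi> z assume \<phi>: "hopf.lf \<phi>" "hopf.lf \<psi>" "hopf.lf \<chi>"
  note [hopf.lin] = hopf.lf_o[OF \<phi>(3)]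
  have "ev3 \<phi> x \<psi> y \<chi> z (tassoc D D D (tmap D D (tensor D D) D (comul D) (twist D) R)) =
     \<phi> u * \<psi> u * \<epsilon> z * (\<Sum>i\<in>I. c i (\<beta> x \<odot> \<beta> y) * \<chi> (\<alpha> (hopf.T (e i))))"
    by (simp add: linear_on_R[OF ev3_tassoc_tmap(1)] ev3_tassoc_tmap(2) \<phi> E_in lf_c lf_\<epsilon> ev2_comul_E ev_twist_E
        hopf.sw_u hopf.lin hopf.lf_o[OF \<phi>(1)] hopf.lf_o[OF \<phi>(2)] hopf.\<alpha>_u hopf.\<epsilon>_\<beta> sum_distrib_left mult_ac)
  also have "\<dots> = \<phi> u * \<psi> u * \<epsilon> z * \<chi> (\<alpha> (hopf.T (\<beta> y) \<odot> hopf.T (\<beta> x)))"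
    by (subst hopf.expand_lf) (simp_all add: hopf.lin hopf.T_m)
  also have "\<dots> = \<phi> u * \<psi> u * \<epsilon> z * (\<Sum>i\<in>I. c i (\<beta> x) * (\<Sum>j\<in>I. c j (\<beta> y) * \<chi> (\<alpha> (hopf.T (e j) \<odot> hopf.T (e i)))))"
    using hopf.expand_lf(1)[of "\<lambda>w. \<chi> (\<alpha> (hopf.T w \<odot> hopf.T _))" "\<beta> y"]
      hopf.expand_lf(1)[of "\<lambda>w. \<chi> (\<alpha> (hopf.T (\<beta> y) \<odot> hopf.T w))" "\<beta> x"]
    by (simp add: hopf.lin)
  also have "\<dots> = ev3 \<phi> x \<psi> y \<chi> z (mul3 D (R13 D R) (R23 D R))"
    unfolding eq
    by (simp add: ev3_sum \<phi> carr_sum[OF is_vsp_tensor] tens_in twist_D_in mul_D_in E_in lf_c lf_\<epsilon> ev3_tens ev2_tens ev_twist_E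
        ev_mul_E hopf.dm_\<epsilon> lf_\<alpha> hopf.\<alpha>_u hopf.\<epsilon>_\<beta> sum_distrib_left mult_ac)
  finally show "ev3 \<phi> x \<psi> y \<chi> z (tassoc D D D (tmap D D (tensor D D) D (comul D) (twist D) R)) =
    ev3 \<phi> x \<psi> y \<chi> z (mul3 D (R13 D R) (R23 D R))" .
qed

text \<open>\<open>T\<close> reverses the coproduct of \<open>e i\<close>, which matches the order
  of the factors \<open>R13\<close> and \<open>R12\<close>; \<open>sum_conv\<close> identifies the
  convolution of two dual basis functionals with that coproduct.\<close>

lemma twist_comul_R_D:
  "tmap D D D (tensor D D) (twist D) (comul D) R = mul3 D (R13 D R) (R12 D R)"
proof (rule DDD_eqI)
  have lin: "linear_on (tensor D D) (tensor D (tensor D D)) (tmap D D D (tensor D D) (twist D) (comul D))"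
    by (intro tmap_linear vsp_D is_vsp_tensor comul_D_linear twist_D_linear)
  show "tmap D D D (tensor D D) (twist D) (comul D) R \<in> carr (tensor D (tensor D D))"
    by (intro linear_onD(1)[OF lin] R_in)
  have eq: "mul3 D (R13 D R) (R12 D R) = (\<Sum>i\<in>I. \<Sum>j\<in>I. tens D (tensor D D) (mul D (E u (c i)) (E u (c j)))
      (tens D D (twist D (E (hopf.T (e j)) \<epsilon>)) (twist D (E (hopf.T (e i)) \<epsilon>))))"
    unfolding R_legs by (simp add: mul3_sum mul3_tens tens_in E_in one_D_in lf_c lf_\<epsilon> mul_one_D)
  show "mul3 D (R13 D R) (R12 D R) \<in> carr (tensor D (tensor D D))"
    unfolding eq by (intro carr_sum is_vsp_tensor tens_in twist_D_in mul_D_in E_in lf_c lf_\<epsilon>)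
  fix \<phi> x \<psi> y \<chi> z assume \<phi>: "hopf.lf \<phi>" "hopf.lf \<psi>" "hopf.lf \<chi>"
  note [hopf.lin] = hopf.lf_o[OF \<phi>(2)] hopf.lf_o[OF \<phi>(3)]
  have "ev3 \<phi> x \<psi> y \<chi> z (tmap D D D (tensor D D) (twist D) (comul D) R) =
     \<phi> u * \<epsilon> y * \<epsilon> z * (\<Sum>i\<in>I. c i (\<beta> x) * hopf.sw (\<lambda>a b. \<chi> (\<alpha> (hopf.T a)) * \<psi> (\<alpha> (hopf.T b))) (e i))"
    by (simp add: linear_on_R[OF ev3_tassoc_tmap(3)] ev3_tassoc_tmap(4) \<phi> E_in lf_c lf_\<epsilon> ev2_comul_E ev_twist_E
        hopf.sw_T hopf.lin hopf.\<alpha>_u hopf.\<epsilon>_\<beta> hopf.\<epsilon>_m sum_distrib_left mult_ac)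
  also have "\<dots> = \<phi> u * \<epsilon> y * \<epsilon> z * hopf.sw (\<lambda>a b. \<chi> (\<alpha> (hopf.T a)) * \<psi> (\<alpha> (hopf.T b))) (\<beta> x)"
    by (subst hopf.expand_lf) (simp_all add: hopf.lin)
  also have "\<dots> = \<phi> u * \<epsilon> y * \<epsilon> z * (\<Sum>i\<in>I. \<Sum>j\<in>I. hopf.conv (c i) (c j) (\<beta> x) *
     (\<chi> (\<alpha> (hopf.T (e i))) * \<psi> (\<alpha> (hopf.T (e j)))))"
    by (subst hopf.sum_conv) (simp_all add: hopf.lin)
  also have "\<dots> = ev3 \<phi> x \<psi> y \<chi> z (mul3 D (R13 D R) (R12 D R))"
    unfolding eq
    by (simp add: ev3_sum \<phi> carr_sum[OF is_vsp_tensor] tens_in twist_D_in mul_D_in E_in lf_c lf_\<epsilon> ev3_tens ev2_tens ev_twist_E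
        ev_mul_E hopf.dm_u lf_\<alpha> hopf.\<alpha>_u hopf.\<epsilon>_\<beta> sum_distrib_left mult_ac)
  finally show "ev3 \<phi> x \<psi> y \<chi> z (tmap D D D (tensor D D) (twist D) (comul D) R) =
    ev3 \<phi> x \<psi> y \<chi> z (mul3 D (R13 D R) (R12 D R))" .
qed

lemma quasitriangular_D: "quasitriangular_hom_bialgebra D R"
  by (intro quasitriangular_hom_bialgebra.intro hom_bialgebra_D quasitriangular_hom_bialgebra_axioms.intro
      R_in R_comul_D comul_twist_R_D twist_comul_R_D)

text \<open>The \<beta> hidden in \<open>E u (c i)\<close> is the twist of the dual on
  \<open>e' i\<close> in the statement, and in the other leg it disappears because \<epsilon> is
  invariant under \<beta>.\<close>

lemma R_eq: "R = (\<Sum>i\<in>I. tens D D (tens H Hd u (twist Hd (e' i))) (tens H Hd (inv S (e i)) \<epsilon>))"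
  unfolding R_def by (intro sum.cong refl) (simp add: E_def c_def hopf.T_def hopf.\<epsilon>_\<beta> dual_hom_def o_def)

end

theorem proposition2p19:
  fixes H :: "('k::field, 'h::ab_group_add) hom_data"
    and S :: "'h \<Rightarrow> 'h"
    and I :: "'i set"
    and e :: "'i \<Rightarrow> 'h"
    and e' :: "'i \<Rightarrow> 'h \<Rightarrow> 'k"
  assumes hopf: "hom_hopf_algebra H S"
    and whole_type: "carr H = UNIV"
    and bij_twist: "bij (twist H)"
    and basis: "inj_on e I" "finite_dimensional_vector_space (smul H) (e ` I)"
    and dual_basis: "\<And>i. i \<in> I \<Longrightarrow> e' i \<in> carr (dual_hom H)"
      "\<And>i j. i \<in> I \<Longrightarrow> j \<in> I \<Longrightarrow> e' i (e j) = (if i = j then 1 else 0)"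
  shows "quasitriangular_hom_bialgebra (drinfeld_double H S)
    (\<Sum>i\<in>I. tens (drinfeld_double H S) (drinfeld_double H S)
       (tens H (dual_hom H) (one H) (twist (dual_hom H) (e' i)))
       (tens H (dual_hom H) (inv S (e i)) (counit H)))"
proof -
  interpret hom_hopf_basis H S I e e'
    by (intro hom_hopf_basis.intro hom_hopf_basis_axioms.intro hopf whole_type bij_twist basis dual_basis)
  show ?thesis
    using quasitriangular_D unfolding R_eq .
qed

end
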